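(* Let $G$ be a $\tau$-group of nilpotency class $c$ such that $\Gamma_c(G)$ has rank at least $2$. Then no Jennings embedding of $G$ into a unitriangular group $UT_d(\mathbb{Z})$ (for any choice of Mal'cev basis and any ordering of the basis of $\mathfrak{R}G/I^{c+1}$ making the representation unitriangular) has undistorted image.
   Context: A $\tau$-group is a finitely generated torsion-free non-abelian nilpotent group; $\Gamma_1(G)=G$, $\Gamma_{i+1}(G)=[\Gamma_i(G),G]$, and the class $c$ is the least $c$ with $\Gamma_{c+1}(G)=1$; the rank of the free abelian group $\Gamma_c(G)$ is its number of free generators. $\tau_i(G)$ is the isolator $\{g: g^k\in\Gamma_i(G)\text{ for some }k\ge1\}$. Jennings embedding: let $n=c+1$, $\mathfrak{R}$ a field of characteristic $0$, $I$ the augmentation ideal of $\mathfrak{R}G$. Refine $G=\tau_1(G)>\dots>\tau_n(G)=1$ to a series with infinite cyclic factors $G=G_0>\dots>G_M=1$ and choose $x_i$ with $G_{i-1}=\langle x_i,G_i\rangle$ (a Mal'cev basis). Put $u_i=1-x_i$, $\mu(u_i)=k$ iff $x_i\in\tau_k(G)\setminus\tau_{k+1}(G)$. The cosets of products $u_1^{r_1}\cdots u_M^{r_M}$ with $\sum r_i\mu(u_i)\le n-1$ form a basis of $\mathfrak{R}G/I^n$; $G$ acts faithfully by right multiplication via integer matrices, and an ordering of the basis making all matrices upper unitriangular gives an embedding $G\to UT_d(\mathbb{Z})$, $d=\dim\mathfrak{R}G/I^n$. The image is undistorted if the distortion function $\Delta_H^K(n)=\max\{dist_H(1,h): h\in H,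 dist_K(1,h)\le n\}$ (word metrics) satisfies $\Delta_H^K(n)\le Cn$ for some constant $C$. *)

theory Defs
  imports "HOL-Algebra.Algebra" "HOL-Library.Function_Algebras"
begin

definition gcomm :: "('a, 'b) monoid_scheme \<Rightarrow> 'a \<Rightarrow> 'a \<Rightarrow> 'a" where
  "gcomm G x y = inv\<^bsub>G\<^esub> x \<otimes>\<^bsub>G\<^esub> inv\<^bsub>G\<^esub> y \<otimes>\<^bsub>G\<^esub> x \<otimes>\<^bsub>G\<^esub> y"

definition comm_subgroup :: "('a, 'b) monoid_scheme \<Rightarrow> 'a set \<Rightarrow> 'a set \<Rightarrow> 'a set" where
  "comm_subgroup G A B = generate G {gcomm G x y | x y. x \<in> A \<and> y \<in> B}"

text \<open>lcs G k is Gamma_(k+1)(G), i.e. lcs G 0 = G.\<close>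
primrec lcs :: "('a, 'b) monoid_scheme \<Rightarrow> nat \<Rightarrow> 'a set" where
  "lcs G 0 = carrier G"
| "lcs G (Suc k) = comm_subgroup G (lcs G k) (carrier G)"

text \<open>Gamma G i = Gamma_i(G), for i >= 1.\<close>
definition Gamma :: "('a, 'b) monoid_scheme \<Rightarrow> nat \<Rightarrow> 'a set" where
  "Gamma G i = lcs G (i - 1)"

definition tau :: "('a, 'b) monoid_scheme \<Rightarrow> nat \<Rightarrow> 'a set" where
  "tau G i = {g \<in> carrier G. \<exists>k::nat. k \<ge> 1 \<and> g [^]\<^bsub>G\<^esub> k \<in> Gamma G i}"

definition fin_gen_group :: "('a, 'b) monoid_scheme \<Rightarrow> bool" where
  "fin_gen_group G \<longleftrightarrow> (\<exists>S. finite S \<and> S \<subseteq> carrier G \<and> generate G S = carrier G)"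

definition torsion_free :: "('a, 'b) monoid_scheme \<Rightarrow> bool" where
  "torsion_free G \<longleftrightarrow> (\<forall>x \<in> carrier G. \<forall>k::nat. k \<ge> 1 \<longrightarrow> x [^]\<^bsub>G\<^esub> k = \<one>\<^bsub>G\<^esub> \<longrightarrow> x = \<one>\<^bsub>G\<^esub>)"

definition nilpotent_group :: "('a, 'b) monoid_scheme \<Rightarrow> bool" where
  "nilpotent_group G \<longleftrightarrow> (\<exists>c. Gamma G (c + 1) = {\<one>\<^bsub>G\<^esub>})"

definition nil_class :: "('a, 'b) monoid_scheme \<Rightarrow> nat \<Rightarrow> bool" where
  "nil_class G c \<longleftrightarrow> Gamma G (c + 1) = {\<one>\<^bsub>G\<^esub>} \<and> (\<forall>k < c. Gamma G (k + 1) \<noteq> {\<one>\<^bsub>G\<^esub>})"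

definition tau_group :: "('a, 'b) monoid_scheme \<Rightarrow> bool" where
  "tau_group G \<longleftrightarrow> group G \<and> fin_gen_group G \<and> torsion_free G \<and> nilpotent_group G
     \<and> \<not> (\<forall>x \<in> carrier G. \<forall>y \<in> carrier G. x \<otimes>\<^bsub>G\<^esub> y = y \<otimes>\<^bsub>G\<^esub> x)"

definition free_abelian_basis :: "('a, 'b) monoid_scheme \<Rightarrow> 'a set \<Rightarrow> 'a list \<Rightarrow> bool" where
  "free_abelian_basis G H bs \<longleftrightarrow> distinct bs \<and> set bs \<subseteq> H \<and>
     (\<forall>h \<in> H. \<exists>!e::nat \<Rightarrow> int. (\<forall>i \<ge> length bs. e i = 0) \<and>
        h = foldr (\<lambda>i acc. (bs ! i) [^]\<^bsub>G\<^esub> (e i) \<otimes>\<^bsub>G\<^esub> acc) [0..<length bs] \<one>\<^bsub>G\<^esub>)"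

text \<open>With xs = [x_1,...,x_M], the series term G_i is generated by x_(i+1),...,x_M
  (0-indexed list), so G_(i-1) = <x_i, G_i> and G_M = 1.\<close>
definition mseries :: "('a, 'b) monoid_scheme \<Rightarrow> 'a list \<Rightarrow> nat \<Rightarrow> 'a set" where
  "mseries G xs i = generate G (set (drop i xs))"

definition malcev_basis :: "('a, 'b) monoid_scheme \<Rightarrow> nat \<Rightarrow> 'a list \<Rightarrow> bool" where
  "malcev_basis G n xs \<longleftrightarrow> set xs \<subseteq> carrier G \<and> mseries G xs 0 = carrier G \<and>
     (\<forall>i < length xs.
        (\<forall>g \<in> mseries G xs i. \<forall>h \<in> mseries G xs (Suc i).
            g \<otimes>\<^bsub>G\<^esub> h \<otimes>\<^bsub>G\<^esub> inv\<^bsub>G\<^esub> g \<in> mseries G xs (Suc i))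
      \<and> (\<forall>m::int. m \<noteq> 0 \<longrightarrow> (xs ! i) [^]\<^bsub>G\<^esub> m \<notin> mseries G xs (Suc i))) \<and>
     (\<forall>k \<in> {1..n}. \<exists>i \<le> length xs. tau G k = mseries G xs i)"

definition mu :: "('a, 'b) monoid_scheme \<Rightarrow> 'a list \<Rightarrow> nat \<Rightarrow> nat" where
  "mu G xs i = (THE k. k \<ge> 1 \<and> xs ! i \<in> tau G k \<and> xs ! i \<notin> tau G (k + 1))"

definition gsupp :: "('a \<Rightarrow> 'k::zero) \<Rightarrow> 'a set" where
  "gsupp f = {x. f x \<noteq> 0}"

definition group_alg :: "('a, 'b) monoid_scheme \<Rightarrow> ('a \<Rightarrow> 'k::field) set" where
  "group_alg G = {f. finite (gsupp f) \<and> gsupp f \<subseteq> carrier G}"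

definition gconv :: "('a, 'b) monoid_scheme \<Rightarrow> ('a \<Rightarrow> 'k::field) \<Rightarrow> ('a \<Rightarrow> 'k) \<Rightarrow> 'a \<Rightarrow> 'k" where
  "gconv G f h = (\<lambda>z. \<Sum>x \<in> gsupp f. \<Sum>y \<in> gsupp h. if x \<otimes>\<^bsub>G\<^esub> y = z then f x * h y else 0)"

definition gdelta :: "'a \<Rightarrow> 'a \<Rightarrow> 'k::field" where
  "gdelta g = (\<lambda>z. if z = g then 1 else 0)"

definition aug_ideal :: "('a, 'b) monoid_scheme \<Rightarrow> ('a \<Rightarrow> 'k::field) set" where
  "aug_ideal G = {f \<in> group_alg G. (\<Sum>x \<in> gsupp f. f x) = 0}"

primrec aug_pow :: "('a, 'b) monoid_scheme \<Rightarrow> nat \<Rightarrow> ('a \<Rightarrow> 'k::field) set" where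
  "aug_pow G 0 = group_alg G"
| "aug_pow G (Suc m) = {sum_list (map (\<lambda>p. gconv G (fst p) (snd p)) ps) | ps.
        \<forall>p \<in> set ps. fst p \<in> aug_pow G m \<and> snd p \<in> aug_ideal G}"

definition uelt :: "('a, 'b) monoid_scheme \<Rightarrow> 'a list \<Rightarrow> nat \<Rightarrow> 'a \<Rightarrow> 'k::field" where
  "uelt G xs i = gdelta \<one>\<^bsub>G\<^esub> - gdelta (xs ! i)"

definition umon :: "('a, 'b) monoid_scheme \<Rightarrow> 'a list \<Rightarrow> nat list \<Rightarrow> 'a \<Rightarrow> 'k::field" where
  "umon G xs r = foldr (gconv G)
      (concat (map (\<lambda>i. replicate (r ! i) (uelt G xs i)) [0..<length xs])) (gdelta \<one>\<^bsub>G\<^esub>)"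

text \<open>index set of the basis of RG/I^n: exponent vectors with sum r_i mu(u_i) <= n-1\<close>
definition jidx :: "('a, 'b) monoid_scheme \<Rightarrow> nat \<Rightarrow> 'a list \<Rightarrow> nat list set" where
  "jidx G n xs = {r. length r = length xs \<and> (\<Sum>i < length xs. r ! i * mu G xs i) \<le> n - 1}"

definition jcoef :: "('a, 'b) monoid_scheme \<Rightarrow> nat \<Rightarrow> 'a list \<Rightarrow> 'a \<Rightarrow> nat list \<Rightarrow> nat list \<Rightarrow> 'k::field" where
  "jcoef G n xs g r = (THE a. (\<forall>s. s \<notin> jidx G n xs \<longrightarrow> a s = 0) \<and>
      gconv G (umon G xs r) (gdelta g) - (\<Sum>s \<in> jidx G n xs. (\<lambda>z. a s * umon G xs s z))
        \<in> aug_pow G n)"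

text \<open>matrix (d x d, zero outside) of right multiplication by g, basis ordered by sigma\<close>
definition jmat :: "('a, 'b) monoid_scheme \<Rightarrow> nat \<Rightarrow> 'a list \<Rightarrow> (nat \<Rightarrow> nat list) \<Rightarrow> 'a \<Rightarrow> nat \<Rightarrow> nat \<Rightarrow> 'k::field" where
  "jmat G n xs \<sigma> g = (\<lambda>i j. if i < card (jidx G n xs) \<and> j < card (jidx G n xs)
        then jcoef G n xs g (\<sigma> i) (\<sigma> j) else 0)"

definition upper_unitri :: "nat \<Rightarrow> (nat \<Rightarrow> nat \<Rightarrow> 'k::field) \<Rightarrow> bool" where
  "upper_unitri d A \<longleftrightarrow> (\<forall>i < d. A i i = 1 \<and> (\<forall>j < i. A i j = 0))"

definition jennings_ordering :: "'k::field itself \<Rightarrow> ('a, 'b) monoid_scheme \<Rightarrow> nat \<Rightarrow> 'a list \<Rightarrow> (nat \<Rightarrow> nat list) \<Rightarrow> bool" where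
  "jennings_ordering _ G n xs \<sigma> \<longleftrightarrow>
     bij_betw \<sigma> {0..<card (jidx G n xs)} (jidx G n xs) \<and>
     (\<forall>g \<in> carrier G. upper_unitri (card (jidx G n xs)) (jmat G n xs \<sigma> g :: nat \<Rightarrow> nat \<Rightarrow> 'k))"

definition matmul :: "nat \<Rightarrow> (nat \<Rightarrow> nat \<Rightarrow> 'k::field) \<Rightarrow> (nat \<Rightarrow> nat \<Rightarrow> 'k) \<Rightarrow> nat \<Rightarrow> nat \<Rightarrow> 'k" where
  "matmul d A B = (\<lambda>i j. \<Sum>k < d. A i k * B k j)"

definition matone :: "nat \<Rightarrow> nat \<Rightarrow> nat \<Rightarrow> 'k::field" where
  "matone d = (\<lambda>i j. if i = j \<and> i < d then 1 else 0)"

text \<open>UT_d(Z), realised as integer matrices inside d x d matrices over the field\<close>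
definition UTZ :: "nat \<Rightarrow> (nat \<Rightarrow> nat \<Rightarrow> 'k::field) monoid" where
  "UTZ d = \<lparr> carrier = {A. upper_unitri d A \<and> (\<forall>i j. A i j \<in> \<int>) \<and>
                          (\<forall>i j. d \<le> i \<or> d \<le> j \<longrightarrow> A i j = 0)},
            monoid.mult = matmul d, one = matone d \<rparr>"

definition words_of :: "('a, 'b) monoid_scheme \<Rightarrow> 'a set \<Rightarrow> 'a list set" where
  "words_of K S = {ws. set ws \<subseteq> S \<union> (m_inv K ` S)}"

definition wprod :: "('a, 'b) monoid_scheme \<Rightarrow> 'a list \<Rightarrow> 'a" where
  "wprod K ws = foldr (monoid.mult K) ws \<one>\<^bsub>K\<^esub>"

definition generates :: "('a, 'b) monoid_scheme \<Rightarrow> 'a set \<Rightarrow> 'a set \<Rightarrow> bool" where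
  "generates K S H \<longleftrightarrow> (\<forall>h \<in> H. \<exists>ws \<in> words_of K S. wprod K ws = h)"

definition wlen :: "('a, 'b) monoid_scheme \<Rightarrow> 'a set \<Rightarrow> 'a \<Rightarrow> nat" where
  "wlen K S h = (LEAST m. \<exists>ws \<in> words_of K S. length ws = m \<and> wprod K ws = h)"

text \<open>H (a finitely generated subgroup of the finitely generated group K) is undistorted:
  Delta_H^K(m) <= C m for all m, for word metrics of finite generating sets.\<close>
definition undistorted :: "('a, 'b) monoid_scheme \<Rightarrow> 'a set \<Rightarrow> bool" where
  "undistorted K H \<longleftrightarrow> (\<exists>S T. finite S \<and> S \<subseteq> H \<and> generates K S H \<and>
      finite T \<and> T \<subseteq> carrier K \<and> generates K T (carrier K) \<and>
      (\<exists>C::nat. \<forall>m. \<forall>h \<in> H. wlen K T h \<le> m \<longrightarrow> wlen K S h \<le> C * m))"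

end

theory Submission
  imports Defs
begin

text \<open>
  Write \<open>t\<^sub>i\<close> for the coordinates of \<open>G\<close> with respect to the Mal'cev basis. Since
  \<open>[\<tau>\<^sub>j, \<tau>\<^sub>k] \<subseteq> \<tau>\<^sub>j\<^sub>+\<^sub>k\<close>, the function \<open>t\<^sub>i\<close> is polynomial of degree at most \<open>\<mu>\<^sub>i\<close>, so the
  products of binomial coefficients \<open>\<Prod>\<^sub>i (t\<^sub>i choose s\<^sub>i)\<close> of weight at most \<open>c\<close> vanish on \<open>I\<close> to the power \<open>c + 1\<close>. They
  are dual, up to sign, to the monomials in the \<open>u\<^sub>i\<close>; this gives Jennings' basis theorem, integrality and
  explicit matrix entries.

  If \<open>\<mu>\<^sub>i = c\<close>, then the image of a power of \<open>x\<^sub>i\<close> is a transvection whose only off-diagonal entry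
  sits in the row of \<open>1\<close> and the column of \<open>u\<^sub>i\<close>. As \<open>u\<^sub>i\<close> lies in \<open>I\<close> to the power \<open>c\<close> and every factor from \<open>I\<close>
  moves strictly up in the ordering, this column is at distance at least \<open>c\<close> from the diagonal. Rank at least
  two provides two such columns, so one is at distance \<open>p \<ge> c + 1\<close>. The transvection with entry
  \<open>N\<^sup>p\<close> has length \<open>O(N)\<close> in the unitriangular group, by iterated commutators, whereas
  \<open>t\<^sub>i\<close> is bounded by a multiple of \<open>L\<^sup>c\<close> on words of length \<open>L\<close> in \<open>G\<close>.
\<close>

section \<open>Central series and isolators\<close>

text \<open>Both \<open>mu\<close> and \<open>jcoef\<close> are definite descriptions, so nothing is
  known about the matrices until the weights are shown to exist and the monomials to form a basis
  modulo I^(c+1). Uniqueness of coefficients comes from the dual functionals, existence from a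
  spanning argument that runs down the Mal'cev series and keeps the factors of each product in
  order. The obstacle to polynomial coordinates is that splitting off the leading factor is not a
  homomorphism: right multiplication by a power of \<open>xs ! i\<close> conjugates the rest.
  Because commutators of isolators add weights, this conjugation moves an element of weight k only
  by an element of weight k + mu_i, and so costs nothing in degree. Adding weights requires the
  isolators to be subgroups, which the Mal'cev basis supplies, each of them being a term of its
  series. Characteristic 0 enters when roots are extracted: it carries membership in powers of I
  over from Gamma_k to its isolator, so that u_i lies in I to the power mu_i.\<close>

declare lcs.simps(2) [simp del]

context group
begin

lemma inv_cancel_left [simp]:
  "x \<in> carrier G \<Longrightarrow> y \<in> carrier G \<Longrightarrow> x \<otimes> (inv x \<otimes> y) = y"
  "x \<in> carrier G \<Longrightarrow> y \<in> carrier G \<Longrightarrow> inv x \<otimes> (x \<otimes> y) = y"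
  by (simp_all flip: m_assoc)

lemma gcomm_closed [simp]: "x \<in> carrier G \<Longrightarrow> y \<in> carrier G \<Longrightarrow> gcomm G x y \<in> carrier G"
  by (simp add: gcomm_def)

lemma gcomm_eq_one_iff:
  assumes "x \<in> carrier G" "y \<in> carrier G"
  shows "gcomm G x y = \<one> \<longleftrightarrow> x \<otimes> y = y \<otimes> x"
proof -
  have "gcomm G x y = inv (y \<otimes> x) \<otimes> (x \<otimes> y)"
    using assms by (simp add: gcomm_def m_assoc inv_mult_group)
  then show ?thesis
    using assms by (metis inv_equality inv_inv inv_closed l_inv m_closed)
qed

lemma inv_gcomm:
  "x \<in> carrier G \<Longrightarrow> y \<in> carrier G \<Longrightarrow> inv (gcomm G x y) = gcomm G y x"
  by (simp add: gcomm_def m_assoc inv_mult_group)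

lemma gcomm_conj:
  assumes "x \<in> carrier G" "y \<in> carrier G" "g \<in> carrier G"
  shows "g \<otimes> gcomm G x y \<otimes> inv g = gcomm G (g \<otimes> x \<otimes> inv g) (g \<otimes> y \<otimes> inv g)"
  using assms by (simp add: gcomm_def m_assoc inv_mult_group)

lemma normal_conj_mem:
  assumes "N \<lhd> G" "n \<in> N" "g \<in> carrier G"
  shows "g \<otimes> n \<otimes> inv g \<in> N" "inv g \<otimes> n \<otimes> g \<in> N"
  using normal.inv_op_closed2[OF assms(1,3,2)] normal.inv_op_closed1[OF assms(1,3,2)] by auto

lemma lcs_normal: "lcs G k \<lhd> G"
proof (induction k)
  case 0
  show ?case
    by (simp add: normal_invI subgroup_self)
next
  case (Suc k)
  then have sub: "lcs G k \<subseteq> carrier G"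
    by (simp add: normal_imp_subgroup subgroup.subset)
  show ?case
    unfolding lcs.simps(2) comm_subgroup_def
  proof (rule normal_generateI)
    show "{gcomm G x y |x y. x \<in> lcs G k \<and> y \<in> carrier G} \<subseteq> carrier G"
      using sub by auto
    fix h g assume "h \<in> {gcomm G x y |x y. x \<in> lcs G k \<and> y \<in> carrier G}" and g: "g \<in> carrier G"
    then obtain x y where xy: "h = gcomm G x y" "x \<in> lcs G k" "y \<in> carrier G"
      by blast
    then have "g \<otimes> h \<otimes> inv g = gcomm G (g \<otimes> x \<otimes> inv g) (g \<otimes> y \<otimes> inv g)"
      using gcomm_conj g sub by blast
    moreover have "g \<otimes> x \<otimes> inv g \<in> lcs G k"
      using normal_conj_mem(1)[OF Suc] xy g by blast
    ultimately show "g \<otimes> h \<otimes> inv g \<in> {gcomm G x y |x y. x \<in> lcs G k \<and> y \<in> carrier G}"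
      using xy g by blast
  qed
qed

lemma lcs_subgroup: "subgroup (lcs G k) G"
  by (rule normal_imp_subgroup[OF lcs_normal])

lemma lcs_subset: "lcs G k \<subseteq> carrier G"
  by (rule subgroup.subset[OF lcs_subgroup])

lemma gcomm_lcs_Suc: "x \<in> lcs G k \<Longrightarrow> y \<in> carrier G \<Longrightarrow> gcomm G x y \<in> lcs G (Suc k)"
  unfolding lcs.simps(2) comm_subgroup_def by (rule generate.incl) blast

lemma lcs_Suc_subset: "lcs G (Suc k) \<subseteq> lcs G k"
  unfolding lcs.simps(2) comm_subgroup_def
proof (rule generate_subgroup_incl[OF _ lcs_subgroup], safe)
  fix x y assume xy: "x \<in> lcs G k" "y \<in> carrier G"
  then have "inv x \<otimes> (inv y \<otimes> x \<otimes> y) \<in> lcs G k"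
    using normal_conj_mem(2)[OF lcs_normal] lcs_subgroup
    by (meson subgroup.m_closed subgroup.m_inv_closed)
  moreover have "x \<in> carrier G"
    using xy lcs_subset by blast
  ultimately show "gcomm G x y \<in> lcs G k"
    using xy by (simp add: gcomm_def m_assoc)
qed

lemma lcs_antimono: "i \<le> j \<Longrightarrow> lcs G j \<subseteq> lcs G i"
  by (rule lift_Suc_antimono_le[of "lcs G"]) (use lcs_Suc_subset in auto)

text \<open>The identity already holds in the free group on three letters, so plain cancellation
  proves it. It supplies the three subgroups argument below.\<close>

lemma hall_witt:
  assumes "x \<in> carrier G" "y \<in> carrier G" "z \<in> carrier G"
  shows "(inv y \<otimes> gcomm G (gcomm G x (inv y)) z \<otimes> y)
    \<otimes> (inv z \<otimes> gcomm G (gcomm G y (inv z)) x \<otimes> z)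
    \<otimes> (inv x \<otimes> gcomm G (gcomm G z (inv x)) y \<otimes> x) = \<one>"
  using assms by (simp add: gcomm_def m_assoc inv_mult_group)

lemma normal_conj_mem_iff:
  assumes "N \<lhd> G" "n \<in> carrier G" "g \<in> carrier G"
  shows "inv g \<otimes> n \<otimes> g \<in> N \<longleftrightarrow> n \<in> N"
proof
  assume "inv g \<otimes> n \<otimes> g \<in> N"
  then have "g \<otimes> (inv g \<otimes> n \<otimes> g) \<otimes> inv g \<in> N"
    using normal_conj_mem assms by blast
  then show "n \<in> N"
    using assms by (simp add: m_assoc)
qed (use normal_conj_mem assms in blast)

text \<open>Three subgroups argument: for a generator y = [b, g] the Hall-Witt identity expresses a
  conjugate of [[b, g], x] through conjugates of [[g^-1, x^-1], b] and [[x, b^-1], g^-1], and both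
  lie in the normal subgroup by induction. As \<open>lcs G j\<close> is Gamma_(j+1), the index
  carries a successor.\<close>

lemma gcomm_lcs_lcs:
  "x \<in> lcs G j \<Longrightarrow> y \<in> lcs G k \<Longrightarrow> gcomm G x y \<in> lcs G (Suc (j + k))"
proof (induction k arbitrary: j x y)
  case 0
  then show ?case
    using gcomm_lcs_Suc by simp
next
  case (Suc k)
  let ?N = "lcs G (Suc (j + Suc k))"
  interpret N: normal ?N G
    by (rule lcs_normal)
  have a: "x \<in> carrier G"
    using Suc lcs_subset by blast
  have gens: "{gcomm G b g |b g. b \<in> lcs G k \<and> g \<in> carrier G} \<subseteq> carrier G"
    using lcs_subset[of k] by auto
  have base: "gcomm G x (gcomm G b g) \<in> ?N" if b: "b \<in> lcs G k" and g: "g \<in> carrier G" for b g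
  proof -
    have bc: "b \<in> carrier G"
      using b lcs_subset by blast
    \<comment> \<open>The inner commutator sits one level deeper than x, so the induction hypothesis
      is used with \<open>Suc j\<close>; this is why j is generalised.\<close>
    have 1: "gcomm G (gcomm G (inv g) (inv x)) b \<in> ?N"
    proof -
      have "gcomm G (inv x) (inv g) \<in> lcs G (Suc j)"
        using Suc.prems(1) g by (intro gcomm_lcs_Suc subgroup.m_inv_closed[OF lcs_subgroup]) auto
      then have "inv (gcomm G (inv x) (inv g)) \<in> lcs G (Suc j)"
        by (rule subgroup.m_inv_closed[OF lcs_subgroup])
      then have "gcomm G (inv g) (inv x) \<in> lcs G (Suc j)"
        using a g by (simp add: inv_gcomm)
      from Suc.IH[OF this b] show ?thesis
        by simp
    qed
    have 2: "gcomm G (gcomm G x (inv b)) (inv g) \<in> ?N"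
    proof -
      have "gcomm G x (inv b) \<in> lcs G (Suc (j + k))"
        using Suc.IH[OF Suc.prems(1)] b subgroup.m_inv_closed[OF lcs_subgroup] by blast
      then show ?thesis
        using gcomm_lcs_Suc g by (metis add_Suc_right inv_closed)
    qed
    define p q r where "p = inv (inv g) \<otimes> gcomm G (gcomm G b (inv (inv g))) x \<otimes> inv g"
      and "q = inv x \<otimes> gcomm G (gcomm G (inv g) (inv x)) b \<otimes> x"
      and "r = inv b \<otimes> gcomm G (gcomm G x (inv b)) (inv g) \<otimes> b"
    have "p \<otimes> q \<otimes> r = \<one>"
      unfolding p_def q_def r_def using hall_witt[of b "inv g" x] a bc g by simp
    moreover have "q \<in> ?N" "r \<in> ?N"
      unfolding q_def r_def using normal_conj_mem(2)[OF lcs_normal] 1 2 a bc by blast+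
    moreover have pc: "p \<in> carrier G"
      unfolding p_def using a bc g by simp
    ultimately have "p = inv (q \<otimes> r)"
      using N.mem_carrier inv_equality[of p "q \<otimes> r"] by (simp add: m_assoc)
    then have "p \<in> ?N"
      using \<open>q \<in> ?N\<close> \<open>r \<in> ?N\<close> by blast
    then have "gcomm G (gcomm G b g) x \<in> ?N"
      unfolding p_def using normal_conj_mem_iff[OF lcs_normal, of "gcomm G (gcomm G b g) x" "inv g"] a bc g by simp
    then have "inv (gcomm G (gcomm G b g) x) \<in> ?N"
      by blast
    then show ?thesis
      using a bc g by (simp add: inv_gcomm)
  qed
  from Suc.prems(2) have "y \<in> generate G {gcomm G b g |b g. b \<in> lcs G k \<and> g \<in> carrier G}"
    unfolding lcs.simps(2) comm_subgroup_def .
  then show ?case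
  proof (induction rule: generate.induct)
    case one
    then show ?case
      using a N.one_closed by (simp add: gcomm_def)
  next
    case (incl h)
    then show ?case
      using base by blast
  next
    case (inv h)
    then have h: "h \<in> carrier G" "gcomm G x h \<in> ?N"
      using gens base by blast+
    have "gcomm G x (inv h) = h \<otimes> inv (gcomm G x h) \<otimes> inv h"
      using a h(1) by (simp add: gcomm_def m_assoc inv_mult_group)
    then show ?case
      using normal_conj_mem(1)[OF lcs_normal N.m_inv_closed[OF h(2)] h(1)] by simp
  next
    case (eng h1 h2)
    then have h: "h1 \<in> carrier G" "h2 \<in> carrier G"
      using generate_in_carrier[OF gens] by blast+
    then have "gcomm G x (h1 \<otimes> h2) = gcomm G x h2 \<otimes> (inv h2 \<otimes> gcomm G x h1 \<otimes> h2)"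
      using a by (simp add: gcomm_def m_assoc inv_mult_group)
    then show ?case
      using normal_conj_mem(2)[OF lcs_normal eng.IH(1) h(2)] eng.IH(2) by (metis N.m_closed)
  qed
qed

section \<open>Roots in torsion-free nilpotent groups and commutators of isolators\<close>

lemma inv_comm_of_comm:
  assumes "a \<in> carrier G" "b \<in> carrier G" "b \<otimes> a = a \<otimes> b"
  shows "inv a \<otimes> b = b \<otimes> inv a"
proof -
  have "inv a \<otimes> b = inv a \<otimes> (b \<otimes> a) \<otimes> inv a"
    using assms(1,2) by (simp add: m_assoc)
  also have "\<dots> = inv a \<otimes> (a \<otimes> b) \<otimes> inv a"
    by (simp add: assms(3))
  also have "\<dots> = b \<otimes> inv a"
    using assms(1,2) by (simp add: m_assoc)
  finally show ?thesis .
qed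

lemma comm_of_conj_eq:
  assumes "a \<in> carrier G" "b \<in> carrier G" "inv b \<otimes> a \<otimes> b = a"
  shows "a \<otimes> b = b \<otimes> a"
proof -
  have "a \<otimes> b = b \<otimes> (inv b \<otimes> a \<otimes> b)"
    using assms(1,2) by (simp add: m_assoc)
  then show ?thesis
    by (simp add: assms(3))
qed

lemma eq_of_inv_mult_one:
  assumes "a \<in> carrier G" "b \<in> carrier G" "inv a \<otimes> b = \<one>"
  shows "a = b"
  using assms inv_equality[of "inv a" b] by (metis inv_closed inv_inv)

lemma conj_pow:
  assumes "x \<in> carrier G" "y \<in> carrier G"
  shows "(inv y \<otimes> x \<otimes> y) [^] (m::nat) = inv y \<otimes> x [^] m \<otimes> y"
proof (induction m)
  case 0
  show ?case
    using assms by simp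
next
  case (Suc m)
  have "(inv y \<otimes> x \<otimes> y) [^] Suc m = (inv y \<otimes> x [^] m \<otimes> y) \<otimes> (inv y \<otimes> x \<otimes> y)"
    by (simp only: nat_pow_Suc Suc)
  also have "\<dots> = inv y \<otimes> x [^] Suc m \<otimes> y"
    using assms by (simp add: m_assoc)
  finally show ?case .
qed

text \<open>Downward induction along the central series: if $b \in aL_i$ and $a^m = b^m$, then
  $b^{-1}ab \in aL_{i+1}$ has the same $m$-th power as $a$.\<close>
lemma unique_roots:
  fixes L :: "nat \<Rightarrow> 'a set"
  assumes L0: "L 0 = carrier G"
    and Lc: "L c = {\<one>}"
    and comm: "\<And>i x y. x \<in> carrier G \<Longrightarrow> y \<in> L i \<Longrightarrow> gcomm G x y \<in> L (Suc i)"
    and tf: "torsion_free G"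
    and m: "(m::nat) \<ge> 1"
    and ab: "a \<in> carrier G" "b \<in> carrier G" "a [^] m = b [^] m"
  shows "a = b"
proof -
  have "\<forall>a b. a \<in> carrier G \<longrightarrow> b \<in> carrier G \<longrightarrow> inv a \<otimes> b \<in> L (c - i)
      \<longrightarrow> a [^] m = b [^] m \<longrightarrow> a = b" if "i \<le> c" for i
    using that
  proof (induction i)
    case 0
    then show ?case
      by (auto simp: Lc intro: eq_of_inv_mult_one)
  next
    case (Suc i)
    have S: "Suc (c - Suc i) = c - i"
      using Suc.prems by simp
    show ?case
    proof (intro allI impI)
      fix a b assume A: "a \<in> carrier G" "b \<in> carrier G" "inv a \<otimes> b \<in> L (c - Suc i)"
        "a [^] m = b [^] m"
      have "gcomm G a (inv a \<otimes> b) \<in> L (c - i)"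
        using comm[OF A(1,3)] S by simp
      moreover have "gcomm G a (inv a \<otimes> b) = inv a \<otimes> (inv b \<otimes> a \<otimes> b)"
        using A by (simp add: gcomm_def m_assoc inv_mult_group)
      moreover have "(inv b \<otimes> a \<otimes> b) [^] m = a [^] m"
      proof -
        have "b [^] m \<otimes> b = b \<otimes> b [^] m"
          using A(2) nat_pow_Suc2 by auto
        then show ?thesis
          using A by (simp add: conj_pow, simp add: m_assoc)
      qed
      ultimately have "a = inv b \<otimes> a \<otimes> b"
        using Suc.IH Suc.prems A by simp
      \<comment> \<open>Once a and b commute, the m-th power of a^-1 b is the quotient of equal
        powers, and torsion-freeness applies.\<close>
      then have "b \<otimes> a = a \<otimes> b"
        using A comm_of_conj_eq[of a b] by simp
      then have "inv a \<otimes> b = b \<otimes> inv a"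
        using A inv_comm_of_comm by blast
      then have "(inv a \<otimes> b) [^] m = inv a [^] m \<otimes> b [^] m"
        using A pow_mult_distrib by simp
      also have "\<dots> = \<one>"
        using A by (metis l_inv nat_pow_closed nat_pow_inv)
      finally have "inv a \<otimes> b = \<one>"
        using tf m A by (simp add: torsion_free_def)
      then show "a = b"
        using A eq_of_inv_mult_one by blast
    qed
  qed
  then show ?thesis
    using ab L0 by (metis diff_self_eq_0 inv_closed le_refl m_closed)
qed

text \<open>The conjugate of a by b has the same m-th power as a, so uniqueness of roots identifies
  the two.\<close>

lemma commute_of_pow_commute:
  fixes L :: "nat \<Rightarrow> 'a set"
  assumes L: "L 0 = carrier G" "L c = {\<one>}"
      "\<And>i x y. x \<in> carrier G \<Longrightarrow> y \<in> L i \<Longrightarrow> gcomm G x y \<in> L (Suc i)" "torsion_free G"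
    and m: "(m::nat) \<ge> 1"
    and ab: "a \<in> carrier G" "b \<in> carrier G" "a [^] m \<otimes> b = b \<otimes> a [^] m"
  shows "a \<otimes> b = b \<otimes> a"
proof -
  have "(inv b \<otimes> a \<otimes> b) [^] m = a [^] m"
    using ab by (simp add: conj_pow, simp add: m_assoc)
  with unique_roots[OF L m, of "inv b \<otimes> a \<otimes> b" a] ab have "inv b \<otimes> a \<otimes> b = a"
    by simp
  then show ?thesis
    using ab comm_of_conj_eq by blast
qed

lemma tau_antimono: "1 \<le> i \<Longrightarrow> i \<le> j \<Longrightarrow> tau G j \<subseteq> tau G i"
  unfolding tau_def Gamma_def using subsetD[OF lcs_antimono[OF diff_le_mono[of i j 1]]]
  by blast

lemma Gamma_subset_tau: "Gamma G i \<subseteq> tau G i"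
proof
  fix x assume x: "x \<in> Gamma G i"
  then have "x \<in> carrier G" "x [^] (1::nat) \<in> Gamma G i"
    using lcs_subset[of "i - 1"] by (auto simp: Gamma_def)
  then show "x \<in> tau G i"
    unfolding tau_def by blast
qed

lemma tau_isolated:
  assumes "x \<in> carrier G" "(m::nat) \<ge> 1" "x [^] m \<in> tau G i"
  shows "x \<in> tau G i"
proof -
  obtain k :: nat where "k \<ge> 1" "(x [^] m) [^] k \<in> Gamma G i"
    using assms by (auto simp: tau_def)
  then have "m * k \<ge> 1" "x [^] (m * k) \<in> Gamma G i"
    using assms by (auto simp: nat_pow_pow)
  then show ?thesis
    using assms unfolding tau_def by blast
qed

text \<open>Powers commute with conjugation and \<open>Gamma G i\<close> is normal. The subgroup
  property is assumed here and later supplied by the Mal'cev series.\<close>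

lemma tau_normal:
  assumes "subgroup (tau G i) G"
  shows "tau G i \<lhd> G"
proof (rule normal_invI[OF assms])
  fix x h assume x: "x \<in> carrier G" and h: "h \<in> tau G i"
  then obtain k :: nat where k: "k \<ge> 1" "h [^] k \<in> Gamma G i" "h \<in> carrier G"
    by (auto simp: tau_def)
  have "(x \<otimes> h \<otimes> inv x) [^] k = x \<otimes> h [^] k \<otimes> inv x"
    using conj_pow[of h "inv x" k] x k by simp
  then have "(x \<otimes> h \<otimes> inv x) [^] k \<in> Gamma G i"
    using normal_conj_mem(1)[OF lcs_normal] k x by (simp add: Gamma_def)
  then show "x \<otimes> h \<otimes> inv x \<in> tau G i"
    using k x by (auto simp: tau_def)
qed

text \<open>The quotient by \<open>tau G (i + j)\<close> is nilpotent, and torsion-free because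
  isolators are closed under roots. Powers of a and b that lie in Gamma_i and Gamma_j commute there,
  and \<open>commute_of_pow_commute\<close> removes the two exponents one after the other.\<close>

lemma gcomm_tau:
  assumes sub: "subgroup (tau G (i + j)) G"
    and nil: "lcs G c = {\<one>}"
    and ij: "i \<ge> 1" "j \<ge> 1"
    and ab: "a \<in> tau G i" "b \<in> tau G j"
  shows "gcomm G a b \<in> tau G (i + j)"
proof -
  have c: "a \<in> carrier G" "b \<in> carrier G"
    using ab by (simp_all add: tau_def)
  obtain m :: nat where m: "m \<ge> 1" "a [^] m \<in> Gamma G i"
    using ab(1) unfolding tau_def by blast
  obtain n :: nat where n: "n \<ge> 1" "b [^] n \<in> Gamma G j"
    using ab(2) unfolding tau_def by blast
  let ?N = "tau G (i + j)"
  let ?Q = "G Mod ?N"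
  let ?p = "\<lambda>x. ?N #> x"
  interpret N: normal ?N G
    by (rule tau_normal[OF sub])
  interpret Q: group ?Q
    by (rule N.factorgroup_is_group)
  have hom: "?p \<in> hom G ?Q"
    by (rule N.r_coset_hom_Mod)
  interpret p: group_hom G ?Q ?p
    by unfold_locales (rule hom)
  have car: "carrier ?Q = ?p ` carrier G"
    by (auto simp: FactGroup_def RCOSETS_def)
  have one_iff: "?p x = \<one>\<^bsub>?Q\<^esub> \<longleftrightarrow> x \<in> ?N" if "x \<in> carrier G" for x
    unfolding FactGroup_def using that coset_join1[OF _ that sub] coset_join2[OF that sub] by auto
  have p_gcomm: "?p (gcomm G x y) = gcomm ?Q (?p x) (?p y)" if "x \<in> carrier G" "y \<in> carrier G" for x y
    using that by (simp add: gcomm_def)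
  \<comment> \<open>The images of the lower central series form the central chain that
    \<open>commute_of_pow_commute\<close> asks for in the quotient.\<close>
  define L where "L k = ?p ` lcs G k" for k
  have L: "L 0 = carrier ?Q" "L c = {\<one>\<^bsub>?Q\<^esub>}"
    using car nil by (simp_all add: L_def)
  have Lcomm: "gcomm ?Q x y \<in> L (Suc k)" if xy: "x \<in> carrier ?Q" "y \<in> L k" for k x y
  proof -
    obtain x' y' where x': "x' \<in> carrier G" "x = ?p x'" and y': "y' \<in> lcs G k" "y = ?p y'"
      using xy car by (auto simp: L_def)
    have y'c: "y' \<in> carrier G"
      using y' lcs_subset by blast
    have "gcomm G x' y' \<in> lcs G (Suc k)"
      using gcomm_lcs_Suc[OF y'(1) x'(1)] subgroup.m_inv_closed[OF lcs_subgroup] inv_gcomm[OF y'c x'(1)]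
      by metis
    then show ?thesis
      using p_gcomm[OF x'(1) y'c] x' y' by (auto simp: L_def intro: rev_image_eqI)
  qed
  have tf: "torsion_free ?Q"
    unfolding torsion_free_def
  proof (intro ballI allI impI)
    fix x and k :: nat assume x: "x \<in> carrier ?Q" "1 \<le> k" "x [^]\<^bsub>?Q\<^esub> k = \<one>\<^bsub>?Q\<^esub>"
    then obtain x' where x': "x' \<in> carrier G" "x = ?p x'"
      using car by auto
    then have "x' [^] k \<in> ?N"
      using x one_iff[of "x' [^] k"] by (simp add: p.hom_nat_pow)
    then show "x = \<one>\<^bsub>?Q\<^esub>"
      using tau_isolated x x' one_iff by blast
  qed
  have comm: "x \<otimes>\<^bsub>?Q\<^esub> y = y \<otimes>\<^bsub>?Q\<^esub> x"
    if "x \<in> carrier ?Q" "y \<in> carrier ?Q" "k \<ge> 1" "x [^]\<^bsub>?Q\<^esub> k \<otimes>\<^bsub>?Q\<^esub> y = y \<otimes>\<^bsub>?Q\<^esub> x [^]\<^bsub>?Q\<^esub> k"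
    for x y and k :: nat
    by (rule Q.commute_of_pow_commute[where L = L and c = c and m = k]) (fact L Lcomm tf that)+
  have "gcomm G (a [^] m) (b [^] n) \<in> lcs G (Suc ((i - 1) + (j - 1)))"
    using gcomm_lcs_lcs m n by (simp add: Gamma_def)
  moreover have "Suc ((i - 1) + (j - 1)) = i + j - 1"
    using ij by simp
  ultimately have "gcomm G (a [^] m) (b [^] n) \<in> Gamma G (i + j)"
    unfolding Gamma_def by metis
  then have "gcomm G (a [^] m) (b [^] n) \<in> ?N"
    using Gamma_subset_tau by blast
  then have "gcomm ?Q (?p a [^]\<^bsub>?Q\<^esub> m) (?p b [^]\<^bsub>?Q\<^esub> n) = \<one>\<^bsub>?Q\<^esub>"
    using one_iff c p_gcomm by (metis gcomm_closed nat_pow_closed p.hom_nat_pow)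
  then have "?p a [^]\<^bsub>?Q\<^esub> m \<otimes>\<^bsub>?Q\<^esub> ?p b [^]\<^bsub>?Q\<^esub> n = ?p b [^]\<^bsub>?Q\<^esub> n \<otimes>\<^bsub>?Q\<^esub> ?p a [^]\<^bsub>?Q\<^esub> m"
    using Q.gcomm_eq_one_iff c by simp
  then have "?p a \<otimes>\<^bsub>?Q\<^esub> ?p b [^]\<^bsub>?Q\<^esub> n = ?p b [^]\<^bsub>?Q\<^esub> n \<otimes>\<^bsub>?Q\<^esub> ?p a"
    using comm[OF _ _ m(1)] c by (meson Q.nat_pow_closed p.hom_closed)
  then have "?p b \<otimes>\<^bsub>?Q\<^esub> ?p a = ?p a \<otimes>\<^bsub>?Q\<^esub> ?p b"
    using comm[OF _ _ n(1), of "?p b" "?p a"] c by (metis p.hom_closed)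
  then have "gcomm ?Q (?p a) (?p b) = \<one>\<^bsub>?Q\<^esub>"
    using Q.gcomm_eq_one_iff c by simp
  then show ?thesis
    using one_iff p_gcomm c by (metis gcomm_closed)
qed

end

section \<open>Weighted polynomial functions\<close>

text \<open>Degree less than \<open>m\<close> on \<open>H\<close> in the weighted sense: right differences by elements of \<open>T k\<close>
  lower the degree by \<open>k\<close>, and degree less than \<open>0\<close> means vanishing on \<open>H\<close>.\<close>
fun wpoly :: "('a, 'b) monoid_scheme \<Rightarrow> (nat \<Rightarrow> 'a set) \<Rightarrow> 'a set \<Rightarrow> nat \<Rightarrow> ('a \<Rightarrow> 'r::comm_ring_1) \<Rightarrow> bool" where
  "wpoly G T H 0 f \<longleftrightarrow> (\<forall>g\<in>H. f g = 0)"
| "wpoly G T H (Suc m) f \<longleftrightarrow>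
     (\<forall>k. \<forall>h\<in>H \<inter> T (Suc k). wpoly G T H (m - k) (\<lambda>g. f (g \<otimes>\<^bsub>G\<^esub> h) - f g))"

lemma (in monoid) foldr_mult_closed: "set us \<subseteq> carrier G \<Longrightarrow> foldr (\<otimes>) us \<one> \<in> carrier G"
  by (induction us) auto

lemma (in monoid) foldr_mult_acc:
  "set us \<subseteq> carrier G \<Longrightarrow> a \<in> carrier G \<Longrightarrow> foldr (\<otimes>) us a = foldr (\<otimes>) us \<one> \<otimes> a"
  by (induction us) (auto simp: m_assoc foldr_mult_closed)

context group
begin

context
  fixes T :: "nat \<Rightarrow> 'a set" and H :: "'a set"
  assumes H: "subgroup H G"
begin

lemma wpoly_cong:
  "(\<And>g. g \<in> H \<Longrightarrow> f g = f' g) \<Longrightarrow> wpoly G T H m f = wpoly G T H m f'"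
proof (induction m arbitrary: f f' rule: less_induct)
  case (less m)
  show ?case
  proof (cases m)
    case 0
    then show ?thesis
      using less.prems by simp
  next
    case (Suc p)
    have "wpoly G T H (p - k) (\<lambda>g. f (g \<otimes> h) - f g) = wpoly G T H (p - k) (\<lambda>g. f' (g \<otimes> h) - f' g)"
      if "h \<in> H" for h k
      using that Suc less.prems subgroup.m_closed[OF H] by (intro less.IH) auto
    then show ?thesis
      unfolding Suc wpoly.simps by blast
  qed
qed

lemma wpoly_zero: "wpoly G T H m (\<lambda>g. 0)"
  by (induction m rule: less_induct) (case_tac x; simp)

lemma wpoly_vanish:
  "(\<And>g. g \<in> H \<Longrightarrow> f g = 0) \<Longrightarrow> wpoly G T H m f"
  using wpoly_cong[of f "\<lambda>g. 0"] wpoly_zero by simp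

lemma wpoly_Suc: "wpoly G T H m f \<Longrightarrow> wpoly G T H (Suc m) f"
proof (induction m arbitrary: f rule: less_induct)
  case (less m)
  have "wpoly G T H (m - k) (\<lambda>g. f (g \<otimes> h) - f g)" if h: "h \<in> H \<inter> T (Suc k)" for k h
  proof (cases m)
    case 0
    then show ?thesis
      using less.prems h subgroup.m_closed[OF H] by simp
  next
    case (Suc p)
    then have d: "wpoly G T H (p - k) (\<lambda>g. f (g \<otimes> h) - f g)"
      using less.prems h by simp
    show ?thesis
    proof (cases "k \<le> p")
      case True
      then show ?thesis
        using less.IH[OF _ d] Suc by (simp add: Suc_diff_le)
    next
      case False
      then show ?thesis
        using d Suc by simp
    qed
  qed
  then show ?case
    by simp
qed

lemma wpoly_mono:
  assumes "wpoly G T H m f" "m \<le> m'"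
  shows "wpoly G T H m' f"
  using assms(2) by (induction rule: dec_induct) (use assms(1) wpoly_Suc in blast)+

lemma wpoly_add:
  "wpoly G T H m f \<Longrightarrow> wpoly G T H m f' \<Longrightarrow> wpoly G T H m (\<lambda>g. f g + f' g)"
proof (induction m arbitrary: f f' rule: less_induct)
  case (less m)
  show ?case
  proof (cases m)
    case 0
    then show ?thesis
      using less.prems by simp
  next
    case (Suc p)
    have "wpoly G T H (p - k) (\<lambda>g. f (g \<otimes> h) + f' (g \<otimes> h) - (f g + f' g))"
      if h: "h \<in> H \<inter> T (Suc k)" for k h
    proof -
      have "wpoly G T H (p - k) (\<lambda>g. (f (g \<otimes> h) - f g) + (f' (g \<otimes> h) - f' g))"
        using less.prems h Suc by (intro less.IH) auto
      then show ?thesis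
        by (simp add: algebra_simps)
    qed
    then show ?thesis
      using Suc by simp
  qed
qed

lemma wpoly_const: "wpoly G T H (Suc m) (\<lambda>g. a)"
  by (simp add: wpoly_zero)

context
  assumes HT: "H \<subseteq> T 1"
begin

lemma wpoly_rdiff: "wpoly G T H m f \<Longrightarrow> h \<in> H \<Longrightarrow> wpoly G T H (m - 1) (\<lambda>g. f (g \<otimes> h) - f g)"
proof (cases m)
  case 0
  assume "wpoly G T H m f" "h \<in> H"
  then show ?thesis
    using 0 subgroup.m_closed[OF H] by simp
next
  case (Suc p)
  assume A: "wpoly G T H m f" "h \<in> H"
  then have "h \<in> H \<inter> T (Suc 0)"
    using HT by auto
  then have "wpoly G T H (p - 0) (\<lambda>g. f (g \<otimes> h) - f g)"
    using A(1) unfolding Suc wpoly.simps by blast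
  then show ?thesis
    using Suc by simp
qed

lemma wpoly_translate:
  assumes "wpoly G T H m f" "h \<in> H"
  shows "wpoly G T H m (\<lambda>g. f (g \<otimes> h))"
proof -
  have "wpoly G T H m (\<lambda>g. f g + (f (g \<otimes> h) - f g))"
    using wpoly_add[OF assms(1) wpoly_mono[OF wpoly_rdiff[OF assms]]] by simp
  then show ?thesis
    by simp
qed

text \<open>Discrete Leibniz rule: a difference of the product is the difference of f times a
  translate of f', plus f times the difference of f'. With \<open>Suc\<close> in the bounds the
  degrees are at most a and b; once k reaches the degree of a factor, truncated subtraction gives
  the bound 0 and that summand vanishes on H.\<close>

lemma wpoly_mult:
  "wpoly G T H (Suc a) f \<Longrightarrow> wpoly G T H (Suc b) f' \<Longrightarrow> wpoly G T H (Suc (a + b)) (\<lambda>g. f g * f' g)"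
proof (induction "a + b" arbitrary: a b f f' rule: less_induct)
  case less
  have "wpoly G T H (a + b - k) (\<lambda>g. f (g \<otimes> h) * f' (g \<otimes> h) - f g * f' g)"
    if h: "h \<in> H \<inter> T (Suc k)" for k h
  proof -
    have d: "wpoly G T H (a - k) (\<lambda>g. f (g \<otimes> h) - f g)" "wpoly G T H (b - k) (\<lambda>g. f' (g \<otimes> h) - f' g)"
      using less.prems h by simp_all
    have tr: "wpoly G T H (Suc b) (\<lambda>g. f' (g \<otimes> h))"
      using wpoly_translate less.prems h by blast
    have 1: "wpoly G T H (a + b - k) (\<lambda>g. (f (g \<otimes> h) - f g) * f' (g \<otimes> h))"
    proof (cases "k < a")
      case True
      then have "a - k = Suc (a - Suc k)" "a - Suc k + b < a + b" "Suc (a - Suc k + b) = a + b - k"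
        by auto
      then show ?thesis
        using less.hyps[OF _ _ tr, of "a - Suc k"] d(1) by metis
    next
      case False
      then have "\<forall>g\<in>H. f (g \<otimes> h) - f g = 0"
        using d(1) by simp
      then show ?thesis
        by (intro wpoly_vanish) simp
    qed
    have 2: "wpoly G T H (a + b - k) (\<lambda>g. f g * (f' (g \<otimes> h) - f' g))"
    proof (cases "k < b")
      case True
      then have "b - k = Suc (b - Suc k)" "a + (b - Suc k) < a + b" "Suc (a + (b - Suc k)) = a + b - k"
        by auto
      then show ?thesis
        using less.hyps[OF _ less.prems(1), of "b - Suc k"] d(2) by metis
    next
      case False
      then have "\<forall>g\<in>H. f' (g \<otimes> h) - f' g = 0"
        using d(2) by simp
      then show ?thesis
        by (intro wpoly_vanish) simp
    qed
    show ?thesis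
      using wpoly_add[OF 1 2] by (simp add: algebra_simps)
  qed
  then show ?case
    by simp
qed

lemma wpoly_scale: "wpoly G T H m f \<Longrightarrow> wpoly G T H m (\<lambda>g. a * f g)"
  using wpoly_mult[OF wpoly_const[of 0 a], of "m - 1" f] by (cases m) auto

lemma wpoly_prod:
  assumes "finite A" "\<And>i. i \<in> A \<Longrightarrow> wpoly G T H (Suc (w i)) (F i)"
  shows "wpoly G T H (Suc (\<Sum>i\<in>A. w i)) (\<lambda>g. \<Prod>i\<in>A. F i g)"
  using assms
  by (induction A rule: finite_induct) (auto intro: wpoly_const wpoly_mult simp del: wpoly.simps)

context
  fixes \<alpha> :: "'a \<Rightarrow> 'a" and w :: nat
  assumes \<alpha>H: "\<And>g. g \<in> H \<Longrightarrow> \<alpha> g \<in> H"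
    and \<alpha>hom: "\<And>g h. g \<in> H \<Longrightarrow> h \<in> H \<Longrightarrow> \<alpha> (g \<otimes> h) = \<alpha> g \<otimes> \<alpha> h"
    and \<alpha>T: "\<And>h k. h \<in> H \<inter> T (Suc k) \<Longrightarrow> \<alpha> h \<in> T (Suc k)"
    and \<alpha>w: "\<And>h k. h \<in> H \<inter> T (Suc k) \<Longrightarrow> inv h \<otimes> \<alpha> h \<in> T (Suc (k + w))"
begin

lemma wpoly_compose: "wpoly G T H m f \<Longrightarrow> wpoly G T H m (\<lambda>g. f (\<alpha> g))"
proof (induction m arbitrary: f rule: less_induct)
  case (less m)
  show ?case
  proof (cases m)
    case 0
    then show ?thesis
      using less.prems \<alpha>H by simp
  next
    case (Suc p)
    have "wpoly G T H (p - k) (\<lambda>g. f (\<alpha> (g \<otimes> h)) - f (\<alpha> g))" if h: "h \<in> H \<inter> T (Suc k)" for k h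
    proof -
      have "\<alpha> h \<in> H \<inter> T (Suc k)"
        using h \<alpha>H \<alpha>T by blast
      then have "wpoly G T H (p - k) (\<lambda>g. f (g \<otimes> \<alpha> h) - f g)"
        using less.prems Suc by simp
      then have "wpoly G T H (p - k) (\<lambda>g. f (\<alpha> g \<otimes> \<alpha> h) - f (\<alpha> g))"
        using less.IH[of "p - k" "\<lambda>g. f (g \<otimes> \<alpha> h) - f g"] Suc by simp
      then show ?thesis
        using wpoly_cong[of "\<lambda>g. f (\<alpha> g \<otimes> \<alpha> h) - f (\<alpha> g)" "\<lambda>g. f (\<alpha> (g \<otimes> h)) - f (\<alpha> g)"] \<alpha>hom h by simp
    qed
    then show ?thesis
      using Suc by simp
  qed
qed

text \<open>A map that moves elements of weight k only by elements of weight k + w acts like a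
  difference of weight w. The intended case is conjugation by an element of weight w, where h^-1
  times the image of h is a commutator.\<close>

lemma wpoly_compose_diff: "wpoly G T H m f \<Longrightarrow> wpoly G T H (m - w) (\<lambda>g. f (\<alpha> g) - f g)"
proof (induction m arbitrary: f rule: less_induct)
  case (less m)
  let ?E = "\<lambda>g. f (\<alpha> g) - f g"
  show ?case
  proof (cases m)
    case 0
    then show ?thesis
      using less.prems \<alpha>H by simp
  next
    case (Suc p)
    have D: "wpoly G T H (p - w - k) (\<lambda>g. ?E (g \<otimes> h) - ?E g)" if h: "h \<in> H \<inter> T (Suc k)" for k h
    proof -
      \<comment> \<open>The image of g h is the image of g times h times \<open>?h\<close>, so the
        difference of \<open>?E\<close> splits in two: the induction hypothesis for the h-difference
        of f, and a \<open>?h\<close>-difference of f, where \<open>?h\<close> has weight w more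
        than h.\<close>
      let ?h = "inv h \<otimes> \<alpha> h"
      have hc: "h \<in> carrier G" "h \<in> H" "\<alpha> h \<in> H" "?h \<in> H"
        using h \<alpha>H subgroup.mem_carrier[OF H] subgroup.m_closed[OF H] subgroup.m_inv_closed[OF H] by auto
      have "wpoly G T H (p - k) (\<lambda>g. f (g \<otimes> h) - f g)"
        using less.prems h Suc by simp
      then have 1: "wpoly G T H (p - k - w) (\<lambda>g. (f (\<alpha> g \<otimes> h) - f (\<alpha> g)) - (f (g \<otimes> h) - f g))"
        using less.IH[of "p - k" "\<lambda>g. f (g \<otimes> h) - f g"] Suc by simp
      have "?h \<in> H \<inter> T (Suc (k + w))"
        using \<alpha>w[OF h] hc by blast
      then have "wpoly G T H (p - (k + w)) (\<lambda>g. f (g \<otimes> ?h) - f g)"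
        using less.prems Suc by simp
      then have "wpoly G T H (p - (k + w)) (\<lambda>g. f (g \<otimes> h \<otimes> ?h) - f (g \<otimes> h))"
        using wpoly_translate[OF _ hc(2), of _ "\<lambda>g. f (g \<otimes> ?h) - f g"] by simp
      then have 2: "wpoly G T H (p - (k + w)) (\<lambda>g. f (\<alpha> g \<otimes> h \<otimes> ?h) - f (\<alpha> g \<otimes> h))"
        using wpoly_compose[of _ "\<lambda>g. f (g \<otimes> h \<otimes> ?h) - f (g \<otimes> h)"] by simp
      have e: "p - k - w = p - w - k" "p - (k + w) = p - w - k"
        by auto
      have "wpoly G T H (p - w - k) (\<lambda>g. (f (\<alpha> g \<otimes> h) - f (\<alpha> g)) - (f (g \<otimes> h) - f g)
          + (f (\<alpha> g \<otimes> h \<otimes> ?h) - f (\<alpha> g \<otimes> h)))"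
        using wpoly_add[OF 1[unfolded e] 2[unfolded e]] .
      moreover have "(f (\<alpha> g \<otimes> h) - f (\<alpha> g)) - (f (g \<otimes> h) - f g)
          + (f (\<alpha> g \<otimes> h \<otimes> ?h) - f (\<alpha> g \<otimes> h)) = ?E (g \<otimes> h) - ?E g" if "g \<in> H" for g
      proof -
        have "\<alpha> g \<otimes> h \<otimes> ?h = \<alpha> (g \<otimes> h)"
          using that hc \<alpha>H \<alpha>hom subgroup.mem_carrier[OF H] by (simp add: m_assoc)
        then show ?thesis
          by simp
      qed
      ultimately show ?thesis
        using wpoly_cong by (metis (no_types, lifting))
    qed
    show ?thesis
    proof (cases "w \<le> p")
      case True
      then have "m - w = Suc (p - w)"
        using Suc by simp
      then show ?thesis
        using D by simp
    next
      \<comment> \<open>The claimed bound is now 0, so \<open>?E\<close> must vanish on H: its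
        differences do, and it is 0 at the identity.\<close>
      case False
      have one: "\<one> \<in> H" "\<alpha> \<one> = \<one>"
      proof -
        show "\<one> \<in> H"
          using H subgroup.one_closed by blast
        then have "\<alpha> \<one> \<otimes> \<alpha> \<one> = \<alpha> \<one>" "\<alpha> \<one> \<in> carrier G"
          using \<alpha>hom[of \<one> \<one>] \<alpha>H subgroup.mem_carrier[OF H] by auto
        then show "\<alpha> \<one> = \<one>"
          by (simp add: r_cancel_one)
      qed
      have "?E h = 0" if "h \<in> H" for h
      proof -
        have "h \<in> H \<inter> T (Suc 0)" "p - w = 0"
          using that HT False by auto
        then have "?E (\<one> \<otimes> h) - ?E \<one> = 0"
          using D[of h 0] one(1) by simp
        then show ?thesis
          using one that subgroup.mem_carrier[OF H] by simp
      qed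
      then show ?thesis
        by (intro wpoly_vanish) auto
    qed
  qed
qed

end

end

end

text \<open>Discrete integration: appending a letter on the right changes f by one of finitely many
  functions of degree less by one, and summing the increments over the prefixes of the word raises
  the exponent by one.\<close>

lemma wpoly_growth:
  fixes f :: "'a \<Rightarrow> int"
  assumes HT: "carrier G \<subseteq> T 1"
    and W: "finite W" "W \<subseteq> carrier G"
    and f: "wpoly G T (carrier G) (Suc m) f"
  shows "\<exists>C\<ge>0. \<forall>ws. set ws \<subseteq> W \<longrightarrow> \<bar>f (foldr (\<otimes>) ws \<one>)\<bar> \<le> C * (int (length ws) + 1) ^ m"
  using f
proof (induction m arbitrary: f)
  case 0
  have "f (foldr (\<otimes>) ws \<one>) = f \<one>" if "set ws \<subseteq> W" for ws
  proof -
    have "foldr (\<otimes>) ws \<one> \<in> carrier G"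
      using that W(2) foldr_mult_closed[of ws] by auto
    then have "wpoly G T (carrier G) (Suc 0 - 1) (\<lambda>g. f (g \<otimes> foldr (\<otimes>) ws \<one>) - f g)"
      by (rule wpoly_rdiff[OF subgroup_self HT 0])
    then have "f (\<one> \<otimes> foldr (\<otimes>) ws \<one>) - f \<one> = 0"
      by simp
    then show ?thesis
      using \<open>foldr (\<otimes>) ws \<one> \<in> carrier G\<close> by simp
  qed
  then show ?case
    by (intro exI[of _ "\<bar>f \<one>\<bar>"]) auto
next
  case (Suc m)
  have "\<exists>C\<ge>0. \<forall>ws. set ws \<subseteq> W \<longrightarrow>
      \<bar>f (foldr (\<otimes>) ws \<one> \<otimes> w) - f (foldr (\<otimes>) ws \<one>)\<bar> \<le> C * (int (length ws) + 1) ^ m"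
    if "w \<in> W" for w
  proof (rule Suc.IH)
    show "wpoly G T (carrier G) (Suc m) (\<lambda>g. f (g \<otimes> w) - f g)"
      using wpoly_rdiff[OF subgroup_self HT Suc.prems] that W(2) by auto
  qed
  then obtain C where C: "\<And>w. w \<in> W \<Longrightarrow> C w \<ge> 0" "\<And>w ws. w \<in> W \<Longrightarrow> set ws \<subseteq> W \<Longrightarrow>
      \<bar>f (foldr (\<otimes>) ws \<one> \<otimes> w) - f (foldr (\<otimes>) ws \<one>)\<bar> \<le> C w * (int (length ws) + 1) ^ m"
    by metis
  define B where "B = (\<Sum>w\<in>W. C w)"
  have B0: "B \<ge> 0"
    unfolding B_def using C(1) by (simp add: sum_nonneg)
  have CB: "C w \<le> B" if "w \<in> W" for w
    unfolding B_def using that W(1) C(1) by (intro member_le_sum) auto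
  have bound: "\<bar>f (foldr (\<otimes>) ws \<one>)\<bar> \<le> \<bar>f \<one>\<bar> + int (length ws) * (B * (int (length ws) + 1) ^ m)"
    if "set ws \<subseteq> W" for ws
    using that
  proof (induction ws rule: rev_induct)
    case (snoc w ws)
    have w: "w \<in> carrier G" "w \<in> W" "set ws \<subseteq> W"
      using snoc.prems W(2) by auto
    let ?n = "int (length ws)"
    have "\<bar>f (foldr (\<otimes>) ws \<one> \<otimes> w) - f (foldr (\<otimes>) ws \<one>)\<bar> \<le> B * (?n + 1) ^ m"
      by (rule order_trans[OF C(2)[OF w(2,3)] mult_right_mono[OF CB[OF w(2)]]]) simp
    moreover have "foldr (\<otimes>) (ws @ [w]) \<one> = foldr (\<otimes>) ws \<one> \<otimes> w"
      using foldr_mult_acc[of ws w] w W(2) by auto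
    ultimately have "\<bar>f (foldr (\<otimes>) (ws @ [w]) \<one>)\<bar> \<le> \<bar>f \<one>\<bar> + (?n + 1) * (B * (?n + 1) ^ m)"
      using snoc.IH[OF w(3)] by (simp add: algebra_simps)
    also have "\<dots> \<le> \<bar>f \<one>\<bar> + (?n + 1) * (B * (?n + 2) ^ m)"
      using B0 by (intro add_left_mono mult_left_mono power_mono) auto
    finally show ?case
      by (simp add: add.commute)
  qed simp
  show ?case
  proof (intro exI[of _ "\<bar>f \<one>\<bar> + B"] conjI allI impI)
    fix ws assume ws: "set ws \<subseteq> W"
    let ?n = "int (length ws) + 1"
    have "\<bar>f (foldr (\<otimes>) ws \<one>)\<bar> \<le> \<bar>f \<one>\<bar> * 1 + int (length ws) * (B * ?n ^ m)"
      using bound[OF ws] by simp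
    also have "\<dots> \<le> \<bar>f \<one>\<bar> * ?n ^ Suc m + ?n * (B * ?n ^ m)"
      using B0 by (intro add_mono mult_left_mono mult_right_mono one_le_power) auto
    finally show "\<bar>f (foldr (\<otimes>) ws \<one>)\<bar> \<le> (\<bar>f \<one>\<bar> + B) * ?n ^ Suc m"
      by (simp add: algebra_simps)
  qed (use B0 in auto)
qed

end

section \<open>Mal'cev coordinates\<close>

locale malcev_group = group G for G (structure) +
  fixes c :: nat and xs :: "'a list"
  assumes tau_group: "tau_group G"
    and nil_class: "nil_class G c"
    and malcev_basis: "malcev_basis G (c + 1) xs"
begin

abbreviation MS :: "nat \<Rightarrow> 'a set" where
  "MS i \<equiv> mseries G xs i"

lemma xs_carrier: "i < length xs \<Longrightarrow> xs ! i \<in> carrier G"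
  using malcev_basis by (auto simp: malcev_basis_def)

lemma MS_subgroup: "subgroup (MS i) G"
  unfolding mseries_def using malcev_basis
  by (intro generate_is_subgroup) (auto simp: malcev_basis_def dest: in_set_dropD)

lemma MS_carrier: "g \<in> MS i \<Longrightarrow> g \<in> carrier G"
  using subgroup.mem_carrier[OF MS_subgroup] by blast

lemma MS_0 [simp]: "MS 0 = carrier G"
  using malcev_basis by (simp add: malcev_basis_def)

lemma MS_length [simp]: "MS (length xs) = {\<one>}"
  by (simp add: mseries_def generate_empty)

lemma MS_antimono: "i \<le> j \<Longrightarrow> MS j \<subseteq> MS i"
  unfolding mseries_def by (intro mono_generate set_drop_subset_set_drop)

lemma one_MS [simp]: "\<one> \<in> MS i"
  using MS_subgroup subgroup.one_closed by blast

lemma xs_MS: "i < length xs \<Longrightarrow> xs ! i \<in> MS i"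
  unfolding mseries_def by (intro generate.incl) (simp flip: Cons_nth_drop_Suc)

lemma xs_pow_MS: "i < length xs \<Longrightarrow> xs ! i [^] (t::int) \<in> MS i"
  using subgroup_int_pow_closed[OF MS_subgroup xs_MS] .

lemma MS_conj: "i < length xs \<Longrightarrow> g \<in> MS i \<Longrightarrow> h \<in> MS (Suc i) \<Longrightarrow> g \<otimes> h \<otimes> inv g \<in> MS (Suc i)"
  using malcev_basis by (auto simp: malcev_basis_def)

lemma xs_pow_notin: "i < length xs \<Longrightarrow> m \<noteq> 0 \<Longrightarrow> xs ! i [^] (m::int) \<notin> MS (Suc i)"
  using malcev_basis by (auto simp: malcev_basis_def)

lemma MS_decomp:
  assumes i: "i < length xs" and g: "g \<in> MS i"
  shows "\<exists>t::int. \<exists>h\<in>MS (Suc i). g = xs ! i [^] t \<otimes> h"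
proof -
  let ?x = "xs ! i"
  note x = xs_carrier[OF i]
  have "set (drop i xs) = insert ?x (set (drop (Suc i) xs))"
    using i by (simp flip: Cons_nth_drop_Suc)
  then have "g \<in> generate G (insert ?x (set (drop (Suc i) xs)))"
    using g by (simp add: mseries_def)
  then show ?thesis
  proof (induction rule: generate.induct)
    case one
    have "\<one> = ?x [^] (0::int) \<otimes> \<one>"
      by simp
    then show ?case
      using one_MS by blast
  next
    case (incl h)
    show ?case
    proof (cases "h = ?x")
      case True
      then have "h = ?x [^] (1::int) \<otimes> \<one>"
        using x by (simp add: int_pow_1)
      then show ?thesis
        using one_MS by blast
    next
      case False
      then have "h \<in> MS (Suc i)"
        using incl unfolding mseries_def by (auto intro: generate.incl)
      moreover have "h = ?x [^] (0::int) \<otimes> h"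
        using MS_carrier[OF calculation] by simp
      ultimately show ?thesis
        by blast
    qed
  next
    case (inv h)
    show ?case
    proof (cases "h = ?x")
      case True
      then have "inv h = ?x [^] (-1::int) \<otimes> \<one>"
        using x by (simp add: int_pow_neg int_pow_1)
      then show ?thesis
        using one_MS by blast
    next
      case False
      then have "inv h \<in> MS (Suc i)"
        using inv unfolding mseries_def by (auto intro: generate.inv)
      moreover have "inv h = ?x [^] (0::int) \<otimes> inv h"
        using MS_carrier[OF calculation] by simp
      ultimately show ?thesis
        by blast
    qed
  next
    case (eng h1 h2)
    then obtain t1 t2 :: int and k1 k2 where k: "k1 \<in> MS (Suc i)" "h1 = ?x [^] t1 \<otimes> k1"
      "k2 \<in> MS (Suc i)" "h2 = ?x [^] t2 \<otimes> k2"
      by blast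
    have "?x [^] (- t2) \<otimes> k1 \<otimes> inv (?x [^] (- t2)) \<in> MS (Suc i)"
      using MS_conj[OF i xs_pow_MS[OF i] k(1)] .
    then have "?x [^] (- t2) \<otimes> k1 \<otimes> inv (?x [^] (- t2)) \<otimes> k2 \<in> MS (Suc i)"
      using k(3) subgroup.m_closed[OF MS_subgroup] by blast
    moreover have "h1 \<otimes> h2 = ?x [^] (t1 + t2) \<otimes> (?x [^] (- t2) \<otimes> k1 \<otimes> inv (?x [^] (- t2)) \<otimes> k2)"
      using x k MS_carrier by (simp add: int_pow_mult int_pow_neg m_assoc)
    ultimately show ?case
      by blast
  qed
qed

lemma MS_decomp_unique:
  assumes i: "i < length xs" and h: "h \<in> MS (Suc i)" "h' \<in> MS (Suc i)"
    and eq: "xs ! i [^] (t::int) \<otimes> h = xs ! i [^] (t'::int) \<otimes> h'"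
  shows "t = t'"
proof (rule ccontr)
  assume "t \<noteq> t'"
  let ?x = "xs ! i"
  note x = xs_carrier[OF i]
  have hc: "h \<in> carrier G" "h' \<in> carrier G"
    using h MS_carrier by auto
  have "?x [^] (t - t') = inv (?x [^] t') \<otimes> (?x [^] t \<otimes> h) \<otimes> inv h"
    using x hc by (simp add: m_assoc int_pow_mult[symmetric] int_pow_neg[symmetric])
  also have "\<dots> = h' \<otimes> inv h"
    unfolding eq using x hc by (simp add: m_assoc)
  also have "\<dots> \<in> MS (Suc i)"
    using h subgroup.m_closed[OF MS_subgroup] subgroup.m_inv_closed[OF MS_subgroup] by blast
  finally show False
    using xs_pow_notin[OF i, of "t - t'"] \<open>t \<noteq> t'\<close> by simp
qed

text \<open>Meaningful on \<open>MS i\<close>, where the exponent of the leading factor is unique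
  because the factors of the series are infinite cyclic.\<close>

definition tco :: "nat \<Rightarrow> 'a \<Rightarrow> int" where
  "tco i g = (THE t. \<exists>h\<in>MS (Suc i). g = xs ! i [^] t \<otimes> h)"

definition rho :: "nat \<Rightarrow> 'a \<Rightarrow> 'a" where
  "rho i g = inv (xs ! i [^] tco i g) \<otimes> g"

lemma tco_rho_eq:
  assumes "i < length xs" "h \<in> MS (Suc i)"
  shows "tco i (xs ! i [^] (t::int) \<otimes> h) = t" "rho i (xs ! i [^] (t::int) \<otimes> h) = h"
proof -
  show *: "tco i (xs ! i [^] (t::int) \<otimes> h) = t"
    unfolding tco_def using assms MS_decomp_unique by (intro the_equality) blast+
  show "rho i (xs ! i [^] (t::int) \<otimes> h) = h"
    unfolding rho_def * using assms xs_carrier MS_carrier by simp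
qed

lemma tco_rho:
  assumes "i < length xs" "g \<in> MS i"
  shows "g = xs ! i [^] tco i g \<otimes> rho i g" "rho i g \<in> MS (Suc i)"
  using MS_decomp[OF assms] tco_rho_eq[OF assms(1)] by auto

text \<open>Collecting leading factors on the left conjugates the rest of g by the leading factor of
  h. This twist is what makes the later coordinates nontrivial polynomials.\<close>

lemma tco_rho_mult:
  assumes i: "i < length xs" and g: "g \<in> MS i" and h: "h \<in> MS i"
  shows "tco i (g \<otimes> h) = tco i g + tco i h"
    and "rho i (g \<otimes> h) = inv (xs ! i [^] tco i h) \<otimes> rho i g \<otimes> xs ! i [^] tco i h \<otimes> rho i h"
proof -
  let ?x = "xs ! i" and ?k = "inv (xs ! i [^] tco i h) \<otimes> rho i g \<otimes> xs ! i [^] tco i h \<otimes> rho i h"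
  note x = xs_carrier[OF i]
  have c: "rho i g \<in> carrier G" "rho i h \<in> carrier G"
    using tco_rho(2) i g h MS_carrier by blast+
  have "g \<otimes> h = (?x [^] tco i g \<otimes> rho i g) \<otimes> (?x [^] tco i h \<otimes> rho i h)"
    using tco_rho(1)[OF i] g h by metis
  also have "\<dots> = ?x [^] (tco i g + tco i h) \<otimes> ?k"
    using x c by (simp add: int_pow_mult m_assoc)
  finally have eq: "g \<otimes> h = ?x [^] (tco i g + tco i h) \<otimes> ?k" .
  have "inv (?x [^] tco i h) \<otimes> rho i g \<otimes> inv (inv (?x [^] tco i h)) \<in> MS (Suc i)"
    using MS_conj[OF i _ tco_rho(2)[OF i g]] subgroup.m_inv_closed[OF MS_subgroup xs_pow_MS[OF i]] by blast
  then have "?k \<in> MS (Suc i)"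
    using subgroup.m_closed[OF MS_subgroup _ tco_rho(2)[OF i h]] x by simp
  then show "tco i (g \<otimes> h) = tco i g + tco i h" "rho i (g \<otimes> h) = ?k"
    using tco_rho_eq[OF i] eq by metis+
qed

lemma tco_rho_sub:
  assumes "i < length xs" "h \<in> MS (Suc i)"
  shows "tco i h = 0" "rho i h = h"
  using tco_rho_eq[OF assms, of 0] MS_carrier[OF assms(2)] by auto

lemma tco_rho_pow:
  assumes "i < length xs"
  shows "tco i (xs ! i [^] (t::int)) = t" "rho i (xs ! i [^] (t::int)) = \<one>"
  using tco_rho_eq[OF assms one_MS, of t] xs_carrier[OF assms] by auto

section \<open>Isolators as terms of the Mal'cev series, and the weights\<close>

lemma c_pos: "c \<ge> 1"
proof (rule ccontr)
  assume "\<not> c \<ge> 1"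
  then have "c = 0"
    by simp
  then have "carrier G = {\<one>}"
    using nil_class by (simp add: nil_class_def Gamma_def)
  then show False
    using tau_group by (simp add: tau_group_def)
qed

lemma lcs_c: "lcs G c = {\<one>}"
  using nil_class by (simp add: nil_class_def Gamma_def)

lemma tau_trivial:
  assumes "k \<ge> c + 1"
  shows "tau G k = {\<one>}"
proof -
  have "lcs G (k - 1) \<subseteq> {\<one>}"
    using lcs_antimono[of c "k - 1"] lcs_c assms by auto
  then have "Gamma G k = {\<one>}"
    using subgroup.one_closed[OF lcs_subgroup, of "k - 1"] by (auto simp: Gamma_def)
  then show ?thesis
    using tau_group Gamma_subset_tau[of k] unfolding tau_group_def torsion_free_def tau_def by auto
qed

lemma tau_1: "tau G 1 = carrier G"
proof -
  have "carrier G \<subseteq> tau G 1"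
    using Gamma_subset_tau[of 1] by (simp add: Gamma_def)
  then show ?thesis
    by (auto simp: tau_def)
qed

lemma tau_MS:
  assumes "k \<ge> 1"
  obtains j where "j \<le> length xs" "tau G k = MS j"
proof (cases "k \<le> c + 1")
  case True
  then have "\<exists>i\<le>length xs. tau G k = MS i"
    using malcev_basis assms unfolding malcev_basis_def by simp
  then show ?thesis
    using that by blast
next
  case False
  then show ?thesis
    using that[of "length xs"] tau_trivial[of k] by simp
qed

text \<open>Up to index c + 1 the isolators are terms of the series by the definition of a Mal'cev
  basis, and beyond that they are trivial. This discharges the assumption of
  \<open>gcomm_tau\<close>.\<close>

lemma tau_subgroup: "k \<ge> 1 \<Longrightarrow> subgroup (tau G k) G"
  using tau_MS[of k] MS_subgroup by metis

lemma xs_notin_Suc: "i < length xs \<Longrightarrow> xs ! i \<notin> MS (Suc i)"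
  using xs_pow_notin[of i 1] xs_carrier[of i] by (simp add: int_pow_1)

text \<open>The isolators decrease from the whole group to the trivial one, so the description in
  \<open>mu\<close> picks the last isolator containing \<open>xs ! i\<close>.\<close>

lemma mu_props:
  assumes i: "i < length xs"
  shows "mu G xs i \<ge> 1" "k \<ge> 1 \<Longrightarrow> xs ! i \<in> tau G k \<longleftrightarrow> k \<le> mu G xs i"
proof -
  let ?x = "xs ! i"
  define m where "m = (LEAST m. ?x \<notin> tau G (m + 1))"
  have ne: "?x \<noteq> \<one>"
    using xs_notin_Suc[OF i] one_MS by metis
  have "?x \<notin> tau G (c + 1)"
    using tau_trivial[of "c + 1"] ne by simp
  then have m1: "?x \<notin> tau G (m + 1)"
    unfolding m_def by (rule LeastI)
  have m2: "?x \<in> tau G k" if "k \<ge> 1" "k \<le> m" for k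
    using not_less_Least[of "k - 1" "\<lambda>m. ?x \<notin> tau G (m + 1)"] that by (auto simp: m_def)
  have m0: "m \<ge> 1"
    using m1 tau_1 xs_carrier[OF i] by (cases m) auto
  have m3: "?x \<in> tau G k \<longleftrightarrow> k \<le> m" if "k \<ge> 1" for k
    using m1 m2[OF that] tau_antimono[of "m + 1" k] by (metis Suc_eq_plus1 le_add2 not_less_eq_eq subsetD)
  have "mu G xs i = m"
    unfolding mu_def
  proof (rule the_equality)
    show "1 \<le> m \<and> ?x \<in> tau G m \<and> ?x \<notin> tau G (m + 1)"
      using m0 m1 m2 by auto
    show "k = m" if "1 \<le> k \<and> ?x \<in> tau G k \<and> ?x \<notin> tau G (k + 1)" for k
      using that m3[of k] m3[of "k + 1"] by auto
  qed
  then show "mu G xs i \<ge> 1" "k \<ge> 1 \<Longrightarrow> ?x \<in> tau G k \<longleftrightarrow> k \<le> mu G xs i"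
    using m0 m3 by auto
qed

text \<open>An isolator is some \<open>MS j\<close>; it can contain an element outside
  \<open>MS (Suc i)\<close> only if j is at most i, and then it contains all of
  \<open>MS i\<close>.\<close>

lemma MS_tau_step:
  assumes i: "i < length xs" and k: "k \<ge> 1" and h: "h \<in> MS i" "h \<in> tau G k" "h \<notin> MS (Suc i)"
  shows "MS i \<subseteq> tau G k" "k \<le> mu G xs i"
proof -
  obtain j where j: "tau G k = MS j"
    using tau_MS[OF k] by metis
  have "j \<le> i"
    using h j MS_antimono[of "Suc i" j] by (metis not_less_eq_eq subsetD)
  then show "MS i \<subseteq> tau G k"
    using j MS_antimono by simp
  then show "k \<le> mu G xs i"
    using mu_props(2)[OF i k] xs_MS[OF i] by blast
qed

lemma xs_pow_tau: "i < length xs \<Longrightarrow> xs ! i [^] (t::int) \<in> tau G (mu G xs i)"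
  using mu_props[of i] tau_subgroup subgroup_int_pow_closed by blast

lemma MS_tau1: "MS i \<subseteq> tau G 1"
  using tau_1 MS_carrier by auto

text \<open>By \<open>gcomm_tau\<close>, conjugation by a power of \<open>xs ! i\<close> fits
  \<open>wpoly_compose_diff\<close> with w equal to mu_i.\<close>

lemma wpoly_conj_diff:
  fixes f :: "'a \<Rightarrow> 'r::comm_ring_1"
  assumes i: "i < length xs" and f: "wpoly G (tau G) (MS (Suc i)) m f"
  shows "wpoly G (tau G) (MS (Suc i)) (m - mu G xs i)
    (\<lambda>g. f (inv (xs ! i [^] (s::int)) \<otimes> g \<otimes> xs ! i [^] s) - f g)"
proof (rule wpoly_compose_diff[OF MS_subgroup MS_tau1 _ _ _ _ f])
  let ?x = "xs ! i [^] s"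
  have x: "?x \<in> carrier G"
    using xs_carrier[OF i] by simp
  show "inv ?x \<otimes> g \<otimes> ?x \<in> MS (Suc i)" if "g \<in> MS (Suc i)" for g
    using MS_conj[OF i subgroup.m_inv_closed[OF MS_subgroup xs_pow_MS[OF i, of s]] that] x by simp
  show "inv ?x \<otimes> (g \<otimes> h) \<otimes> ?x = inv ?x \<otimes> g \<otimes> ?x \<otimes> (inv ?x \<otimes> h \<otimes> ?x)"
    if "g \<in> MS (Suc i)" "h \<in> MS (Suc i)" for g h
    using that MS_carrier x by (simp add: m_assoc)
  show "inv ?x \<otimes> h \<otimes> ?x \<in> tau G (Suc k)" if "h \<in> MS (Suc i) \<inter> tau G (Suc k)" for h k
    using normal_conj_mem(2)[OF tau_normal[OF tau_subgroup]] that x by simp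
  show "inv h \<otimes> (inv ?x \<otimes> h \<otimes> ?x) \<in> tau G (Suc (k + mu G xs i))"
    if h: "h \<in> MS (Suc i) \<inter> tau G (Suc k)" for h k
  proof -
    have "gcomm G h ?x \<in> tau G (Suc k + mu G xs i)"
      using h mu_props(1)[OF i] by (intro gcomm_tau[OF _ lcs_c] tau_subgroup xs_pow_tau[OF i]) auto
    moreover have "h \<in> carrier G"
      using h MS_carrier by blast
    ultimately show ?thesis
      using x by (simp add: gcomm_def m_assoc)
  qed
qed

text \<open>Right multiplication by a power of \<open>xs ! i\<close> conjugates the component in the next term of the series,
  which alters \<open>f\<close> only by terms of lower degree.\<close>
lemma wpoly_extend:
  fixes f :: "'a \<Rightarrow> 'r::comm_ring_1"
  assumes i: "i < length xs"
  shows "wpoly G (tau G) (MS (Suc i)) m f \<Longrightarrow> wpoly G (tau G) (MS i) m (\<lambda>g. f (rho i g))"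
proof (induction m arbitrary: f rule: less_induct)
  case (less m)
  show ?case
  proof (cases m)
    case 0
    then show ?thesis
      using less.prems tco_rho(2)[OF i] by simp
  next
    case (Suc p)
    have sub: "wpoly G (tau G) (MS i) (p - k) (\<lambda>g. f (rho i (g \<otimes> h)) - f (rho i g))"
      if h: "h \<in> MS (Suc i) \<inter> tau G (Suc k)" for k h
    proof -
      have "wpoly G (tau G) (MS (Suc i)) (p - k) (\<lambda>g. f (g \<otimes> h) - f g)"
        using less.prems h Suc by simp
      then have "wpoly G (tau G) (MS i) (p - k) (\<lambda>g. f (rho i g \<otimes> h) - f (rho i g))"
        using less.IH[of "p - k" "\<lambda>g. f (g \<otimes> h) - f g"] Suc by simp
      moreover have "rho i (g \<otimes> h) = rho i g \<otimes> h" if "g \<in> MS i" for g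
        using tco_rho_mult(2)[OF i that, of h] tco_rho_sub[OF i, of h] h that MS_antimono[of i "Suc i"]
          MS_carrier[OF tco_rho(2)[OF i that]] by auto
      ultimately show ?thesis
        using wpoly_cong[OF MS_subgroup[of i], of "\<lambda>g. f (rho i g \<otimes> h) - f (rho i g)"
            "\<lambda>g. f (rho i (g \<otimes> h)) - f (rho i g)"] by simp
    qed
    have "wpoly G (tau G) (MS i) (p - k) (\<lambda>g. f (rho i (g \<otimes> h)) - f (rho i g))"
      if h: "h \<in> MS i \<inter> tau G (Suc k)" for k h
    proof (cases "h \<in> MS (Suc i)")
      case True
      then show ?thesis
        using sub h by blast
    next
      case False
      \<comment> \<open>An h outside \<open>MS (Suc i)\<close> forces all of \<open>MS i\<close>
        into the same isolator, so both factors of h = a b have at least the weight assumed for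
        h.\<close>
      then have k: "MS i \<subseteq> tau G (Suc k)" "Suc k \<le> mu G xs i"
        using MS_tau_step[OF i _ _ _ False] h by auto
      define a where "a = xs ! i [^] tco i h"
      define b where "b = rho i h"
      have hab: "h = a \<otimes> b" and a: "a \<in> MS i" and b: "b \<in> MS (Suc i)"
        unfolding a_def b_def using tco_rho[OF i] h xs_pow_MS[OF i] by auto
      have bT: "b \<in> MS (Suc i) \<inter> tau G (Suc k)"
        using b k(1) MS_antimono[of i "Suc i"] by auto
      have 1: "wpoly G (tau G) (MS i) (p - k) (\<lambda>g. f (rho i (g \<otimes> a \<otimes> b)) - f (rho i (g \<otimes> a)))"
        using wpoly_translate[OF MS_subgroup MS_tau1 sub[OF bT] a] .
      \<comment> \<open>Passing from g to g a conjugates the rest by a, which lowers the degree by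
        mu_i; since mu_i is at least k + 1, this stays within p - k.\<close>
      have "wpoly G (tau G) (MS (Suc i)) (Suc p - mu G xs i) (\<lambda>g. f (inv a \<otimes> g \<otimes> a) - f g)"
        unfolding a_def by (rule wpoly_conj_diff[OF i less.prems[unfolded Suc]])
      then have "wpoly G (tau G) (MS (Suc i)) (p - k) (\<lambda>g. f (inv a \<otimes> g \<otimes> a) - f g)"
        by (rule wpoly_mono[OF MS_subgroup]) (use k(2) in simp)
      then have "wpoly G (tau G) (MS i) (p - k) (\<lambda>g. f (inv a \<otimes> rho i g \<otimes> a) - f (rho i g))"
        using less.IH[of "p - k" "\<lambda>g. f (inv a \<otimes> g \<otimes> a) - f g"] Suc by simp
      from wpoly_add[OF MS_subgroup 1 this]
      have "wpoly G (tau G) (MS i) (p - k) (\<lambda>g. f (rho i (g \<otimes> a \<otimes> b)) - f (rho i (g \<otimes> a))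
          + (f (inv a \<otimes> rho i g \<otimes> a) - f (rho i g)))" .
      moreover have "f (rho i (g \<otimes> a \<otimes> b)) - f (rho i (g \<otimes> a))
          + (f (inv a \<otimes> rho i g \<otimes> a) - f (rho i g)) = f (rho i (g \<otimes> h)) - f (rho i g)"
        if g: "g \<in> MS i" for g
      proof -
        have "rho i (g \<otimes> a) = inv a \<otimes> rho i g \<otimes> a"
          using tco_rho_mult(2)[OF i g a] tco_rho_pow[OF i] MS_carrier[OF a] MS_carrier[OF tco_rho(2)[OF i g]]
          unfolding a_def by simp
        moreover have "g \<otimes> a \<otimes> b = g \<otimes> h"
          using hab g a b MS_carrier by (simp add: m_assoc)
        ultimately show ?thesis
          by simp
      qed
      ultimately show ?thesis
        using wpoly_cong[OF MS_subgroup[of i], of "\<lambda>g. f (rho i (g \<otimes> a \<otimes> b)) - f (rho i (g \<otimes> a))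
          + (f (inv a \<otimes> rho i g \<otimes> a) - f (rho i g))" "\<lambda>g. f (rho i (g \<otimes> h)) - f (rho i g)"] by blast
    qed
    then show ?thesis
      using Suc by simp
  qed
qed

text \<open>The leading exponent is additive on \<open>MS i\<close>, so its differences are
  constants. A nonzero one requires h outside \<open>MS (Suc i)\<close>, and then
  \<open>Suc k \<le> mu G xs i\<close> leaves room for a constant.\<close>

lemma wpoly_tco:
  assumes i: "i < length xs"
  shows "wpoly G (tau G) (MS i) (Suc (mu G xs i)) (\<lambda>g. of_int (tco i g) :: 'r::comm_ring_1)"
proof -
  have "wpoly G (tau G) (MS i) (mu G xs i - k) (\<lambda>g. of_int (tco i (g \<otimes> h)) - of_int (tco i g) :: 'r)"
    if h: "h \<in> MS i \<inter> tau G (Suc k)" for k h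
  proof (cases "h \<in> MS (Suc i)")
    case True
    then show ?thesis
      using tco_rho_mult(1)[OF i] tco_rho_sub[OF i] h by (intro wpoly_vanish[OF MS_subgroup]) simp
  next
    case False
    then have "Suc k \<le> mu G xs i"
      using MS_tau_step(2)[OF i _ _ _ False] h by auto
    then have "mu G xs i - k = Suc (mu G xs i - Suc k)"
      by simp
    then have "wpoly G (tau G) (MS i) (mu G xs i - k) (\<lambda>g. of_int (tco i h) :: 'r)"
      using wpoly_const[OF MS_subgroup] by metis
    then show ?thesis
      using wpoly_cong[OF MS_subgroup[of i], of "\<lambda>g. of_int (tco i (g \<otimes> h)) - of_int (tco i g) :: 'r"
          "\<lambda>g. of_int (tco i h)"] tco_rho_mult(1)[OF i] h by simp
  qed
  then show ?thesis
    by simp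
qed

text \<open>For g written as a product of powers of the basis elements in order, this is the tail of
  the product from index i on; \<open>coord\<close> then gives the usual Mal'cev coordinates,
  counted from 0.\<close>

primrec pr :: "nat \<Rightarrow> 'a \<Rightarrow> 'a" where
  "pr 0 g = g"
| "pr (Suc i) g = rho i (pr i g)"

definition coord :: "nat \<Rightarrow> 'a \<Rightarrow> int" where
  "coord i g = tco i (pr i g)"

lemma wpoly_pr:
  fixes f :: "'a \<Rightarrow> 'r::comm_ring_1"
  shows "i \<le> length xs \<Longrightarrow> wpoly G (tau G) (MS i) m f \<Longrightarrow> wpoly G (tau G) (carrier G) m (\<lambda>g. f (pr i g))"
proof (induction i arbitrary: f)
  case (Suc i)
  then show ?case
    using wpoly_extend[of i m f] Suc.IH[of "\<lambda>g. f (rho i g)"] by simp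
qed simp

lemma wpoly_coord:
  "i < length xs \<Longrightarrow>
    wpoly G (tau G) (carrier G) (Suc (mu G xs i)) (\<lambda>g. of_int (coord i g) :: 'r::comm_ring_1)"
  unfolding coord_def using wpoly_pr[OF _ wpoly_tco[of i]] by simp

lemma pr_id: "i \<le> j \<Longrightarrow> j \<le> length xs \<Longrightarrow> g \<in> MS j \<Longrightarrow> pr i g = g"
proof (induction i)
  case (Suc i)
  then have "g \<in> MS (Suc i)"
    using MS_antimono[of "Suc i" j] by blast
  then show ?case
    using Suc tco_rho_sub[of i g] by simp
qed simp

lemma coord_MS: "l < j \<Longrightarrow> j \<le> length xs \<Longrightarrow> g \<in> MS j \<Longrightarrow> coord l g = 0"
  unfolding coord_def using pr_id[of l j g] tco_rho_sub(1)[of l g] MS_antimono[of "Suc l" j] by auto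

lemma coord_one: "l < length xs \<Longrightarrow> coord l \<one> = 0"
  using coord_MS[of l "length xs"] by simp

lemma pr_rho_cong:
  assumes "g \<in> MS j" "g' \<in> MS j" "rho j g = rho j g'" "j < l" "l \<le> length xs"
  shows "pr l g = pr l g'"
  using assms(4,5)
proof (induction l)
  case (Suc l)
  show ?case
  proof (cases "l = j")
    case True
    then show ?thesis
      using assms pr_id[of j j] Suc.prems by simp
  next
    case False
    then show ?thesis
      using Suc by simp
  qed
qed simp

text \<open>In \<open>MS j\<close> the leading factor stands on the left, so left multiplication by
  \<open>xs ! j\<close> meets it without passing anything else. Pascal's rule for binomials in the
  coordinates rests on this.\<close>

lemma coord_mult_xs:
  assumes j: "j < length xs" and l: "l < length xs" and g: "g \<in> MS j"
  shows "coord l (xs ! j \<otimes> g) = coord l g + (if l = j then 1 else 0)"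
proof -
  let ?x = "xs ! j"
  have x1: "?x = ?x [^] (1::int)"
    using xs_carrier[OF j] by (simp add: int_pow_1)
  have xg: "?x \<otimes> g \<in> MS j"
    using subgroup.m_closed[OF MS_subgroup xs_MS[OF j] g] .
  have t: "tco j ?x = 1" "rho j ?x = \<one>"
    using tco_rho_pow[OF j, of 1] x1 by auto
  have gc: "rho j g \<in> carrier G"
    using tco_rho(2)[OF j g] MS_carrier by blast
  have "tco j (?x \<otimes> g) = tco j g + 1" "rho j (?x \<otimes> g) = rho j g"
    using tco_rho_mult[OF j xs_MS[OF j] g] t gc xs_carrier[OF j] by auto
  then show ?thesis
    using pr_id[of j j] g xg j l coord_MS[of l j] pr_rho_cong[OF xg g, of l]
    by (cases l j rule: linorder_cases) (auto simp: coord_def)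
qed

lemma coord_xs_pow:
  assumes j: "j < length xs" and l: "l < length xs"
  shows "coord l (xs ! j [^] (t::int)) = (if l = j then t else 0)"
  using pr_id[of j j "xs ! j [^] t"] xs_pow_MS[OF j, of t] tco_rho_pow[OF j, of t] j l coord_MS[of l j]
    pr_rho_cong[of "xs ! j [^] t" j \<one> l] tco_rho_sub[OF j one_MS] coord_one[OF l]
  by (cases l j rule: linorder_cases) (auto simp: coord_def)

end

section \<open>The group algebra and powers of the augmentation ideal\<close>

text \<open>The linear extension of f to the group algebra, evaluated at a.\<close>

definition lin :: "('a \<Rightarrow> 'k::field) \<Rightarrow> ('a \<Rightarrow> 'k) \<Rightarrow> 'k" where
  "lin f a = (\<Sum>x\<in>gsupp a. a x * f x)"

lemma lin_superset: "finite A \<Longrightarrow> gsupp a \<subseteq> A \<Longrightarrow> lin f a = (\<Sum>x\<in>A. a x * f x)"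
  unfolding lin_def by (rule sum.mono_neutral_left) (auto simp: gsupp_def)

lemma lin_cong: "(\<And>x. x \<in> gsupp a \<Longrightarrow> f x = f' x) \<Longrightarrow> lin f a = lin f' a"
  unfolding lin_def by (rule sum.cong) auto

lemma lin_fun_add: "lin (\<lambda>x. f x + f' x) a = lin f a + lin f' a"
  by (simp add: lin_def algebra_simps sum.distrib)

lemma lin_fun_diff: "lin (\<lambda>x. f x - f' x) a = lin f a - lin f' a"
  by (simp add: lin_def algebra_simps sum_subtractf)

lemma lin_fun_scale: "lin (\<lambda>x. k * f x) a = k * lin f a"
  by (simp add: lin_def algebra_simps sum_distrib_left)

lemma lin_fun_scale_right: "lin (\<lambda>x. f x * k) a = lin f a * k"
  by (simp add: lin_def algebra_simps sum_distrib_left)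

lemma lin_swap: "lin (\<lambda>x. lin (\<lambda>y. F x y) b) a = lin (\<lambda>y. lin (\<lambda>x. F x y) a) b"
  unfolding lin_def by (simp add: sum_distrib_left) (subst sum.swap, simp add: mult.left_commute)

lemma gsupp_gdelta [simp]: "gsupp (gdelta g :: 'a \<Rightarrow> 'k::field) = {g}"
  by (auto simp: gsupp_def gdelta_def)

lemma lin_gdelta [simp]: "lin f (gdelta g) = f g"
  by (simp add: lin_def) (simp add: gdelta_def)

lemma lin_gdelta_left: "finite (gsupp a) \<Longrightarrow> lin (gdelta z) a = a z"
proof -
  assume f: "finite (gsupp a)"
  have "lin (gdelta z) a = (\<Sum>x\<in>insert z (gsupp a). a x * gdelta z x)"
    by (rule lin_superset) (use f in auto)
  also have "\<dots> = (\<Sum>x\<in>insert z (gsupp a). if x = z then a x else 0)"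
    by (rule sum.cong) (auto simp: gdelta_def)
  also have "\<dots> = a z"
    using f by simp
  finally show ?thesis .
qed

lemma lin_add: "finite (gsupp a) \<Longrightarrow> finite (gsupp b) \<Longrightarrow> lin f (a + b) = lin f a + lin f b"
  by (subst (1 2 3) lin_superset[of "gsupp a \<union> gsupp b"])
    (auto simp: gsupp_def algebra_simps sum.distrib)

lemma lin_diff: "finite (gsupp a) \<Longrightarrow> finite (gsupp b) \<Longrightarrow> lin f (a - b) = lin f a - lin f b"
  by (subst (1 2 3) lin_superset[of "gsupp a \<union> gsupp b"])
    (auto simp: gsupp_def algebra_simps sum_subtractf)

lemma lin_scale: "finite (gsupp a) \<Longrightarrow> lin f (\<lambda>z. k * a z) = k * lin f a"
  by (subst (1 2) lin_superset[of "gsupp a"])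
    (auto simp: gsupp_def algebra_simps sum_distrib_left)

lemma lin_zero [simp]: "lin f 0 = 0"
  by (simp add: lin_def gsupp_def)

lemma gsupp_gconv: "gsupp (gconv G a b) \<subseteq> (\<lambda>(x, y). x \<otimes>\<^bsub>G\<^esub> y) ` (gsupp a \<times> gsupp b)"
proof
  fix z assume "z \<in> gsupp (gconv G a b)"
  then have "(\<Sum>x\<in>gsupp a. \<Sum>y\<in>gsupp b. if x \<otimes>\<^bsub>G\<^esub> y = z then a x * b y else 0) \<noteq> 0"
    by (simp add: gsupp_def gconv_def)
  then obtain x where x: "x \<in> gsupp a" "(\<Sum>y\<in>gsupp b. if x \<otimes>\<^bsub>G\<^esub> y = z then a x * b y else 0) \<noteq> 0"
    by (rule sum.not_neutral_contains_not_neutral)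
  from x(2) obtain y where "y \<in> gsupp b" "(if x \<otimes>\<^bsub>G\<^esub> y = z then a x * b y else 0) \<noteq> 0"
    by (rule sum.not_neutral_contains_not_neutral)
  then show "z \<in> (\<lambda>(x, y). x \<otimes>\<^bsub>G\<^esub> y) ` (gsupp a \<times> gsupp b)"
    using x by (auto split: if_splits)
qed

lemma lin_gconv:
  assumes "finite (gsupp a)" "finite (gsupp b)"
  shows "lin f (gconv G a b) = lin (\<lambda>x. lin (\<lambda>y. f (x \<otimes>\<^bsub>G\<^esub> y)) b) a"
proof -
  let ?P = "(\<lambda>(x, y). x \<otimes>\<^bsub>G\<^esub> y) ` (gsupp a \<times> gsupp b)"
  have fin: "finite ?P"
    using assms by simp
  have "lin f (gconv G a b) = (\<Sum>z\<in>?P. gconv G a b z * f z)"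
    by (rule lin_superset[OF fin gsupp_gconv])
  also have "\<dots> = (\<Sum>z\<in>?P. \<Sum>x\<in>gsupp a. \<Sum>y\<in>gsupp b. if x \<otimes>\<^bsub>G\<^esub> y = z then a x * b y * f z else 0)"
    unfolding gconv_def by (simp add: sum_distrib_right if_distrib[of "\<lambda>t. t * _"] cong: if_cong)
  also have "\<dots> = (\<Sum>x\<in>gsupp a. \<Sum>z\<in>?P. \<Sum>y\<in>gsupp b. if x \<otimes>\<^bsub>G\<^esub> y = z then a x * b y * f z else 0)"
    by (rule sum.swap)
  also have "\<dots> = (\<Sum>x\<in>gsupp a. \<Sum>y\<in>gsupp b. \<Sum>z\<in>?P. if x \<otimes>\<^bsub>G\<^esub> y = z then a x * b y * f z else 0)"
    by (rule sum.cong[OF refl]) (rule sum.swap)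
  also have "\<dots> = (\<Sum>x\<in>gsupp a. \<Sum>y\<in>gsupp b. a x * b y * f (x \<otimes>\<^bsub>G\<^esub> y))"
    using fin by (intro sum.cong refl) auto
  also have "\<dots> = lin (\<lambda>x. lin (\<lambda>y. f (x \<otimes>\<^bsub>G\<^esub> y)) b) a"
    by (simp add: lin_def sum_distrib_left mult.assoc)
  finally show ?thesis .
qed

lemma gsupp_add: "gsupp (a + b :: 'a \<Rightarrow> 'k::field) \<subseteq> gsupp a \<union> gsupp b"
  by (auto simp: gsupp_def)

lemma gsupp_diff: "gsupp (a - b :: 'a \<Rightarrow> 'k::field) \<subseteq> gsupp a \<union> gsupp b"
  by (auto simp: gsupp_def)

context group
begin

lemma group_alg_finite: "a \<in> group_alg G \<Longrightarrow> finite (gsupp a)"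
  by (simp add: group_alg_def)

lemma group_alg_carrier: "a \<in> group_alg G \<Longrightarrow> x \<in> gsupp a \<Longrightarrow> x \<in> carrier G"
  by (auto simp: group_alg_def)

lemma group_alg_0 [simp]: "0 \<in> group_alg G"
  by (simp add: group_alg_def gsupp_def)

lemma group_alg_gdelta [simp]: "gdelta g \<in> group_alg G \<longleftrightarrow> g \<in> carrier G"
  by (simp add: group_alg_def)

lemma group_alg_add [simp]: "a \<in> group_alg G \<Longrightarrow> b \<in> group_alg G \<Longrightarrow> a + b \<in> group_alg G"
  unfolding group_alg_def using gsupp_add[of a b] by (auto dest: finite_subset)

lemma group_alg_diff [simp]: "a \<in> group_alg G \<Longrightarrow> b \<in> group_alg G \<Longrightarrow> a - b \<in> group_alg G"
  unfolding group_alg_def using gsupp_diff[of a b] by (auto dest: finite_subset)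

lemma group_alg_scale [simp]: "a \<in> group_alg G \<Longrightarrow> (\<lambda>z. k * a z) \<in> group_alg G"
  unfolding group_alg_def by (auto simp: gsupp_def intro: rev_finite_subset[of "gsupp a"])

lemma group_alg_gconv [simp]:
  assumes "a \<in> group_alg G" "b \<in> group_alg G"
  shows "gconv G a b \<in> group_alg G"
proof -
  have "finite ((\<lambda>(x, y). x \<otimes> y) ` (gsupp a \<times> gsupp b))"
    using assms by (simp add: group_alg_finite)
  moreover have "(\<lambda>(x, y). x \<otimes> y) ` (gsupp a \<times> gsupp b) \<subseteq> carrier G"
    using assms group_alg_carrier by auto
  ultimately show ?thesis
    unfolding group_alg_def using gsupp_gconv[of G a b] by (auto dest: finite_subset)
qed

lemma lin_ga [simp]:
  assumes "a \<in> group_alg G"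
  shows "lin f (\<lambda>z. k * a z) = k * lin f a"
    "b \<in> group_alg G \<Longrightarrow> lin f (a + b) = lin f a + lin f b"
    "b \<in> group_alg G \<Longrightarrow> lin f (a - b) = lin f a - lin f b"
    "b \<in> group_alg G \<Longrightarrow> lin f (gconv G a b) = lin (\<lambda>x. lin (\<lambda>y. f (x \<otimes> y)) b) a"
  using assms by (simp_all add: lin_scale lin_add lin_diff lin_gconv group_alg_finite)

text \<open>Point masses already separate elements. Identities in the group algebra thereby become
  identities between iterated evaluations, which \<open>simp\<close> settles without convolution
  sums.\<close>

lemma group_alg_eqI:
  assumes "a \<in> group_alg G" "b \<in> group_alg G" "\<And>f. lin f a = lin f b"
  shows "a = b"
proof
  fix z
  show "a z = b z"
    using assms lin_gdelta_left[of a z] lin_gdelta_left[of b z] by (simp add: group_alg_finite)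
qed

lemma lin_cong_carrier: "a \<in> group_alg G \<Longrightarrow> (\<And>x. x \<in> carrier G \<Longrightarrow> f x = f' x) \<Longrightarrow> lin f a = lin f' a"
  using group_alg_carrier by (intro lin_cong) blast

lemma gconv_assoc:
  assumes "a \<in> group_alg G" "b \<in> group_alg G" "d \<in> group_alg G"
  shows "gconv G (gconv G a b) d = gconv G a (gconv G b d)"
proof (rule group_alg_eqI)
  fix f
  have "lin (\<lambda>x. lin (\<lambda>y. lin (\<lambda>z. f (x \<otimes> y \<otimes> z)) d) b) a = lin (\<lambda>x. lin (\<lambda>y. lin (\<lambda>z. f (x \<otimes> (y \<otimes> z))) d) b) a"
    using assms by (intro lin_cong_carrier) (auto simp: m_assoc)
  then show "lin f (gconv G (gconv G a b) d) = lin f (gconv G a (gconv G b d))"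
    using assms by simp
qed (use assms in auto)

lemma gconv_laws:
  assumes "a \<in> group_alg G" "b \<in> group_alg G" "d \<in> group_alg G"
  shows "gconv G (a + b) d = gconv G a d + gconv G b d"
    "gconv G a (b + d) = gconv G a b + gconv G a d"
    "gconv G (a - b) d = gconv G a d - gconv G b d"
    "gconv G a (b - d) = gconv G a b - gconv G a d"
    "gconv G (\<lambda>z. k * a z) b = (\<lambda>z. k * gconv G a b z)"
    "gconv G a (\<lambda>z. k * b z) = (\<lambda>z. k * gconv G a b z)"
  by (rule group_alg_eqI; use assms in \<open>simp add: lin_fun_add lin_fun_diff lin_fun_scale\<close>)+

lemma gconv_one:
  assumes "a \<in> group_alg G"
  shows "gconv G (gdelta \<one>) a = a" "gconv G a (gdelta \<one>) = a"
  by (rule group_alg_eqI; use assms in \<open>auto intro: lin_cong_carrier\<close>)+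

lemma gconv_zero:
  assumes "a \<in> group_alg G"
  shows "gconv G 0 a = 0" "gconv G a 0 = 0"
  by (simp_all add: gconv_def gsupp_def zero_fun_def)

lemma gconv_gdelta:
  "g \<in> carrier G \<Longrightarrow> h \<in> carrier G \<Longrightarrow> gconv G (gdelta g) (gdelta h) = gdelta (g \<otimes> h)"
  by (rule group_alg_eqI) simp_all

lemma aug_ideal_iff: "a \<in> aug_ideal G \<longleftrightarrow> a \<in> group_alg G \<and> lin (\<lambda>_. 1) a = 0"
  by (simp add: aug_ideal_def lin_def)

lemma aug_ideal_ga: "a \<in> aug_ideal G \<Longrightarrow> a \<in> group_alg G"
  by (simp add: aug_ideal_iff)

lemma aug_ideal_gdelta: "g \<in> carrier G \<Longrightarrow> gdelta \<one> - gdelta g \<in> aug_ideal G"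
  by (simp add: aug_ideal_iff)

lemma aug_ideal_gconv: "a \<in> aug_ideal G \<Longrightarrow> b \<in> group_alg G \<Longrightarrow> gconv G a b \<in> aug_ideal G"
proof -
  assume a: "a \<in> aug_ideal G" and b: "b \<in> group_alg G"
  have "lin (\<lambda>x. lin (\<lambda>y. 1) b) a = lin (\<lambda>x. 1 * lin (\<lambda>y. 1) b) a"
    by simp
  also have "\<dots> = 0"
    using a unfolding lin_fun_scale_right by (simp add: aug_ideal_iff)
  finally show ?thesis
    using a b by (simp add: aug_ideal_iff)
qed

declare plus_fun_apply [simp del] zero_fun_apply [simp del] minus_apply [simp del]

lemma aug_pow_Suc_induct [consumes 1, case_names zero add]:
  assumes "a \<in> aug_pow G (Suc m)" and "P 0"
    and "\<And>p q r. p \<in> aug_pow G m \<Longrightarrow> q \<in> aug_ideal G \<Longrightarrow> r \<in> aug_pow G (Suc m) \<Longrightarrow> P r \<Longrightarrow> P (gconv G p q + r)"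
  shows "P a"
proof -
  obtain ps where ps: "a = sum_list (map (\<lambda>p. gconv G (fst p) (snd p)) ps)"
    "\<forall>p\<in>set ps. fst p \<in> aug_pow G m \<and> snd p \<in> aug_ideal G"
    using assms(1) by auto
  have "P (sum_list (map (\<lambda>p. gconv G (fst p) (snd p)) ps))"
    using ps(2)
  proof (induction ps)
    case Nil
    then show ?case
      using assms(2) by simp
  next
    case (Cons p ps)
    have "sum_list (map (\<lambda>p. gconv G (fst p) (snd p)) ps) \<in> aug_pow G (Suc m)"
      using Cons.prems by auto
    then show ?case
      using Cons assms(3)[of "fst p" "snd p"] by (simp del: aug_pow.simps(2))
  qed
  then show ?thesis
    using ps by simp
qed

lemma aug_pow_Suc_zero: "0 \<in> aug_pow G (Suc m)"
  by (auto intro: exI[of _ "[]"])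

lemma aug_pow_Suc_gconv_add:
  assumes "p \<in> aug_pow G m" "q \<in> aug_ideal G" "r \<in> aug_pow G (Suc m)"
  shows "gconv G p q + r \<in> aug_pow G (Suc m)"
proof -
  obtain ps where "r = sum_list (map (\<lambda>p. gconv G (fst p) (snd p)) ps)"
    "\<forall>p\<in>set ps. fst p \<in> aug_pow G m \<and> snd p \<in> aug_ideal G"
    using assms(3) by auto
  then show ?thesis
    using assms(1,2) by (auto intro!: exI[of _ "(p, q) # ps"])
qed

lemma aug_pow_Suc_gconv: "p \<in> aug_pow G m \<Longrightarrow> q \<in> aug_ideal G \<Longrightarrow> gconv G p q \<in> aug_pow G (Suc m)"
  using aug_pow_Suc_gconv_add[OF _ _ aug_pow_Suc_zero] by fastforce

declare aug_pow.simps(2) [simp del]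

lemma aug_pow_ga: "a \<in> aug_pow G m \<Longrightarrow> a \<in> group_alg G"
proof (induction m arbitrary: a)
  case (Suc m)
  from Suc.prems show ?case
    by (induction rule: aug_pow_Suc_induct) (auto simp: Suc.IH aug_ideal_ga)
qed simp

lemma aug_pow_0 [simp]: "0 \<in> aug_pow G m"
  by (cases m) (auto simp: aug_pow_Suc_zero)

lemma aug_pow_add: "a \<in> aug_pow G m \<Longrightarrow> b \<in> aug_pow G m \<Longrightarrow> a + b \<in> aug_pow G m"
proof (cases m)
  case (Suc k)
  assume a: "a \<in> aug_pow G m" and b: "b \<in> aug_pow G m"
  from a[unfolded Suc] show ?thesis
    unfolding Suc
    by (induction rule: aug_pow_Suc_induct) (use b Suc in \<open>auto simp: add.assoc intro: aug_pow_Suc_gconv_add\<close>)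
qed simp

lemma aug_pow_scale: "a \<in> aug_pow G m \<Longrightarrow> (\<lambda>z. k * a z) \<in> aug_pow G m"
proof (induction m arbitrary: a)
  case (Suc m)
  from Suc.prems show ?case
  proof (induction rule: aug_pow_Suc_induct)
    case zero
    then show ?case
      using aug_pow_Suc_zero by (simp add: zero_fun_def)
  next
    case (add p q r)
    have "(\<lambda>z. k * (gconv G p q + r) z) = gconv G (\<lambda>z. k * p z) q + (\<lambda>z. k * r z)"
      using gconv_laws(5)[OF aug_pow_ga[OF add.hyps(1)] aug_ideal_ga[OF add.hyps(2)] group_alg_0, of k]
      by (auto simp: algebra_simps plus_fun_apply)
    then show ?case
      using add by (simp add: aug_pow_Suc_gconv_add Suc.IH)
  qed
qed simp

lemma aug_pow_diff:
  assumes "a \<in> aug_pow G m" "b \<in> aug_pow G m"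
  shows "a - b \<in> aug_pow G m"
proof -
  have "a - b = a + (\<lambda>z. (-1) * b z)"
    by (auto simp: fun_eq_iff plus_fun_apply minus_apply)
  then show ?thesis
    using aug_pow_add[OF assms(1) aug_pow_scale[OF assms(2), of "-1"]] by metis
qed

text \<open>The factor b is absorbed into the last factor q, since the augmentation ideal is a right
  ideal.\<close>

lemma aug_pow_gconv_right: "a \<in> aug_pow G m \<Longrightarrow> b \<in> group_alg G \<Longrightarrow> gconv G a b \<in> aug_pow G m"
proof (cases m)
  case (Suc k)
  assume a: "a \<in> aug_pow G m" and b: "b \<in> group_alg G"
  from a[unfolded Suc] show ?thesis
    unfolding Suc
  proof (induction rule: aug_pow_Suc_induct)
    case zero
    then show ?case
      by (simp add: gconv_zero[OF b])
  next
    case (add p q r)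
    have "gconv G (gconv G p q + r) b = gconv G p (gconv G q b) + gconv G r b"
      using add.hyps b by (simp add: gconv_laws gconv_assoc aug_pow_ga aug_ideal_ga)
    then show ?case
      using add b by (simp add: aug_ideal_gconv aug_pow_Suc_gconv_add)
  qed
qed simp

lemma aug_pow_Suc_subset: "a \<in> aug_pow G (Suc m) \<Longrightarrow> a \<in> aug_pow G m"
  by (induction rule: aug_pow_Suc_induct) (auto intro: aug_pow_add aug_pow_gconv_right aug_ideal_ga)

lemma aug_pow_antimono:
  assumes "a \<in> aug_pow G n" "m \<le> n"
  shows "a \<in> aug_pow G m"
  using assms(2,1) by (induction rule: inc_induct) (auto intro: aug_pow_Suc_subset)

lemma aug_pow_mult:
  "a \<in> aug_pow G m \<Longrightarrow> b \<in> aug_pow G n \<Longrightarrow> gconv G a b \<in> aug_pow G (m + n)"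
proof (induction n arbitrary: b)
  case 0
  then show ?case
    by (simp add: aug_pow_gconv_right)
next
  case (Suc n)
  from Suc.prems(2) show ?case
  proof (induction rule: aug_pow_Suc_induct)
    case zero
    then show ?case
      using gconv_zero[OF aug_pow_ga[OF Suc.prems(1)]] by simp
  next
    case (add p q r)
    have "gconv G a (gconv G p q + r) = gconv G (gconv G a p) q + gconv G a r"
      using add.hyps Suc.prems(1) by (simp add: gconv_laws gconv_assoc aug_pow_ga aug_ideal_ga)
    moreover have "gconv G (gconv G a p) q \<in> aug_pow G (m + Suc n)"
      using aug_pow_Suc_gconv[OF Suc.IH] add.hyps Suc.prems(1) by simp
    ultimately show ?case
      using add.IH by (simp add: aug_pow_add)
  qed
qed

lemma aug_ideal_aug_pow: "a \<in> aug_ideal G \<Longrightarrow> a \<in> aug_pow G 1"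
  using aug_pow_Suc_gconv[of "gdelta \<one>" 0 a] by (simp add: gconv_one aug_ideal_ga)

lemma aug_pow_gconv_left: "a \<in> group_alg G \<Longrightarrow> b \<in> aug_pow G m \<Longrightarrow> gconv G a b \<in> aug_pow G m"
  using aug_pow_mult[of a 0 b m] by simp

text \<open>For p in I^m and q in I, evaluating f on p q sums f(x y) against p and q. As the values
  of q add up to 0, f(x y) may be replaced by f(x y) - f(x), which has degree less than m in x, and
  the induction hypothesis applies to p.\<close>

lemma lin_vanish_aug_pow:
  fixes f :: "'a \<Rightarrow> 'k::field"
  assumes T: "carrier G \<subseteq> T 1"
  shows "wpoly G T (carrier G) m f \<Longrightarrow> a \<in> aug_pow G m \<Longrightarrow> lin f a = 0"
proof (induction m arbitrary: f a)
  case 0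
  then show ?case
    using group_alg_carrier[of a] by (auto simp: lin_def intro!: sum.neutral)
next
  case (Suc m)
  from Suc.prems(2) show ?case
  proof (induction rule: aug_pow_Suc_induct)
    case (add p q r)
    have p: "p \<in> group_alg G" and q: "q \<in> group_alg G"
      using add.hyps aug_pow_ga aug_ideal_ga by auto
    have "lin (\<lambda>x. f (x \<otimes> y) - f x) p = 0" if "y \<in> carrier G" for y
      using Suc.IH[OF _ add.hyps(1)] wpoly_rdiff[OF subgroup_self T Suc.prems(1) that] by simp
    then have "lin (\<lambda>y. lin (\<lambda>x. f (x \<otimes> y) - f x) p) q = lin (\<lambda>y. 0) q"
      by (rule lin_cong_carrier[OF q])
    then have "lin (\<lambda>y. lin (\<lambda>x. f (x \<otimes> y) - f x) p) q = 0"
      by (simp add: lin_def)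
    moreover have "lin (\<lambda>y. lin (\<lambda>x. f x) p) q = lin f p * lin (\<lambda>_. 1) q"
      using lin_fun_scale[of "lin f p" "\<lambda>_. 1" q] by simp
    moreover have "lin (\<lambda>_. 1) q = 0"
      using add.hyps(2) by (simp add: aug_ideal_iff)
    ultimately have "lin (\<lambda>y. lin (\<lambda>x. f (x \<otimes> y)) p) q = 0"
      by (simp add: lin_fun_diff)
    then have "lin f (gconv G p q) = 0"
      using p q lin_swap[of "\<lambda>x y. f (x \<otimes> y)" q p] by simp
    then show ?case
      using add p q by (simp add: aug_pow_ga)
  qed simp
qed

end

section \<open>Jennings' basis\<close>

context group
begin

text \<open>The k-th dimension subgroup of G over a field; the type argument selects the
  field.\<close>

definition dimsub :: "'k::field itself \<Rightarrow> nat \<Rightarrow> 'a set" where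
  "dimsub _ k = {g \<in> carrier G. gdelta \<one> - gdelta g \<in> (aug_pow G k :: ('a \<Rightarrow> 'k) set)}"

lemma dimsub_one: "\<one> \<in> dimsub TYPE('k::field) k"
  by (simp add: dimsub_def)

lemma dimsub_mult:
  assumes "g \<in> dimsub TYPE('k::field) k" "h \<in> dimsub TYPE('k) k"
  shows "g \<otimes> h \<in> dimsub TYPE('k) k"
proof -
  have gh: "g \<in> carrier G" "h \<in> carrier G"
    using assms by (auto simp: dimsub_def)
  have eq: "(gdelta \<one> - gdelta (g \<otimes> h) :: 'a \<Rightarrow> 'k)
      = gconv G (gdelta \<one> - gdelta g) (gdelta h) + (gdelta \<one> - gdelta h)"
    by (rule group_alg_eqI) (use gh in simp_all)
  show ?thesis
    using assms gh unfolding dimsub_def mem_Collect_eq eq by (auto intro!: aug_pow_add aug_pow_gconv_right)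
qed

lemma dimsub_inv:
  assumes "g \<in> dimsub TYPE('k::field) k"
  shows "inv g \<in> dimsub TYPE('k) k"
proof -
  have g: "g \<in> carrier G"
    using assms by (auto simp: dimsub_def)
  have eq: "(gdelta \<one> - gdelta (inv g) :: 'a \<Rightarrow> 'k)
      = (\<lambda>z. (-1) * gconv G (gdelta (inv g)) (gdelta \<one> - gdelta g) z)"
    by (rule group_alg_eqI; (intro group_alg_scale)?) (use g in \<open>simp_all del: mult_minus_left mult_1 mult_minus1, simp?\<close>)
  have "gconv G (gdelta (inv g)) (gdelta \<one> - gdelta g) \<in> (aug_pow G k :: ('a \<Rightarrow> 'k) set)"
    using assms g by (auto simp: dimsub_def intro!: aug_pow_gconv_left)
  from aug_pow_scale[OF this, of "-1"] show ?thesis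
    using g unfolding dimsub_def mem_Collect_eq eq by simp
qed

text \<open>With u = 1 - g and v = 1 - h one has 1 - [g, h] = g^-1 h^-1 (v u - u v).\<close>

lemma dimsub_gcomm:
  assumes "g \<in> dimsub TYPE('k::field) i" "h \<in> dimsub TYPE('k) j"
  shows "gcomm G g h \<in> dimsub TYPE('k) (i + j)"
proof -
  have gh: "g \<in> carrier G" "h \<in> carrier G"
    using assms by (auto simp: dimsub_def)
  let ?u = "gdelta \<one> - gdelta g :: 'a \<Rightarrow> 'k" and ?v = "gdelta \<one> - gdelta h :: 'a \<Rightarrow> 'k"
  have uv: "?u \<in> aug_pow G i" "?v \<in> aug_pow G j"
    using assms by (auto simp: dimsub_def)
  have "(gdelta \<one> - gdelta (gcomm G g h) :: 'a \<Rightarrow> 'k)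
      = gconv G (gdelta (inv g \<otimes> inv h)) (gconv G ?v ?u - gconv G ?u ?v)"
    by (rule group_alg_eqI) (use gh in \<open>simp_all add: gcomm_def m_assoc\<close>)
  moreover have "gconv G ?v ?u - gconv G ?u ?v \<in> aug_pow G (i + j)"
    using aug_pow_diff[OF aug_pow_mult[OF uv(2,1), unfolded add.commute[of j i]] aug_pow_mult[OF uv]] .
  ultimately show ?thesis
    using gh by (auto simp: dimsub_def intro!: aug_pow_gconv_left)
qed

lemma dimsub_1: "dimsub TYPE('k::field) (Suc 0) = carrier G"
proof -
  have "gdelta \<one> - gdelta g \<in> (aug_pow G (Suc 0) :: ('a \<Rightarrow> 'k) set)" if "g \<in> carrier G" for g
    using aug_ideal_aug_pow[OF aug_ideal_gdelta[OF that]] by simp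
  then show ?thesis
    by (auto simp: dimsub_def)
qed

lemma lcs_dimsub: "lcs G k \<subseteq> dimsub TYPE('k::field) (Suc k)"
proof (induction k)
  case 0
  then show ?case
    by (simp add: dimsub_1)
next
  case (Suc k)
  have gens: "gcomm G b g \<in> dimsub TYPE('k) (Suc (Suc k))" if "b \<in> lcs G k" "g \<in> carrier G" for b g
    using dimsub_gcomm[of b "Suc k" g "Suc 0", where 'k = 'k] Suc that by (auto simp: dimsub_1)
  show ?case
  proof
    fix y assume "y \<in> lcs G (Suc k)"
    then have "y \<in> generate G {gcomm G b g |b g. b \<in> lcs G k \<and> g \<in> carrier G}"
      unfolding lcs.simps(2) comm_subgroup_def .
    then show "y \<in> dimsub TYPE('k) (Suc (Suc k))"
    proof (induction rule: generate.induct)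
      case (incl h)
      then show ?case
        using gens by blast
    next
      case (inv h)
      then show ?case
        using gens dimsub_inv by blast
    qed (auto intro: dimsub_one dimsub_mult)
  qed
qed

text \<open>Induction through 1 - x^(m+1) = (1 - x^m) + (1 - x) - (1 - x)(1 - x^m), whose last term
  lies one power of I deeper.\<close>

lemma dimsub_pow_linear:
  assumes x: "x \<in> dimsub TYPE('k::field) j" and j: "j \<ge> 1"
  shows "(gdelta \<one> - gdelta (x [^] m)) - (\<lambda>z. of_nat m * (gdelta \<one> - gdelta x) z)
    \<in> (aug_pow G (Suc j) :: ('a \<Rightarrow> 'k) set)"
proof (induction m)
  case 0
  have "(gdelta \<one> - gdelta \<one>) - (\<lambda>z. of_nat 0 * (gdelta \<one> - gdelta x) z) = (0 :: 'a \<Rightarrow> 'k)"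
    by (auto simp: fun_eq_iff minus_apply zero_fun_apply)
  then show ?case
    using aug_pow_0 by (simp only: nat_pow_0)
next
  case (Suc m)
  have xc: "x \<in> carrier G" and u: "gdelta \<one> - gdelta x \<in> (aug_pow G j :: ('a \<Rightarrow> 'k) set)"
    using x by (auto simp: dimsub_def)
  let ?u = "gdelta \<one> - gdelta x :: 'a \<Rightarrow> 'k" and ?v = "gdelta \<one> - gdelta (x [^] m) :: 'a \<Rightarrow> 'k"
  have "(gdelta \<one> - gdelta (x [^] Suc m)) - (\<lambda>z. of_nat (Suc m) * ?u z)
      = (?v - (\<lambda>z. of_nat m * ?u z)) - gconv G ?u ?v"
    by (rule group_alg_eqI) (use xc nat_pow_Suc2[of x m] in \<open>simp_all, simp add: algebra_simps\<close>)
  moreover have "gconv G ?u ?v \<in> aug_pow G (Suc j)"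
    using aug_pow_Suc_gconv[OF u aug_ideal_gdelta] xc by simp
  ultimately show ?case
    using aug_pow_diff[OF Suc] by (metis (no_types, lifting))
qed

text \<open>The index climbs one step at a time: m (1 - x) agrees with 1 - x^m modulo the next power
  of I, and m is invertible in characteristic 0.\<close>

lemma dimsub_root:
  assumes xc: "x \<in> carrier G" and m: "(m::nat) \<ge> 1"
    and xm: "x [^] m \<in> dimsub TYPE('k::field_char_0) k" and j: "1 \<le> j" "j \<le> k"
  shows "x \<in> dimsub TYPE('k) j"
  using j
proof (induction j rule: dec_induct)
  case base
  then show ?case
    using xc by (simp add: dimsub_1)
next
  case (step j)
  let ?u = "gdelta \<one> - gdelta x :: 'a \<Rightarrow> 'k" and ?v = "gdelta \<one> - gdelta (x [^] m) :: 'a \<Rightarrow> 'k"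
  have x: "x \<in> dimsub TYPE('k) j"
    using step by simp
  have v: "?v \<in> aug_pow G (Suc j)"
    using xm step by (auto simp: dimsub_def intro: aug_pow_antimono)
  have "(\<lambda>z. of_nat m * ?u z) = ?v - (?v - (\<lambda>z. of_nat m * ?u z))"
    by simp
  also have "\<dots> \<in> aug_pow G (Suc j)"
    by (rule aug_pow_diff[OF v dimsub_pow_linear[OF x step(1)]])
  finally have "(\<lambda>z. inverse (of_nat m) * (of_nat m * ?u z)) \<in> aug_pow G (Suc j)"
    by (rule aug_pow_scale)
  moreover have "(\<lambda>z. inverse (of_nat m) * (of_nat m * ?u z)) = ?u"
    using m by (auto simp: fun_eq_iff field_simps)
  ultimately have "?u \<in> aug_pow G (Suc j)"
    by simp
  then show ?case
    using xc by (simp add: dimsub_def)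
qed

text \<open>One inclusion of Jennings' description of the dimension subgroups; it places u_i in I to
  the power mu_i.\<close>

lemma tau_dimsub: "k \<ge> 1 \<Longrightarrow> tau G k \<subseteq> dimsub TYPE('k::field_char_0) k"
proof
  fix x assume k: "k \<ge> 1" and "x \<in> tau G k"
  then obtain m :: nat where m: "m \<ge> 1" "x [^] m \<in> lcs G (k - 1)" "x \<in> carrier G"
    unfolding tau_def Gamma_def by blast
  then have "x [^] m \<in> dimsub TYPE('k) k"
    using lcs_dimsub[of "k - 1"] k by auto
  then show "x \<in> dimsub TYPE('k) k"
    using dimsub_root[OF m(3,1) _ k] by blast
qed

end

text \<open>Coordinates may be negative; there upper negation leads back to a natural upper
  argument. Integrality of the matrices depends on this.\<close>

lemma gbinomial_of_int_Ints: "(of_int t :: 'k::field_char_0) gchoose k \<in> \<int>"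
proof -
  have nat: "(of_nat n :: 'k) gchoose k \<in> \<int>" for n
    by (simp flip: of_nat_gbinomial)
  show ?thesis
  proof (cases "t \<ge> 0")
    case True
    then show ?thesis
      using nat[of "nat t"] by (simp add: of_nat_nat)
  next
    case False
    then have "(of_nat k - of_int t - 1 :: 'k) = of_nat (nat (int k - t - 1))"
      by (simp add: of_nat_nat)
    then show ?thesis
      using nat[of "nat (int k - t - 1)"] gbinomial_negated_upper[of "of_int t :: 'k" k]
      by (metis Ints_1 Ints_minus Ints_mult Ints_power)
  qed
qed

lemma sum_fun_apply: "(\<Sum>x\<in>A. F x) z = (\<Sum>x\<in>A. F x z :: 'k::comm_monoid_add)"
  by (induction A rule: infinite_finite_induct) (auto simp: plus_fun_apply zero_fun_apply)

lemma foldr_replicate: "foldr f (replicate n x) b = (f x ^^ n) b"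
  by (induction n) auto

text \<open>The parameter \<open>kty\<close> only fixes the type of the coefficient field.\<close>
locale jennings = malcev_group G c xs for G (structure) and c xs +
  fixes kty :: "'k::field_char_0 itself"
begin

section \<open>Monomials in the u_i and their weights\<close>

abbreviation M :: nat where "M \<equiv> length xs"
abbreviation u :: "nat \<Rightarrow> 'a \<Rightarrow> 'k" where "u i \<equiv> uelt G xs i"

lemma uelt_ga: "i < M \<Longrightarrow> u i \<in> group_alg G"
  by (simp add: uelt_def xs_carrier)

lemma uelt_aug_ideal: "i < M \<Longrightarrow> u i \<in> aug_ideal G"
  unfolding uelt_def by (intro aug_ideal_gdelta xs_carrier)

lemma uelt_aug_pow: "i < M \<Longrightarrow> u i \<in> aug_pow G (mu G xs i)"
  using tau_dimsub[of "mu G xs i", where 'k = 'k] mu_props[of i] by (auto simp: dimsub_def uelt_def)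

text \<open>The tail of a monomial from the factor with index j on, which permits induction from the
  last generator downwards.\<close>

definition tm :: "nat \<Rightarrow> nat list \<Rightarrow> 'a \<Rightarrow> 'k" where
  "tm j r = foldr (gconv G) (concat (map (\<lambda>i. replicate (r ! i) (u i)) [j..<M])) (gdelta \<one>)"

lemma umon_tm: "umon G xs r = tm 0 r"
  by (simp add: umon_def tm_def)

lemma tm_last: "tm M r = gdelta \<one>"
  by (simp add: tm_def)

lemma tm_step: "j < M \<Longrightarrow> tm j r = (gconv G (u j) ^^ (r ! j)) (tm (Suc j) r)"
  by (simp add: tm_def upt_conv_Cons foldr_replicate)

lemma tm_skip:
  assumes "\<forall>l<j. r ! l = 0" "j \<le> M"
  shows "tm 0 r = tm j r"
  using assms
proof (induction j)
  case (Suc j)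
  then show ?case
    using tm_step[of j r] by simp
qed simp

lemma tm_update:
  assumes "length r = M" "j < M"
  shows "gconv G (u j) (tm j r) = tm j (r[j := Suc (r ! j)])"
proof -
  have "tm (Suc j) (r[j := Suc (r ! j)]) = tm (Suc j) r"
    unfolding tm_def by (intro arg_cong[of _ _ "\<lambda>l. foldr (gconv G) (concat l) (gdelta \<one>)"] map_cong) auto
  then show ?thesis
    using assms by (simp add: tm_step)
qed

lemma upow_ga: "j < M \<Longrightarrow> b \<in> group_alg G \<Longrightarrow> (gconv G (u j) ^^ n) b \<in> group_alg G"
  by (induction n) (auto simp: uelt_ga)

lemma tm_ga: "j \<le> M \<Longrightarrow> tm j r \<in> group_alg G"
  by (induction rule: inc_induct) (auto simp: tm_last tm_step upow_ga)

lemma umon_ga: "(umon G xs r :: 'a \<Rightarrow> 'k) \<in> group_alg G"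
  by (simp add: umon_tm tm_ga)

lemma upow_aug_pow:
  "j < M \<Longrightarrow> b \<in> aug_pow G w \<Longrightarrow> (gconv G (u j) ^^ n) b \<in> aug_pow G (n * mu G xs j + w)"
proof (induction n)
  case (Suc n)
  then show ?case
    using aug_pow_mult[OF uelt_aug_pow[of j] Suc.IH] by (simp add: add.assoc)
qed simp

lemma tm_aug_pow: "j \<le> M \<Longrightarrow> tm j r \<in> aug_pow G (\<Sum>l = j..<M. r ! l * mu G xs l)"
proof (induction rule: inc_induct)
  case (step j)
  then show ?case
    using upow_aug_pow[of j "tm (Suc j) r"] by (simp add: tm_step sum.atLeast_Suc_lessThan)
qed (simp add: tm_last)

lemma umon_aug_pow: "(umon G xs r :: 'a \<Rightarrow> 'k) \<in> aug_pow G (\<Sum>l<M. r ! l * mu G xs l)"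
  using tm_aug_pow[of 0 r] by (simp add: umon_tm lessThan_atLeast0)

lemma gconv_Ints:
  fixes a b :: "'a \<Rightarrow> 'k"
  assumes "\<And>z. a z \<in> \<int>" "\<And>z. b z \<in> \<int>"
  shows "gconv G a b z \<in> \<int>"
  unfolding gconv_def using assms by (intro Ints_sum) (simp add: Ints_mult)

lemma gdelta_Ints: "(gdelta g :: 'a \<Rightarrow> 'k) z \<in> \<int>"
  by (simp add: gdelta_def)

lemma umon_Ints: "(umon G xs r :: 'a \<Rightarrow> 'k) z \<in> \<int>"
proof -
  have "foldr (gconv G) ls (gdelta \<one>) z \<in> \<int>" if "\<forall>a\<in>set ls. \<forall>z. a z \<in> \<int>" for ls :: "('a \<Rightarrow> 'k) list" and z
    using that
  proof (induction ls arbitrary: z)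
    case (Cons a ls)
    then show ?case
      by (auto intro!: gconv_Ints)
  qed (simp add: gdelta_Ints)
  moreover have "(u i) z \<in> \<int>" for i z
    by (simp add: uelt_def gdelta_Ints minus_apply)
  ultimately show ?thesis
    unfolding umon_def by auto
qed

section \<open>Binomial functions dual to the monomials\<close>

definition BB :: "(nat \<Rightarrow> nat) \<Rightarrow> 'a \<Rightarrow> 'k" where
  "BB s g = (\<Prod>i<M. of_int (coord i g) gchoose s i)"

lemma BB_Ints: "BB s g \<in> \<int>"
  unfolding BB_def by (intro Ints_prod gbinomial_of_int_Ints)

text \<open>Up to the constant 1 / s_i!, the binomial of order s_i is a product of s_i shifted
  copies of one coordinate, each of degree at most mu_i.\<close>

lemma wpoly_BB: "wpoly G (tau G) (carrier G) (Suc (\<Sum>i<M. s i * mu G xs i)) (BB s)"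
proof -
  have "wpoly G (tau G) (carrier G) (Suc (s i * mu G xs i)) (\<lambda>g. of_int (coord i g) gchoose s i :: 'k)"
    if i: "i < M" for i
  proof -
    have T: "carrier G \<subseteq> tau G 1"
      using tau_1 by simp
    have "wpoly G (tau G) (carrier G) (Suc (\<Sum>l\<in>{0..<s i}. mu G xs i))
        (\<lambda>g. \<Prod>l\<in>{0..<s i}. of_int (coord i g) + (- of_nat l) :: 'k)"
    proof (rule wpoly_prod[OF subgroup_self, where T = "tau G"])
      show "carrier G \<subseteq> tau G 1"
        by (rule T)
      show "wpoly G (tau G) (carrier G) (Suc (mu G xs i)) (\<lambda>g. of_int (coord i g) + (- of_nat l) :: 'k)" for l
        by (rule wpoly_add[OF subgroup_self wpoly_coord[OF i] wpoly_const[OF subgroup_self]])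
    qed simp
    then have "wpoly G (tau G) (carrier G) (Suc (s i * mu G xs i))
        (\<lambda>g. inverse (fact (s i)) * (\<Prod>l\<in>{0..<s i}. of_int (coord i g) + (- of_nat l)) :: 'k)"
      using wpoly_scale[OF subgroup_self, where T = "tau G", OF T] by (simp del: wpoly.simps)
    moreover have "(\<lambda>g. inverse (fact (s i)) * (\<Prod>l\<in>{0..<s i}. of_int (coord i g) + (- of_nat l)) :: 'k)
        = (\<lambda>g. of_int (coord i g) gchoose s i)"
      by (simp add: gbinomial_prod_rev field_simps)
    ultimately show ?thesis
      by (simp del: wpoly.simps)
  qed
  then show ?thesis
    unfolding BB_def using tau_1 by (intro wpoly_prod[OF subgroup_self, where T = "tau G"]) auto
qed

lemma lin_BB_aug_pow:
  assumes "(\<Sum>i<M. s i * mu G xs i) < n" "a \<in> aug_pow G n"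
  shows "lin (BB s) a = 0"
proof -
  have "wpoly G (tau G) (carrier G) n (BB s)"
    by (rule wpoly_mono[OF subgroup_self wpoly_BB]) (use assms in simp)
  then show ?thesis
    using lin_vanish_aug_pow[of "tau G" n "BB s" a] tau_1 assms(2) by simp
qed

lemma BB_one: "BB s \<one> = (if \<forall>l<M. s l = 0 then 1 else 0)"
proof -
  have "BB s \<one> = (\<Prod>i<M. if s i = 0 then 1 else 0)"
    unfolding BB_def by (intro prod.cong refl) (simp add: coord_one gbinomial_0_left)
  then show ?thesis
    by (auto simp: prod_zero_iff)
qed

text \<open>Pascal's rule in the j-th binomial; the other coordinates do not move.\<close>

lemma BB_mult_xs:
  assumes j: "j < M" and g: "g \<in> MS j"
  shows "BB s (xs ! j \<otimes> g) = BB s g + (if s j = 0 then 0 else BB (s(j := s j - 1)) g)"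
proof -
  have split: "BB s h = (of_int (coord j h) gchoose s j) * (\<Prod>i\<in>{..<M} - {j}. of_int (coord i h) gchoose s i)"
    for s h
    unfolding BB_def using j by (subst prod.remove[of _ j]) auto
  have rest: "(\<Prod>i\<in>{..<M} - {j}. of_int (coord i (xs ! j \<otimes> g)) gchoose s i)
      = (\<Prod>i\<in>{..<M} - {j}. of_int (coord i g) gchoose s i :: 'k)"
    using coord_mult_xs[OF j _ g] by (intro prod.cong) auto
  have rest': "(\<Prod>i\<in>{..<M} - {j}. of_int (coord i g) gchoose (s(j := s j - 1)) i)
      = (\<Prod>i\<in>{..<M} - {j}. of_int (coord i g) gchoose s i :: 'k)"
    by (intro prod.cong) auto
  have "(of_int (coord j (xs ! j \<otimes> g)) gchoose s j :: 'k)
      = (of_int (coord j g) gchoose s j) + (if s j = 0 then 0 else of_int (coord j g) gchoose (s j - 1))"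
    using coord_mult_xs[OF j j g] by (cases "s j") (auto simp: gbinomial_Suc_Suc)
  then show ?thesis
    unfolding split rest rest' by (simp add: algebra_simps)
qed

lemma gsupp_gconv_MS:
  fixes a b :: "'a \<Rightarrow> 'k"
  shows "gsupp a \<subseteq> MS j \<Longrightarrow> gsupp b \<subseteq> MS j \<Longrightarrow> gsupp (gconv G a b) \<subseteq> MS j"
  using gsupp_gconv[of G a b] subgroup.m_closed[OF MS_subgroup] by fastforce

lemma gsupp_uelt: "j < M \<Longrightarrow> gsupp (u j) \<subseteq> MS j"
  unfolding uelt_def using gsupp_diff[of "gdelta \<one> :: 'a \<Rightarrow> 'k" "gdelta (xs ! j)"] xs_MS[of j] by auto

text \<open>On elements supported in \<open>MS j\<close>, left multiplication by u_j acts on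
  binomial functions as minus the lowering of s_j, by Pascal's rule, and gives 0 when s_j is
  0.\<close>

lemma lin_BB_upow:
  assumes j: "j < M" and b: "b \<in> group_alg G" "gsupp b \<subseteq> MS j"
  shows "lin (BB s) ((gconv G (u j) ^^ n) b)
    = (if n \<le> s j then (-1) ^ n * lin (BB (s(j := s j - n))) b else 0)"
proof (induction n arbitrary: s)
  case (Suc n)
  let ?b = "(gconv G (u j) ^^ n) b"
  define s' where "s' = s(j := s j - 1)"
  have e: "s' j = s j - 1" "s'(j := s j - 1 - n) = s(j := s j - Suc n)"
    by (auto simp: s'_def)
  have sb: "gsupp ?b \<subseteq> MS j"
    using b(2) gsupp_gconv_MS[OF gsupp_uelt[OF j]] by (induction n) auto
  have gb: "?b \<in> group_alg G"
    using upow_ga j b by blast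
  have "lin (BB s) ((gconv G (u j) ^^ Suc n) b) = lin (BB s) (gconv G (u j) ?b)"
    by simp
  also have "\<dots> = lin (\<lambda>y. BB s (\<one> \<otimes> y)) ?b - lin (\<lambda>y. BB s (xs ! j \<otimes> y)) ?b"
    using gb uelt_ga[OF j] xs_carrier[OF j] by (simp add: uelt_def)
  also have "lin (\<lambda>y. BB s (\<one> \<otimes> y)) ?b = lin (BB s) ?b"
    by (rule lin_cong_carrier[OF gb]) simp
  also have "lin (\<lambda>y. BB s (xs ! j \<otimes> y)) ?b
      = lin (\<lambda>y. BB s y + (if s j = 0 then 0 else 1) * BB (s(j := s j - 1)) y) ?b"
    using sb BB_mult_xs[OF j] by (intro lin_cong) auto
  finally have "lin (BB s) ((gconv G (u j) ^^ Suc n) b)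
      = - ((if s j = 0 then 0 else 1) * lin (BB s') ?b)"
    unfolding lin_fun_add lin_fun_scale s'_def by simp
  also have "\<dots> = (if Suc n \<le> s j then (-1) ^ Suc n * lin (BB (s(j := s j - Suc n))) b else 0)"
    unfolding Suc.IH[of s'] e by (cases "s j") auto
  finally show ?case .
qed simp

text \<open>Each power of u_j lowers s_j by \<open>r ! j\<close>, and at the end only a value at the
  identity remains. The support claim is carried along because the lowering formula holds only on
  \<open>MS j\<close>.\<close>

lemma lin_BB_tm:
  "j \<le> M \<Longrightarrow> lin (BB s) (tm j r) = (if (\<forall>l<j. s l = 0) \<and> (\<forall>l. j \<le> l \<and> l < M \<longrightarrow> s l = r ! l)
    then (-1) ^ (\<Sum>l = j..<M. r ! l) else 0) \<and> gsupp (tm j r) \<subseteq> MS j"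
proof (induction arbitrary: s rule: inc_induct)
  case base
  then show ?case
    by (simp add: tm_last BB_one)
next
  case (step j)
  have supp: "gsupp (tm (Suc j) r) \<subseteq> MS j"
    using step.IH MS_antimono[of j "Suc j"] by auto
  have "gsupp ((gconv G (u j) ^^ n) (tm (Suc j) r)) \<subseteq> MS j" for n
    using supp gsupp_gconv_MS[OF gsupp_uelt[OF step(2)]] by (induction n) auto
  then have 1: "gsupp (tm j r) \<subseteq> MS j"
    using step(2) by (simp add: tm_step)
  let ?n = "r ! j"
  define s' where "s' = s(j := s j - ?n)"
  \<comment> \<open>The tail from \<open>Suc j\<close> demands \<open>s' j = 0\<close>; together
    with the guard \<open>?n \<le> s j\<close> against truncated subtraction this says
    \<open>s j = ?n\<close>.\<close>
  have A: "?n \<le> s j \<and> (\<forall>l<Suc j. s' l = 0) \<and> (\<forall>l. Suc j \<le> l \<and> l < M \<longrightarrow> s' l = r ! l)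
      \<longleftrightarrow> (\<forall>l<j. s l = 0) \<and> (\<forall>l. j \<le> l \<and> l < M \<longrightarrow> s l = r ! l)"
    unfolding s'_def using step(2) by (auto simp: less_Suc_eq Suc_le_eq le_less)
  have "lin (BB s) (tm j r) = (if ?n \<le> s j then (-1) ^ ?n * lin (BB s') (tm (Suc j) r) else 0)"
    unfolding s'_def using lin_BB_upow[OF step(2) tm_ga supp] step(2) by (simp add: tm_step)
  also have "\<dots> = (if ?n \<le> s j \<and> (\<forall>l<Suc j. s' l = 0) \<and> (\<forall>l. Suc j \<le> l \<and> l < M \<longrightarrow> s' l = r ! l)
      then (-1) ^ ?n * (-1) ^ (\<Sum>l = Suc j..<M. r ! l) else 0)"
    using step.IH[of s'] by auto
  also have "\<dots> = (if (\<forall>l<j. s l = 0) \<and> (\<forall>l. j \<le> l \<and> l < M \<longrightarrow> s l = r ! l)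
    then (-1) ^ (\<Sum>l = j..<M. r ! l) else 0)"
    unfolding A using step(2) by (simp add: sum.atLeast_Suc_lessThan power_add)
  finally show ?case
    using 1 by blast
qed

text \<open>The sign cancels the one produced by \<open>lin_BB_tm\<close>, so these functionals are
  exactly dual to the monomials.\<close>

definition coef :: "nat list \<Rightarrow> ('a \<Rightarrow> 'k) \<Rightarrow> 'k" where
  "coef s a = (-1) ^ (\<Sum>l<M. s ! l) * lin (BB ((!) s)) a"

lemma coef_umon:
  assumes "length r = M" "length s = M"
  shows "coef s (umon G xs r) = (if r = s then 1 else 0)"
proof -
  have "(\<forall>l<M. s ! l = r ! l) \<longleftrightarrow> r = s"
    using assms by (metis nth_equalityI)
  then show ?thesis
    using lin_BB_tm[of 0 "(!) s" r]
    by (auto simp: coef_def umon_tm lessThan_atLeast0 simp flip: power_add mult_2)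
qed

lemma coef_ga:
  assumes "a \<in> group_alg G" "b \<in> group_alg G"
  shows "coef s (a + b) = coef s a + coef s b" "coef s (a - b) = coef s a - coef s b"
    "coef s (\<lambda>z. k * a z) = k * coef s a"
  using assms by (simp_all add: coef_def algebra_simps)

lemma coef_zero: "coef s 0 = 0"
  by (simp add: coef_def)

lemma coef_aug_pow:
  assumes "s \<in> jidx G n xs" "n \<ge> 1" "a \<in> aug_pow G n"
  shows "coef s a = 0"
  using lin_BB_aug_pow[of "(!) s" n a] assms by (auto simp: coef_def jidx_def)

text \<open>Made for spanning modulo I^n. Admitting only generators from index j on keeps the set
  stable under left multiplication by u_j: this merely raises the leading exponent, so no factors
  have to be reordered.\<close>

inductive_set W :: "nat \<Rightarrow> nat \<Rightarrow> ('a \<Rightarrow> 'k) set" for n j where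
  base: "p \<in> aug_pow G n \<Longrightarrow> p \<in> W n j"
| step: "f \<in> W n j \<Longrightarrow> length r = M \<Longrightarrow> \<forall>l<j. r ! l = 0 \<Longrightarrow> (\<lambda>z. a * umon G xs r z) + f \<in> W n j"

lemma W_ga: "f \<in> W n j \<Longrightarrow> f \<in> group_alg G"
  by (induction rule: W.induct) (auto simp: aug_pow_ga umon_ga)

lemma W_add: "f \<in> W n j \<Longrightarrow> f' \<in> W n j \<Longrightarrow> f + f' \<in> W n j"
proof (induction rule: W.induct)
  case (base p)
  from base(2,1) show ?case
  proof (induction rule: W.induct)
    case (base q)
    then show ?case
      by (auto intro: W.base aug_pow_add)
  next
    case (step f r a)
    then show ?case
      using W.step[of "p + f" n j r a] by (simp add: add.left_commute)
  qed
next
  case (step f r a)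
  then show ?case
    using W.step[of "f + f'" n j r a] by (simp add: add.assoc)
qed

lemma W_scale: "f \<in> W n j \<Longrightarrow> (\<lambda>z. k * f z) \<in> W n j"
proof (induction rule: W.induct)
  case (base p)
  then show ?case
    by (intro W.base aug_pow_scale)
next
  case (step f r a)
  have "(\<lambda>z. k * ((\<lambda>z. a * umon G xs r z) + f) z) = (\<lambda>z. (k * a) * umon G xs r z) + (\<lambda>z. k * f z)"
    by (auto simp: plus_fun_apply algebra_simps)
  then show ?case
    using W.step[OF step.IH step.hyps(2,3), of "k * a"] by simp
qed

lemma W_diff:
  assumes "f \<in> W n j" "f' \<in> W n j"
  shows "f - f' \<in> W n j"
proof -
  have "f - f' = f + (\<lambda>z. (-1) * f' z)"
    by (auto simp: fun_eq_iff plus_fun_apply minus_apply)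
  then show ?thesis
    using W_add[OF assms(1) W_scale[OF assms(2), of "-1"]] by metis
qed

lemma W_Suc: "f \<in> W n (Suc j) \<Longrightarrow> f \<in> W n j"
  by (induction rule: W.induct) (auto intro: W.intros)

lemma W_uelt:
  assumes j: "j < M"
  shows "f \<in> W n j \<Longrightarrow> gconv G (u j) f \<in> W n j"
proof (induction rule: W.induct)
  case (base p)
  then show ?case
    by (intro W.base aug_pow_gconv_left uelt_ga j)
next
  case (step f r a)
  let ?r = "r[j := Suc (r ! j)]"
  have "gconv G (u j) ((\<lambda>z. a * umon G xs r z) + f)
      = (\<lambda>z. a * gconv G (u j) (umon G xs r) z) + gconv G (u j) f"
    using W_ga[OF step(1)] umon_ga uelt_ga[OF j] by (simp add: gconv_laws)
  also have "gconv G (u j) (umon G xs r) = gconv G (u j) (tm j r)"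
    using step j by (simp add: umon_tm tm_skip)
  also have "\<dots> = tm j ?r"
    using tm_update step j by simp
  also have "\<dots> = umon G xs ?r"
    using step j tm_skip[of j ?r] by (simp add: umon_tm)
  finally show ?case
    using W.step[OF step.IH, of ?r a] step.hyps by simp
qed

lemma W_xs:
  assumes j: "j < M" and f: "f \<in> W n j"
  shows "gconv G (gdelta (xs ! j)) f \<in> W n j"
proof -
  have "gconv G (u j) f = f - gconv G (gdelta (xs ! j)) f"
    using W_ga[OF f] xs_carrier[OF j] by (simp add: uelt_def gconv_laws gconv_one)
  then have "gconv G (gdelta (xs ! j)) f = f - gconv G (u j) f"
    by simp
  then show ?thesis
    using W_diff[OF f W_uelt[OF j f]] by simp
qed

text \<open>With x = \<open>xs ! j\<close> and u = 1 - x one has x^-1 f = f + x^-1 (u f), where u f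
  lies one power of I deeper. The recursion ends in I^n: a truncated geometric series.\<close>

lemma W_xs_inv:
  assumes j: "j < M" and f: "f \<in> W n j"
  shows "gconv G (gdelta (inv (xs ! j))) f \<in> W n j"
proof -
  have "\<forall>f \<in> W n j \<inter> aug_pow G m. gconv G (gdelta (inv (xs ! j))) f \<in> W n j" if "m \<le> n" for m
    using that
  proof (induction rule: inc_induct)
    case base
    then show ?case
      using xs_carrier[OF j] by (auto intro!: W.base aug_pow_gconv_left)
  next
    case (step m)
    show ?case
    proof
      fix f assume f: "f \<in> W n j \<inter> aug_pow G m"
      have uf: "gconv G (u j) f \<in> W n j \<inter> aug_pow G (Suc m)"
        using f W_uelt[OF j] aug_pow_mult[OF aug_ideal_aug_pow[OF uelt_aug_ideal[OF j]], of f m] by auto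
      have fg: "f \<in> group_alg G"
        using f W_ga by blast
      have "gconv G (u j) f = f - gconv G (gdelta (xs ! j)) f"
        using fg xs_carrier[OF j] by (simp add: uelt_def gconv_laws gconv_one)
      then have "gconv G (gdelta (inv (xs ! j))) (gconv G (u j) f) = gconv G (gdelta (inv (xs ! j))) f - f"
        using fg xs_carrier[OF j] by (simp add: gconv_laws gconv_one gconv_gdelta flip: gconv_assoc)
      then have "gconv G (gdelta (inv (xs ! j))) f = f + gconv G (gdelta (inv (xs ! j))) (gconv G (u j) f)"
        by simp
      then show "gconv G (gdelta (inv (xs ! j))) f \<in> W n j"
        using W_add[of f n j] uf f step.IH by auto
    qed
  qed
  from this[of 0] f W_ga[OF f] show ?thesis
    by simp
qed

lemma W_xs_pow:
  assumes j: "j < M" and f: "f \<in> W n j"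
  shows "gconv G (gdelta (xs ! j [^] (t::int))) f \<in> W n j"
proof -
  note x = xs_carrier[OF j]
  have nat: "gconv G (gdelta (y [^] (m::nat))) f \<in> W n j"
    if y: "y \<in> carrier G" "\<And>f. f \<in> W n j \<Longrightarrow> gconv G (gdelta y) f \<in> W n j" for y m
  proof (induction m)
    case 0
    then show ?case
      using f W_ga[OF f] by (simp add: gconv_one)
  next
    case (Suc m)
    have "gconv G (gdelta (y [^] Suc m)) f = gconv G (gdelta y) (gconv G (gdelta (y [^] m)) f)"
      using y W_ga[OF f] nat_pow_Suc2[OF y(1), of m] by (simp add: gconv_gdelta flip: gconv_assoc)
    then show ?case
      using y(2)[OF Suc] by simp
  qed
  show ?thesis
  proof (cases "t \<ge> 0")
    case True
    then show ?thesis
      using nat[OF x W_xs[OF j], of "nat t"] by (simp add: int_pow_int[symmetric])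
  next
    case False
    then have "xs ! j [^] t = inv (xs ! j) [^] (nat (- t))"
      using x nat_pow_inv[OF x, of "nat (- t)"] int_pow_def2[of G "xs ! j" t] by simp
    then show ?thesis
      using nat[OF _ W_xs_inv[OF j], of "nat (- t)"] x by simp
  qed
qed

text \<open>Downward induction along the series: g is a power of \<open>xs ! j\<close> times an
  element of the next term.\<close>

lemma gdelta_W: "j \<le> M \<Longrightarrow> g \<in> MS j \<Longrightarrow> gdelta g \<in> W n j"
proof (induction arbitrary: g rule: inc_induct)
  case base
  have "umon G xs (replicate M 0) = (gdelta \<one> :: 'a \<Rightarrow> 'k)"
    using tm_skip[of M "replicate M 0"] by (simp add: umon_tm tm_last)
  then show ?case
    using W.step[OF W.base[OF aug_pow_0], of "replicate M 0" M 1 n] base by (simp add: MS_length)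
next
  case (step j)
  have "gdelta (rho j g) \<in> W n j"
    using step.IH[OF tco_rho(2)] step W_Suc by blast
  then have "gconv G (gdelta (xs ! j [^] tco j g)) (gdelta (rho j g)) \<in> W n j"
    by (rule W_xs_pow[OF step(2)])
  moreover have "rho j g \<in> carrier G" "xs ! j [^] tco j g \<in> carrier G"
    using tco_rho(2)[OF step(2) step.prems] MS_carrier xs_carrier[OF step(2)] by auto
  ultimately show ?case
    using tco_rho(1)[OF step(2) step.prems] by (simp add: gconv_gdelta)
qed

lemma group_alg_W:
  assumes "f \<in> group_alg G"
  shows "f \<in> W n 0"
proof -
  have "(\<Sum>x\<in>A. (\<lambda>z. f x * gdelta x z)) \<in> W n 0" if "finite A" "A \<subseteq> carrier G" for A
    using that
  proof (induction A rule: finite_induct)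
    case empty
    then show ?case
      using W.base[OF aug_pow_0] by simp
  next
    case (insert x A)
    then show ?case
      using W_add[OF W_scale[OF gdelta_W[of 0 x]]] by simp
  qed
  moreover have "(\<Sum>x\<in>gsupp f. (\<lambda>z. f x * gdelta x z)) = f"
  proof
    fix z
    have "(\<Sum>x\<in>gsupp f. (\<lambda>z. f x * gdelta x z)) z = (\<Sum>x\<in>gsupp f. f x * gdelta x z)"
      by (rule sum_fun_apply)
    also have "\<dots> = (\<Sum>x\<in>gsupp f. if z = x then f x else 0)"
      by (intro sum.cong) (auto simp: gdelta_def)
    also have "\<dots> = f z"
      using group_alg_finite[OF assms] by (auto simp: gsupp_def)
    finally show "(\<Sum>x\<in>gsupp f. (\<lambda>z. f x * gdelta x z)) z = f z" .
  qed
  ultimately show ?thesis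
    using assms by (metis (no_types, lifting) group_alg_finite group_alg_carrier subsetI)
qed

end

section \<open>Words in unitriangular groups\<close>

lemma matmul_assoc: "matmul d (matmul d A B) C = matmul d A (matmul d B C)"
proof (intro ext)
  fix i j
  have "(\<Sum>l<d. (\<Sum>k<d. A i k * B k l) * C l j) = (\<Sum>l<d. \<Sum>k<d. A i k * B k l * C l j)"
    by (simp add: sum_distrib_right)
  also have "\<dots> = (\<Sum>k<d. \<Sum>l<d. A i k * B k l * C l j)"
    by (rule sum.swap)
  also have "\<dots> = (\<Sum>k<d. A i k * (\<Sum>l<d. B k l * C l j))"
    by (simp add: sum_distrib_left mult.assoc)
  finally show "matmul d (matmul d A B) C i j = matmul d A (matmul d B C) i j"
    by (simp add: matmul_def)
qed

lemma matmul_one: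
  assumes "\<And>i j. d \<le> i \<or> d \<le> j \<Longrightarrow> A i j = 0"
  shows "matmul d (matone d) A = A" "matmul d A (matone d) = A"
proof -
  have "(\<Sum>k<d. matone d i k * A k j) = (\<Sum>k<d. if k = i then A i j else 0)" for i j
    by (intro sum.cong) (auto simp: matone_def)
  then show "matmul d (matone d) A = A"
    using assms by (auto simp: matmul_def fun_eq_iff)
  have "(\<Sum>k<d. A i k * matone d k j) = (\<Sum>k<d. if k = j then A i j else 0)" for i j
    by (intro sum.cong) (auto simp: matone_def)
  then show "matmul d A (matone d) = A"
    using assms by (auto simp: matmul_def fun_eq_iff)
qed

lemma UTZ_simps [simp]: "monoid.mult (UTZ d) = matmul d" "one (UTZ d) = matone d"
  by (simp_all add: UTZ_def)

lemma UTZ_carrier: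
  "A \<in> carrier (UTZ d) \<longleftrightarrow> upper_unitri d A \<and> (\<forall>i j. A i j \<in> \<int>) \<and> (\<forall>i j. d \<le> i \<or> d \<le> j \<longrightarrow> A i j = 0)"
  by (simp add: UTZ_def)

lemma UTZ_zero: "A \<in> carrier (UTZ d) \<Longrightarrow> d \<le> i \<or> d \<le> j \<Longrightarrow> A i j = 0"
  by (auto simp: UTZ_carrier)

lemma UTZ_monoid: "monoid (UTZ d :: (nat \<Rightarrow> nat \<Rightarrow> 'k::field) monoid)"
proof (rule monoidI)
  fix A B :: "nat \<Rightarrow> nat \<Rightarrow> 'k"
  assume A: "A \<in> carrier (UTZ d)" and B: "B \<in> carrier (UTZ d)"
  have "matmul d A B i i = 1" if i: "i < d" for i
  proof -
    have "(\<Sum>k<d. A i k * B k i) = (\<Sum>k<d. if k = i then 1 else 0)"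
    proof (intro sum.cong refl)
      fix k assume "k \<in> {..<d}"
      then show "A i k * B k i = (if k = i then 1 else 0)"
        using A B i by (cases k i rule: linorder_cases) (auto simp: UTZ_carrier upper_unitri_def)
    qed
    then show ?thesis
      using i by (simp add: matmul_def)
  qed
  moreover have "matmul d A B i j = 0" if i: "i < d" "j < i" for i j
    unfolding matmul_def
  proof (intro sum.neutral ballI)
    fix k assume "k \<in> {..<d}"
    then show "A i k * B k j = 0"
      using A B i by (cases "k < i") (auto simp: UTZ_carrier upper_unitri_def)
  qed
  moreover have "matmul d A B i j \<in> \<int>" for i j
    unfolding matmul_def using A B by (auto simp: UTZ_carrier intro!: Ints_sum Ints_mult)
  moreover have "matmul d A B i j = 0" if "d \<le> i \<or> d \<le> j" for i j
    unfolding matmul_def using A B that by (auto simp: UTZ_carrier)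
  ultimately show "A \<otimes>\<^bsub>UTZ d\<^esub> B \<in> carrier (UTZ d)"
    by (simp add: UTZ_carrier upper_unitri_def)
next
  show "\<one>\<^bsub>UTZ d\<^esub> \<in> carrier (UTZ d :: (nat \<Rightarrow> nat \<Rightarrow> 'k) monoid)"
    by (auto simp: UTZ_carrier upper_unitri_def matone_def)
qed (auto simp: matmul_assoc matmul_one UTZ_zero)

definition transvection :: "nat \<Rightarrow> nat \<Rightarrow> nat \<Rightarrow> 'k::field \<Rightarrow> nat \<Rightarrow> nat \<Rightarrow> 'k" where
  "transvection d i j a = (\<lambda>r s. if r < d \<and> s < d then if r = s then 1 else if r = i \<and> s = j then a else 0 else 0)"

lemma transvection_carrier: "i < j \<Longrightarrow> j < d \<Longrightarrow> a \<in> \<int> \<Longrightarrow> transvection d i j a \<in> carrier (UTZ d)"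
  by (auto simp: UTZ_carrier upper_unitri_def transvection_def)

lemma matmul_transvection:
  assumes "k < d" "l < d" "k \<noteq> l"
  shows "matmul d A (transvection d k l b) r s = (if s < d then A r s + (if s = l then A r k * b else 0) else 0)"
proof (cases "s < d")
  case True
  have "matmul d A (transvection d k l b) r s
      = (\<Sum>t<d. (if t = s then A r s else 0) + (if t = k then (if s = l then A r k * b else 0) else 0))"
    unfolding matmul_def using True assms by (intro sum.cong) (auto simp: transvection_def)
  then show ?thesis
    using True assms by (simp add: sum.distrib)
next
  case False
  then show ?thesis
    by (auto simp: matmul_def transvection_def)
qed

lemma transvection_add:
  assumes "i < j" "j < d"
  shows "matmul d (transvection d i j a) (transvection d i j b) = transvection d i j (a + b)"
  using assms by (intro ext) (simp add: matmul_transvection, auto simp: transvection_def)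

text \<open>The commutator of two elementary matrices, with the inverses written as transvections
  with negated entries.\<close>

lemma transvection_commutator:
  assumes "i < k" "k < j" "j < d"
  shows "matmul d (transvection d i k a) (matmul d (transvection d k j b) (matmul d (transvection d i k (- a)) (transvection d k j (- b))))
    = transvection d i j (a * b)"
  unfolding matmul_assoc[symmetric]
  using assms by (intro ext) (simp add: matmul_transvection, auto simp: transvection_def)

lemma transvection_zero: "transvection d i j 0 = matone d"
  by (auto simp: transvection_def matone_def fun_eq_iff)

text \<open>A witness form of \<open>wlen K T h \<le> L\<close>: unlike the \<open>LEAST\<close> in
  \<open>wlen\<close> it includes the existence of a word, and so it composes under
  products.\<close>

definition haslen :: "('a, 'b) monoid_scheme \<Rightarrow> 'a set \<Rightarrow> nat \<Rightarrow> 'a \<Rightarrow> bool" where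
  "haslen K T L h \<longleftrightarrow> (\<exists>ws\<in>words_of K T. length ws \<le> L \<and> wprod K ws = h)"

lemma haslen_wlen: "haslen K T L h \<Longrightarrow> wlen K T h \<le> L"
  unfolding haslen_def wlen_def by (metis (mono_tags, lifting) Least_le order_trans)

lemma haslen_mono: "haslen K T L h \<Longrightarrow> L \<le> L' \<Longrightarrow> haslen K T L' h"
  unfolding haslen_def using order_trans by blast

lemma haslen_mult:
  assumes "haslen (UTZ d) T L A" "haslen (UTZ d) T L' B" "B \<in> carrier (UTZ d)"
  shows "haslen (UTZ d) T (L + L') (matmul d A B)"
proof -
  obtain ws vs where ws: "ws \<in> words_of (UTZ d) T" "length ws \<le> L" "wprod (UTZ d) ws = A"
    and vs: "vs \<in> words_of (UTZ d) T" "length vs \<le> L'" "wprod (UTZ d) vs = B"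
    using assms by (auto simp: haslen_def)
  have "foldr (matmul d) us B = matmul d (foldr (matmul d) us (matone d)) B" for us
    by (induction us) (simp_all add: matmul_assoc matmul_one(1)[OF UTZ_zero[OF assms(3)]])
  then have "wprod (UTZ d) (ws @ vs) = matmul d A B"
    using ws vs by (simp add: wprod_def)
  moreover have "ws @ vs \<in> words_of (UTZ d) T"
    using ws vs by (simp add: words_of_def)
  ultimately show ?thesis
    unfolding haslen_def using ws vs by (metis add_mono length_append)
qed

lemma haslen_generates: "generates K T H \<Longrightarrow> h \<in> H \<Longrightarrow> \<exists>L. haslen K T L h"
  unfolding generates_def haslen_def by blast

text \<open>T is any generating set, so the constant comes from some words for the transvections
  with entries 1 and -1. Both signs are kept because the commutator step uses inverses.\<close>

lemma transvection_short_one: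
  assumes T: "generates (UTZ d :: (nat \<Rightarrow> nat \<Rightarrow> 'k::field) monoid) T (carrier (UTZ d))"
    and i: "Suc i < d"
  obtains A where "\<And>N e. e \<in> {1, -1::'k} \<Longrightarrow> haslen (UTZ d) T (A * N) (transvection d i (Suc i) (e * of_nat N))"
proof -
  obtain L1 where L1: "haslen (UTZ d) T L1 (transvection d i (Suc i) (1::'k))"
    using haslen_generates[OF T transvection_carrier[of i "Suc i" d 1]] i by auto
  obtain L2 where L2: "haslen (UTZ d) T L2 (transvection d i (Suc i) (-1::'k))"
    using haslen_generates[OF T transvection_carrier[of i "Suc i" d "-1"]] i by auto
  have "haslen (UTZ d) T ((L1 + L2) * N) (transvection d i (Suc i) (e * of_nat N))" if e: "e \<in> {1, -1::'k}" for N e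
  proof (induction N)
    case 0
    then show ?case
      by (auto simp: transvection_zero haslen_def words_of_def wprod_def intro: bexI[of _ "[]"])
  next
    case (Suc N)
    have "haslen (UTZ d) T (L1 + L2) (transvection d i (Suc i) e)"
      using e L1 L2 by (auto elim: haslen_mono)
    then have "haslen (UTZ d) T ((L1 + L2) + (L1 + L2) * N)
        (matmul d (transvection d i (Suc i) e) (transvection d i (Suc i) (e * of_nat N)))"
      using e i by (intro haslen_mult Suc transvection_carrier) auto
    then show ?case
      using i by (simp add: transvection_add algebra_simps)
  qed
  then show thesis
    using that by blast
qed

text \<open>The commutator identity for elementary matrices makes the entry $N^{j-i}$ reachable by words
  of length linear in $N$.\<close>
lemma transvection_short:
  assumes T: "generates (UTZ d :: (nat \<Rightarrow> nat \<Rightarrow> 'k::field) monoid) T (carrier (UTZ d))"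
  shows "i + Suc p < d \<Longrightarrow> \<exists>A. \<forall>N::nat. \<forall>e\<in>{1, -1::'k}.
    haslen (UTZ d) T (A * N) (transvection d i (i + Suc p) (e * of_nat N ^ Suc p))"
proof (induction p)
  case 0
  then obtain A where "\<And>N e. e \<in> {1, -1::'k} \<Longrightarrow> haslen (UTZ d) T (A * N) (transvection d i (Suc i) (e * of_nat N))"
    using transvection_short_one[OF T, of i] by auto
  then show ?case
    by (intro exI[of _ A]) auto
next
  case (Suc p)
  let ?k = "i + Suc p" and ?j = "i + Suc (Suc p)"
  obtain A where A: "\<And>N e. e \<in> {1, -1::'k} \<Longrightarrow> haslen (UTZ d) T (A * N) (transvection d i ?k (e * of_nat N ^ Suc p))"
    using Suc by fastforce
  obtain B where B: "\<And>N e. e \<in> {1, -1::'k} \<Longrightarrow> haslen (UTZ d) T (B * N) (transvection d ?k (Suc ?k) (e * of_nat N))"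
    using transvection_short_one[OF T, of ?k] Suc.prems by auto
  \<comment> \<open>The commutator uses two words of each kind, hence the constant; the sign e is
    carried by the factor with entry \<open>?a\<close> alone.\<close>
  have "haslen (UTZ d) T ((2 * A + 2 * B) * N) (transvection d i ?j (e * of_nat N ^ Suc (Suc p)))"
    if e: "e \<in> {1, -1::'k}" for N e
  proof -
    let ?a = "e * of_nat N ^ Suc p :: 'k" and ?b = "of_nat N :: 'k"
    have a: "haslen (UTZ d) T (A * N) (transvection d i ?k ?a)" "haslen (UTZ d) T (A * N) (transvection d i ?k (- ?a))"
      using A[of e N] A[of "- e" N] e by auto
    have b: "haslen (UTZ d) T (B * N) (transvection d ?k ?j ?b)" "haslen (UTZ d) T (B * N) (transvection d ?k ?j (- ?b))"
      using B[of 1 N] B[of "-1" N] by auto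
    have int: "?a \<in> \<int>" "?b \<in> \<int>"
      using e by (auto intro!: Ints_mult Ints_power simp del: power_Suc)
    have c: "transvection d i ?k (- ?a) \<in> carrier (UTZ d)" "transvection d ?k ?j ?b \<in> carrier (UTZ d)"
      "transvection d ?k ?j (- ?b) \<in> carrier (UTZ d)"
      using int Suc.prems by (auto intro!: transvection_carrier simp del: power_Suc)
    have m: "matmul d P Q \<in> carrier (UTZ d)" if "P \<in> carrier (UTZ d)" "Q \<in> carrier (UTZ d)"
      for P Q :: "nat \<Rightarrow> nat \<Rightarrow> 'k"
      using monoid.m_closed[OF UTZ_monoid that] by simp
    have "haslen (UTZ d) T (A * N + (B * N + (A * N + B * N)))
      (matmul d (transvection d i ?k ?a) (matmul d (transvection d ?k ?j ?b)
        (matmul d (transvection d i ?k (- ?a)) (transvection d ?k ?j (- ?b)))))"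
      by (intro haslen_mult a b c m)
    moreover have "A * N + (B * N + (A * N + B * N)) = (2 * A + 2 * B) * N"
      by (simp add: algebra_simps)
    ultimately show ?thesis
      using transvection_commutator[of i ?k ?j d ?a ?b] Suc.prems by (simp add: mult_ac)
  qed
  then show ?case
    by blast
qed

section \<open>The matrices of the representation\<close>

context jennings
begin

definition J :: "nat list set" where "J = jidx G (c + 1) xs"

lemma J_iff: "r \<in> J \<longleftrightarrow> length r = M \<and> (\<Sum>i<M. r ! i * mu G xs i) \<le> c"
  by (simp add: J_def jidx_def)

lemma coef_J: "s \<in> J \<Longrightarrow> a \<in> aug_pow G (c + 1) \<Longrightarrow> coef s a = 0"
  using coef_aug_pow[of s "c + 1" a] by (simp add: J_def)

lemma entry_le_weight:
  assumes "i < M"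
  shows "r ! i \<le> (\<Sum>i<M. r ! i * mu G xs i)"
proof -
  have "r ! i \<le> r ! i * mu G xs i"
    using mu_props(1)[OF assms] by simp
  also have "\<dots> \<le> (\<Sum>i<M. r ! i * mu G xs i)"
    using assms by (intro member_le_sum) auto
  finally show ?thesis .
qed

lemma finite_J: "finite J"
proof (rule finite_subset)
  show "J \<subseteq> {r. set r \<subseteq> {..c} \<and> length r = M}"
  proof
    fix r assume r: "r \<in> J"
    have "r ! i \<le> c" if "i < M" for i
      using entry_le_weight[OF that, of r] r by (simp add: J_iff)
    then show "r \<in> {r. set r \<subseteq> {..c} \<and> length r = M}"
      using r by (auto simp: J_iff in_set_conv_nth)
  qed
  show "finite {r. set r \<subseteq> {..c} \<and> length r = M}"
    by (rule finite_lists_length_eq) simp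
qed

lemma sum_ga: "(\<And>s. s \<in> A \<Longrightarrow> F s \<in> group_alg G) \<Longrightarrow> (\<Sum>s\<in>A. F s) \<in> group_alg G"
  by (induction A rule: infinite_finite_induct) auto

lemma coef_sum:
  "(\<And>s. s \<in> A \<Longrightarrow> F s \<in> group_alg G) \<Longrightarrow> coef q (\<Sum>s\<in>A. F s) = (\<Sum>s\<in>A. coef q (F s))"
  by (induction A rule: infinite_finite_induct) (auto simp: coef_zero coef_ga sum_ga)

definition comb :: "(nat list \<Rightarrow> 'k) \<Rightarrow> 'a \<Rightarrow> 'k" where
  "comb a = (\<Sum>s\<in>J. (\<lambda>z. a s * umon G xs s z))"

lemma comb_ga: "comb a \<in> group_alg G"
  unfolding comb_def by (intro sum_ga group_alg_scale umon_ga)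

lemma coef_comb:
  assumes "q \<in> J"
  shows "coef q (comb a) = a q"
proof -
  have "coef q (comb a) = (\<Sum>s\<in>J. a s * coef q (umon G xs s))"
    unfolding comb_def by (subst coef_sum) (auto simp: umon_ga coef_ga(3)[OF umon_ga umon_ga])
  also have "\<dots> = (\<Sum>s\<in>J. if s = q then a s else 0)"
    using assms by (intro sum.cong) (auto simp: coef_umon J_iff)
  finally show ?thesis
    using assms finite_J by simp
qed

text \<open>A monomial of weight at most c only changes one coefficient; any other lies in I^(c+1)
  by \<open>umon_aug_pow\<close> and is absorbed.\<close>

lemma W_comb: "f \<in> W (c + 1) 0 \<Longrightarrow> \<exists>a. f - comb a \<in> aug_pow G (c + 1)"
proof (induction rule: W.induct)
  case (base p)
  have "comb (\<lambda>_. 0) = 0"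
    by (simp add: comb_def fun_eq_iff sum_fun_apply zero_fun_apply)
  then show ?case
    using base by (intro exI[of _ "\<lambda>_. 0"]) (simp del: aug_pow.simps)
next
  case (step f r b)
  then obtain a where a: "f - comb a \<in> aug_pow G (c + 1)"
    by blast
  let ?m = "(\<lambda>z. b * umon G xs r z) :: 'a \<Rightarrow> 'k"
  show ?case
  proof (cases "r \<in> J")
    case True
    let ?a = "\<lambda>s. a s + (if s = r then b else 0)"
    have "comb ?a = (\<Sum>s\<in>J. (\<lambda>z. a s * umon G xs s z) + (if s = r then ?m else 0))"
      unfolding comb_def by (intro sum.cong) (auto simp: plus_fun_apply zero_fun_apply algebra_simps)
    also have "\<dots> = comb a + ?m"
      using True finite_J by (simp add: sum.distrib comb_def)
    finally have "?m + f - comb ?a = f - comb a"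
      by simp
    then show ?thesis
      using a by (metis (no_types, lifting))
  next
    case False
    then have "umon G xs r \<in> (aug_pow G (c + 1) :: ('a \<Rightarrow> 'k) set)"
      using aug_pow_antimono[OF umon_aug_pow[of r], of "c + 1"] step.hyps by (simp add: J_iff)
    then have "?m + (f - comb a) \<in> aug_pow G (c + 1)"
      by (intro aug_pow_add[OF aug_pow_scale a])
    then have "?m + f - comb a \<in> aug_pow G (c + 1)"
      by (simp only: add_diff_eq)
    then show ?thesis
      by blast
  qed
qed

lemma comb_unique:
  assumes "f \<in> group_alg G" "f - comb a \<in> aug_pow G (c + 1)" "s \<in> J"
  shows "a s = coef s f"
proof -
  have "coef s (f - comb a) = 0"
    using coef_J[OF assms(3,2)] .
  then show ?thesis
    using coef_ga(2)[OF assms(1) comb_ga] coef_comb[OF assms(3)] by simp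
qed

lemma comb_cong: "(\<And>s. s \<in> J \<Longrightarrow> a s = a' s) \<Longrightarrow> comb a = comb a'"
  unfolding comb_def by (intro sum.cong) auto

lemma expansion:
  assumes "f \<in> group_alg G"
  shows "f - comb (\<lambda>s. coef s f) \<in> aug_pow G (c + 1)"
proof -
  obtain a where a: "f - comb a \<in> aug_pow G (c + 1)"
    using W_comb[OF group_alg_W[OF assms]] by blast
  then have "comb a = comb (\<lambda>s. coef s f)"
    by (intro comb_cong comb_unique[OF assms])
  then show ?thesis
    using a by simp
qed

text \<open>Resolves the definite description: existence is \<open>expansion\<close>, uniqueness is
  \<open>comb_unique\<close>. The zeros off \<open>J\<close> are those prescribed in the
  definition.\<close>

lemma jcoef_eq:
  assumes g: "g \<in> carrier G"
  shows "jcoef G (c + 1) xs g r = (\<lambda>s. if s \<in> J then coef s (gconv G (umon G xs r) (gdelta g)) else 0)"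
  unfolding jcoef_def J_def[symmetric]
proof (rule the_equality)
  let ?f = "gconv G (umon G xs r) (gdelta g) :: 'a \<Rightarrow> 'k"
  let ?a = "\<lambda>s. if s \<in> J then coef s ?f else 0"
  have f: "?f \<in> group_alg G"
    using umon_ga g by simp
  have "comb ?a = comb (\<lambda>s. coef s ?f)"
    by (rule comb_cong) simp
  then show "(\<forall>s. s \<notin> J \<longrightarrow> ?a s = 0) \<and> ?f - (\<Sum>s\<in>J. (\<lambda>z. ?a s * umon G xs s z)) \<in> aug_pow G (c + 1)"
    using expansion[OF f] unfolding comb_def by (metis (no_types, lifting))
  fix a :: "nat list \<Rightarrow> 'k"
  assume a: "(\<forall>s. s \<notin> J \<longrightarrow> a s = 0) \<and> ?f - (\<Sum>s\<in>J. (\<lambda>z. a s * umon G xs s z)) \<in> aug_pow G (c + 1)"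
  then have "?f - comb a \<in> aug_pow G (c + 1)"
    by (simp only: comb_def)
  then show "a = ?a"
    using a comb_unique[OF f, of a] by (intro ext) simp
qed

definition act :: "'a \<Rightarrow> nat list \<Rightarrow> nat list \<Rightarrow> 'k" where
  "act g r s = coef s (gconv G (umon G xs r) (gdelta g))"

text \<open>I^(c+1) is stable under right multiplication, so f may be replaced by its expansion in
  monomials.\<close>

lemma coef_gconv_gdelta:
  assumes f: "f \<in> group_alg G" and g: "g \<in> carrier G" and s: "s \<in> J"
  shows "coef s (gconv G f (gdelta g)) = (\<Sum>q\<in>J. coef q f * act g q s)"
proof -
  let ?h = "comb (\<lambda>s. coef s f)"
  have gd: "gdelta g \<in> group_alg G"
    using g by simp
  have "gconv G (f - ?h) (gdelta g) \<in> aug_pow G (c + 1)"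
    by (rule aug_pow_gconv_right[OF expansion[OF f] gd])
  then have "coef s (gconv G f (gdelta g) - gconv G ?h (gdelta g)) = 0"
    using coef_J[OF s] gconv_laws(3)[OF f comb_ga gd] by simp
  then have "coef s (gconv G f (gdelta g)) = coef s (gconv G ?h (gdelta g))"
    using f gd by (simp add: coef_ga comb_ga)
  also have "gconv G ?h (gdelta g) = (\<Sum>q\<in>J. (\<lambda>z. coef q f * gconv G (umon G xs q) (gdelta g) z))"
  proof -
    have "gconv G (\<Sum>q\<in>A. (\<lambda>z. coef q f * umon G xs q z)) (gdelta g)
        = (\<Sum>q\<in>A. (\<lambda>z. coef q f * gconv G (umon G xs q) (gdelta g) z))" for A
    proof (induction A rule: infinite_finite_induct)
      case (insert q A)
      then show ?case
        using gd by (simp add: gconv_laws(1) gconv_laws(5)[OF _ _ group_alg_0] umon_ga sum_ga)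
    qed (use gd in \<open>simp_all add: gconv_zero\<close>)
    then show ?thesis
      unfolding comb_def .
  qed
  also have "coef s \<dots> = (\<Sum>q\<in>J. coef q f * act g q s)"
    using gd by (subst coef_sum) (auto simp: umon_ga act_def coef_ga(3)[OF group_alg_gconv[OF umon_ga gd] gd])
  finally show ?thesis .
qed

lemma act_mult:
  assumes "g \<in> carrier G" "h \<in> carrier G" "s \<in> J"
  shows "act (g \<otimes> h) r s = (\<Sum>q\<in>J. act g r q * act h q s)"
proof -
  have "gconv G (umon G xs r) (gdelta (g \<otimes> h)) = gconv G (gconv G (umon G xs r) (gdelta g)) (gdelta h :: 'a \<Rightarrow> 'k)"
    using assms umon_ga[of r] by (simp add: gconv_assoc gconv_gdelta)
  then show ?thesis
    using coef_gconv_gdelta[of "gconv G (umon G xs r) (gdelta g)" h s] assms umon_ga[of r]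
    by (simp add: act_def)
qed

lemma act_one: "r \<in> J \<Longrightarrow> s \<in> J \<Longrightarrow> act \<one> r s = (if r = s then 1 else 0)"
  by (simp add: act_def gconv_one umon_ga coef_umon J_iff)

lemma act_Ints: "act g r s \<in> \<int>"
  unfolding act_def coef_def lin_def
  by (intro Ints_mult Ints_sum Ints_power gconv_Ints umon_Ints gdelta_Ints BB_Ints) simp_all

text \<open>Interchanging the two evaluations isolates the dependence on y, so that a q with
  coefficient sum 0 kills anything constant in y.\<close>

lemma coef_gconv:
  assumes "f \<in> group_alg G" "q \<in> group_alg G"
  shows "coef s (gconv G f q) = lin (\<lambda>y. coef s (gconv G f (gdelta y))) q"
proof -
  have "lin (\<lambda>y. coef s (gconv G f (gdelta y))) q
      = lin (\<lambda>y. (-1) ^ (\<Sum>l<M. s ! l) * lin (\<lambda>x. BB ((!) s) (x \<otimes> y)) f) q"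
    using assms by (intro lin_cong_carrier) (simp_all add: coef_def)
  also have "\<dots> = (-1) ^ (\<Sum>l<M. s ! l) * lin (\<lambda>x. lin (\<lambda>y. BB ((!) s) (x \<otimes> y)) q) f"
    unfolding lin_fun_scale by (subst lin_swap) simp
  finally show ?thesis
    using assms by (simp add: coef_def)
qed

section \<open>The action of powers of a generator of weight c\<close>

abbreviation zv :: "nat list" where "zv \<equiv> replicate M 0"

definition ev :: "nat \<Rightarrow> nat list" where "ev i = zv[i := 1]"

lemma zv_J: "zv \<in> J"
  by (simp add: J_iff)

lemma umon_zv: "umon G xs zv = (gdelta \<one> :: 'a \<Rightarrow> 'k)"
  using tm_skip[of M zv] by (simp add: umon_tm tm_last)

lemma ev_weight: "i < M \<Longrightarrow> (\<Sum>l<M. ev i ! l * w l) = w i"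
proof -
  assume i: "i < M"
  have "(\<Sum>l<M. ev i ! l * w l) = (\<Sum>l<M. if l = i then w i else 0)"
    by (intro sum.cong) (auto simp: ev_def nth_list_update)
  then show ?thesis
    using i by simp
qed

lemma ev_J: "i < M \<Longrightarrow> mu G xs i = c \<Longrightarrow> ev i \<in> J"
  using ev_weight[of i "mu G xs"] by (simp add: J_iff) (simp add: ev_def)

lemma coef_ev_gdelta:
  assumes i: "i < M"
  shows "coef (ev i) (gdelta g) = - of_int (coord i g)"
proof -
  have "BB ((!) (ev i)) g = (\<Prod>l<M. if l = i then of_int (coord i g) else 1)"
    unfolding BB_def by (intro prod.cong) (auto simp: ev_def nth_list_update)
  moreover have "(\<Sum>l<M. ev i ! l) = 1"
    using ev_weight[OF i, of "\<lambda>_. 1"] by simp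
  ultimately show ?thesis
    using i by (simp add: coef_def)
qed

lemma ev_nth: "l < M \<Longrightarrow> ev i ! l = (if l = i then 1 else 0)"
  by (auto simp: ev_def nth_list_update)

lemma ev_neq:
  assumes "i < M"
  shows "ev i \<noteq> zv"
proof
  assume "ev i = zv"
  then have "ev i ! i = zv ! i"
    by simp
  then show False
    using assms by (simp add: ev_nth)
qed

lemma ev_inj:
  assumes "i < M" "ev i = ev i'"
  shows "i = i'"
proof -
  have "ev i ! i = ev i' ! i"
    using assms(2) by simp
  then show ?thesis
    using assms(1) by (simp add: ev_nth split: if_splits)
qed

text \<open>This is the row of the monomial 1. Only the i-th coordinate of x_i^t can be nonzero, and
  it enters negated, as in (1 - u_i)^t = 1 - t u_i + ...\<close>

lemma act_xs_pow_zv: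
  assumes i: "i < M" and mu: "mu G xs i = c" and s: "s \<in> J"
  shows "act (xs ! i [^] (t::int)) zv s = (if s = zv then 1 else if s = ev i then - of_int t else 0)"
proof -
  let ?x = "xs ! i [^] t"
  have x: "?x \<in> carrier G"
    using xs_carrier[OF i] by simp
  have a: "act ?x zv s = coef s (gdelta ?x)"
    using x by (simp add: act_def umon_zv gconv_one)
  consider "s = zv" | "s = ev i" | "s \<noteq> zv" "s \<noteq> ev i"
    by blast
  then show ?thesis
  proof cases
    case 1
    have "BB ((!) zv) ?x = 1"
      unfolding BB_def by (intro prod.neutral) simp
    then show ?thesis
      unfolding a using 1 by (simp add: coef_def)
  next
    case 2
    then show ?thesis
      unfolding a using coef_ev_gdelta[OF i] coord_xs_pow[OF i i] ev_neq[OF i] by simp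
  next
    case 3
    \<comment> \<open>A larger exponent would give weight at least 2 c, above the bound c. So s,
      being neither \<open>zv\<close> nor \<open>ev i\<close>, involves another generator, whose
      coordinate is 0 on this power.\<close>
    have "s ! i \<le> 1"
    proof (rule ccontr)
      assume "\<not> s ! i \<le> 1"
      then have "2 * c \<le> s ! i * mu G xs i"
        using mu by simp
      also have "\<dots> \<le> (\<Sum>l<M. s ! l * mu G xs l)"
        using i by (intro member_le_sum) auto
      also have "\<dots> \<le> c"
        using s by (simp add: J_iff)
      finally show False
        using c_pos by simp
    qed
    moreover have ls: "length s = M"
      using s by (simp add: J_iff)
    ultimately obtain l where l: "l < M" "l \<noteq> i" "s ! l \<noteq> 0"
    proof -
      have "\<exists>l<M. l \<noteq> i \<and> s ! l \<noteq> 0"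
      proof (rule ccontr)
        assume n: "\<not> (\<exists>l<M. l \<noteq> i \<and> s ! l \<noteq> 0)"
        have "s ! i = 0 \<or> s ! i = 1"
          using \<open>s ! i \<le> 1\<close> by auto
        then show False
        proof
          assume "s ! i = 0"
          then have "s ! l = 0" if "l < M" for l
            using n that by (cases "l = i") auto
          then have "s = zv"
            using ls by (intro nth_equalityI) auto
          then show False
            using 3 by simp
        next
          assume "s ! i = 1"
          then have "s ! l = ev i ! l" if "l < M" for l
            using n that by (cases "l = i") (auto simp: ev_nth)
          then have "s = ev i"
            using ls by (intro nth_equalityI) (auto simp: ev_def)
          then show False
            using 3 by simp
        qed
      qed
      then show thesis
        using that by blast
    qed
    have "BB ((!) s) ?x = 0"
      unfolding BB_def using l coord_xs_pow[OF i l(1)]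
      by (intro prod_zero) (auto simp: gbinomial_0_left intro!: bexI[of _ l])
    then show ?thesis
      unfolding a using 3 by (simp add: coef_def)
  qed
qed

text \<open>A nontrivial monomial lies in I and 1 - x_i^t lies in I^c, so their product vanishes
  modulo I^(c+1).\<close>

lemma act_xs_pow:
  assumes i: "i < M" and mu: "mu G xs i = c" and r: "r \<in> J" "r \<noteq> zv" and s: "s \<in> J"
  shows "act (xs ! i [^] (t::int)) r s = (if r = s then 1 else 0)"
proof -
  let ?x = "xs ! i [^] t"
  have x: "?x \<in> carrier G"
    using xs_carrier[OF i] by simp
  obtain l where l: "l < M" "r ! l \<noteq> 0"
    using r nth_equalityI[of r zv] by (auto simp: J_iff)
  then have "umon G xs r \<in> (aug_pow G 1 :: ('a \<Rightarrow> 'k) set)"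
    using aug_pow_antimono[OF umon_aug_pow[of r], of 1] entry_le_weight[OF l(1), of r] by simp
  moreover have "gdelta \<one> - gdelta ?x \<in> (aug_pow G c :: ('a \<Rightarrow> 'k) set)"
    using xs_pow_tau[OF i, of t] tau_dimsub[OF c_pos, where 'k = 'k] mu by (auto simp: dimsub_def)
  ultimately have "gconv G (umon G xs r) (gdelta \<one> - gdelta ?x) \<in> (aug_pow G (1 + c) :: ('a \<Rightarrow> 'k) set)"
    by (rule aug_pow_mult)
  then have "coef s (gconv G (umon G xs r) (gdelta \<one> - gdelta ?x)) = 0"
    using coef_J[OF s] by simp
  moreover have "gconv G (umon G xs r) (gdelta \<one> - gdelta ?x)
      = (umon G xs r :: 'a \<Rightarrow> 'k) - gconv G (umon G xs r) (gdelta ?x)"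
    using x by (simp add: gconv_laws gconv_one umon_ga)
  ultimately have "act ?x r s = coef s (umon G xs r)"
    using x by (simp add: act_def coef_ga umon_ga)
  then show ?thesis
    using coef_umon r s by (simp add: J_iff)
qed

end

section \<open>The representation and the flag given by its ordering\<close>

locale jennings_rep = jennings G c xs kty for G (structure) and c xs and kty :: "'k::field_char_0 itself" +
  fixes \<sigma> :: "nat \<Rightarrow> nat list"
  assumes ordering: "jennings_ordering TYPE('k) G (c + 1) xs \<sigma>"
begin

abbreviation d :: nat where "d \<equiv> card J"

definition \<phi> :: "'a \<Rightarrow> nat \<Rightarrow> nat \<Rightarrow> 'k" where "\<phi> = jmat G (c + 1) xs \<sigma>"

lemma sigma_bij: "bij_betw \<sigma> {..<d} J"
  using ordering by (simp add: jennings_ordering_def J_def lessThan_atLeast0)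

lemma sigma_J: "i < d \<Longrightarrow> \<sigma> i \<in> J"
  using sigma_bij by (auto simp: bij_betw_def)

lemma sigma_inj: "i < d \<Longrightarrow> j < d \<Longrightarrow> \<sigma> i = \<sigma> j \<longleftrightarrow> i = j"
  using sigma_bij by (auto simp: bij_betw_def inj_on_def)

lemma sigma_surj:
  assumes "s \<in> J"
  obtains i where "i < d" "\<sigma> i = s"
proof -
  have "s \<in> \<sigma> ` {..<d}"
    using sigma_bij assms by (simp add: bij_betw_def)
  then show thesis
    using that by auto
qed

lemma phi_eq: "g \<in> carrier G \<Longrightarrow> \<phi> g i j = (if i < d \<and> j < d then act g (\<sigma> i) (\<sigma> j) else 0)"
  using jcoef_eq[of g "\<sigma> i"] sigma_J[of j] by (auto simp: \<phi>_def jmat_def act_def J_def)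

lemma phi_unitri: "g \<in> carrier G \<Longrightarrow> upper_unitri d (\<phi> g)"
  using ordering by (simp add: jennings_ordering_def \<phi>_def J_def)

lemma sum_sigma: "(\<Sum>k<d. F (\<sigma> k)) = (\<Sum>q\<in>J. F q)"
  by (rule sum.reindex_bij_betw[OF sigma_bij])

lemma phi_mult:
  assumes "g \<in> carrier G" "h \<in> carrier G"
  shows "\<phi> (g \<otimes> h) = matmul d (\<phi> g) (\<phi> h)"
proof (intro ext)
  fix i j
  show "\<phi> (g \<otimes> h) i j = matmul d (\<phi> g) (\<phi> h) i j"
  proof (cases "i < d \<and> j < d")
    case True
    then have "\<phi> (g \<otimes> h) i j = (\<Sum>q\<in>J. act g (\<sigma> i) q * act h q (\<sigma> j))"
      using assms by (simp add: phi_eq act_mult sigma_J)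
    also have "\<dots> = (\<Sum>k<d. act g (\<sigma> i) (\<sigma> k) * act h (\<sigma> k) (\<sigma> j))"
      by (rule sum_sigma[symmetric])
    also have "\<dots> = matmul d (\<phi> g) (\<phi> h) i j"
      unfolding matmul_def using True assms by (intro sum.cong) (auto simp: phi_eq)
    finally show ?thesis .
  next
    case False
    then show ?thesis
      using assms by (auto simp: phi_eq matmul_def)
  qed
qed

lemma phi_one: "\<phi> \<one> = matone d"
  by (intro ext) (auto simp: phi_eq matone_def act_one sigma_J sigma_inj)

lemma phi_carrier: "g \<in> carrier G \<Longrightarrow> \<phi> g \<in> carrier (UTZ d)"
  using phi_unitri by (auto simp: UTZ_carrier phi_eq act_Ints)

text \<open>Inverses in a monoid are unique, and the image of the inverse is one on both
  sides.\<close>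

lemma phi_inv:
  assumes "g \<in> carrier G"
  shows "m_inv (UTZ d) (\<phi> g) = \<phi> (inv g)"
proof -
  interpret U: monoid "UTZ d :: (nat \<Rightarrow> nat \<Rightarrow> 'k) monoid"
    by (rule UTZ_monoid)
  show ?thesis
    using assms by (intro U.inv_char) (auto simp: phi_carrier phi_one simp flip: phi_mult)
qed

lemma phi_wprod: "set gs \<subseteq> carrier G \<Longrightarrow> wprod (UTZ d) (map \<phi> gs) = \<phi> (foldr (\<otimes>) gs \<one>)"
  by (induction gs) (auto simp: wprod_def phi_one phi_mult foldr_mult_closed)

text \<open>Modulo I^(c+1), the span of the basis elements at positions p and later: the flag
  preserved by the unitriangular action.\<close>

definition V :: "nat \<Rightarrow> ('a \<Rightarrow> 'k) set" where
  "V p = {f \<in> group_alg G. \<forall>i<p. i < d \<longrightarrow> coef (\<sigma> i) f = 0}"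

text \<open>Coefficients before position i vanish, and matrix entries below the diagonal do too. The
  gain lies in the case i = p: the first coefficient that may be nonzero is left unchanged.\<close>

lemma V_gdelta:
  assumes f: "f \<in> V p" and g: "g \<in> carrier G" and i: "i \<le> p" "i < d"
  shows "coef (\<sigma> i) (gconv G f (gdelta g)) = coef (\<sigma> i) f"
proof -
  have "coef (\<sigma> i) (gconv G f (gdelta g)) = (\<Sum>k<d. coef (\<sigma> k) f * act g (\<sigma> k) (\<sigma> i))"
    using coef_gconv_gdelta[of f g "\<sigma> i"] f g i sigma_J by (simp add: V_def flip: sum_sigma)
  also have "\<dots> = (\<Sum>k<d. if k = i then coef (\<sigma> i) f else 0)"
  proof (intro sum.cong refl)
    fix k assume k: "k \<in> {..<d}"
    consider "k < i" | "k = i" | "i < k"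
      by linarith
    then show "coef (\<sigma> k) f * act g (\<sigma> k) (\<sigma> i) = (if k = i then coef (\<sigma> i) f else 0)"
    proof cases
      case 1
      then show ?thesis
        using f i k by (simp add: V_def)
    next
      case 2
      have "\<phi> g i i = 1"
        using phi_unitri[OF g] i by (simp add: upper_unitri_def)
      then show ?thesis
        using 2 i phi_eq[OF g, of i i] by simp
    next
      case 3
      then have "\<phi> g k i = 0"
        using phi_unitri[OF g] k by (simp add: upper_unitri_def)
      then show ?thesis
        using 3 i k phi_eq[OF g, of k i] by simp
    qed
  qed
  finally show ?thesis
    using i by simp
qed

text \<open>At position p the coefficient of f times y does not depend on y, and the values of q sum
  to 0, so one more coefficient vanishes.\<close>

lemma V_aug_ideal:
  assumes f: "f \<in> V p" and q: "q \<in> aug_ideal G"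
  shows "gconv G f q \<in> V (Suc p)"
proof -
  have fg: "f \<in> group_alg G" and qg: "q \<in> group_alg G"
    using f q by (auto simp: V_def aug_ideal_ga)
  have "coef (\<sigma> i) (gconv G f q) = 0" if i: "i < Suc p" "i < d" for i
  proof -
    have "coef (\<sigma> i) (gconv G f q) = lin (\<lambda>y. coef (\<sigma> i) (gconv G f (gdelta y))) q"
      by (rule coef_gconv[OF fg qg])
    also have "\<dots> = lin (\<lambda>y. coef (\<sigma> i) f * 1) q"
      using V_gdelta[OF f] i by (intro lin_cong_carrier[OF qg]) simp
    also have "\<dots> = 0"
      using q unfolding lin_fun_scale by (simp add: aug_ideal_iff)
    finally show ?thesis .
  qed
  then show ?thesis
    using fg qg by (simp add: V_def)
qed

lemma V_add: "f \<in> V p \<Longrightarrow> f' \<in> V p \<Longrightarrow> f + f' \<in> V p"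
  by (auto simp: V_def coef_ga)

text \<open>The monomial 1 lies in \<open>V i0\<close>, and every factor from I advances one step in
  the flag.\<close>

lemma aug_pow_V:
  assumes i0: "i0 < d" "\<sigma> i0 = zv"
  shows "f \<in> aug_pow G (Suc m) \<Longrightarrow> f \<in> V (i0 + Suc m)"
proof (induction m arbitrary: f)
  case 0
  have "coef (\<sigma> i) (gdelta \<one>) = 0" if "i < i0" "i < d" for i
  proof -
    have "zv \<noteq> \<sigma> i"
      using sigma_inj[of i i0] that i0 by auto
    then show ?thesis
      using coef_umon[of zv "\<sigma> i"] sigma_J[OF that(2)] by (auto simp: umon_zv J_iff)
  qed
  then have 1: "gdelta \<one> \<in> V i0"
    by (simp add: V_def)
  from 0 show ?case
  proof (induction rule: aug_pow_Suc_induct)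
    case zero
    then show ?case
      by (simp add: V_def coef_zero)
  next
    case (add p q r)
    have p: "p \<in> group_alg G" and q: "q \<in> group_alg G"
      using add.hyps by (auto simp: aug_ideal_ga)
    \<comment> \<open>Here p is an arbitrary element of the group algebra, so p q is first placed in
      the augmentation ideal and then used as a single factor after 1.\<close>
    have "lin (\<lambda>x. lin (\<lambda>y. 1) q) p = 0"
      using add.hyps by (simp add: aug_ideal_iff lin_def)
    then have "gconv G p q \<in> aug_ideal G"
      using p q by (simp add: aug_ideal_iff)
    then have "gconv G (gdelta \<one>) (gconv G p q) \<in> V (Suc i0)"
      by (rule V_aug_ideal[OF 1])
    then show ?case
      using add.IH p q V_add by (simp add: gconv_one)
  qed
next
  case (Suc m)
  from Suc.prems show ?case
  proof (induction rule: aug_pow_Suc_induct)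
    case zero
    then show ?case
      by (simp add: V_def coef_zero)
  next
    case (add p q r)
    then show ?case
      using V_add[OF V_aug_ideal[OF Suc.IH[OF add.hyps(1)] add.hyps(2)], of r] by simp
  qed
qed

text \<open>The coefficient of u_i at \<open>ev i\<close> is 1, while u_i lies in I^c and so has
  only zero coefficients before position i0 + c.\<close>

lemma ev_position:
  assumes i0: "i0 < d" "\<sigma> i0 = zv"
    and i: "i < M" "mu G xs i = c" and j: "j < d" "\<sigma> j = ev i"
  shows "i0 + c \<le> j"
proof (rule ccontr)
  assume n: "\<not> i0 + c \<le> j"
  have "u i \<in> V (i0 + c)"
    using aug_pow_V[OF i0, of "u i" "c - 1"] uelt_aug_pow[OF i(1)] i(2) c_pos by simp
  then have "coef (\<sigma> j) (u i) = 0"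
    using n j(1) unfolding V_def by auto
  moreover have "coef (ev i) (u i) = - of_int (coord i \<one>) + of_int (coord i (xs ! i))"
    using xs_carrier[OF i(1)] unfolding uelt_def
    by (subst coef_ga(2)) (auto simp: coef_ev_gdelta[OF i(1)])
  moreover have "coord i (xs ! i) = 1"
    using coord_xs_pow[OF i(1) i(1), of 1] xs_carrier[OF i(1)] by simp
  ultimately show False
    using j coord_one[OF i(1)] by simp
qed

lemma phi_xs_pow:
  assumes i0: "i0 < d" "\<sigma> i0 = zv"
    and i: "i < M" "mu G xs i = c" and j: "j < d" "\<sigma> j = ev i"
  shows "\<phi> (xs ! i [^] (t::int)) = transvection d i0 j (- of_int t)"
proof (intro ext)
  fix r s
  have x: "xs ! i [^] t \<in> carrier G"
    using xs_carrier[OF i(1)] by simp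
  have ij: "i0 \<noteq> j"
    using i0 j ev_neq[OF i(1)] by auto
  show "\<phi> (xs ! i [^] t) r s = transvection d i0 j (- of_int t) r s"
  proof (cases "r < d \<and> s < d")
    case True
    then have z: "\<sigma> s = zv \<longleftrightarrow> s = i0" "\<sigma> s = ev i \<longleftrightarrow> s = j" "\<sigma> r = zv \<longleftrightarrow> r = i0"
      using sigma_inj i0 j by metis+
    show ?thesis
    proof (cases "r = i0")
      case True
      then show ?thesis
        using act_xs_pow_zv[OF i sigma_J, of s t] \<open>r < d \<and> s < d\<close> z i0 ij
        by (auto simp: phi_eq[OF x] transvection_def)
    next
      case False
      then show ?thesis
        using act_xs_pow[OF i sigma_J _ sigma_J, of r s t] \<open>r < d \<and> s < d\<close> z sigma_inj[of r s]
        by (auto simp: phi_eq[OF x] transvection_def)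
    qed
  next
    case False
    then show ?thesis
      by (auto simp: phi_eq[OF x] transvection_def)
  qed
qed

lemma phi_entry:
  assumes "i0 < d" "\<sigma> i0 = zv" "i < M" "j < d" "\<sigma> j = ev i" "g \<in> carrier G"
  shows "\<phi> g i0 j = - of_int (coord i g)"
  using assms by (simp add: phi_eq act_def umon_zv gconv_one coef_ev_gdelta)

text \<open>All generators inside tau_c have weight c. With fewer than two of them tau_c would be
  cyclic, and so two distinct basis elements of its subgroup Gamma_c would be powers of one
  element.\<close>

lemma two_top_generators:
  assumes bs: "free_abelian_basis G (Gamma G c) bs" "length bs \<ge> 2"
  obtains i i' where "i < M" "i' < M" "i \<noteq> i'" "mu G xs i = c" "mu G xs i' = c"
proof -
  obtain j where j: "j \<le> M" "tau G c = MS j"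
    using tau_MS[OF c_pos] by metis
  have top: "mu G xs i = c" if "i < M" "j \<le> i" for i
  proof -
    have "xs ! i \<in> tau G c"
      using xs_MS[OF that(1)] MS_antimono[OF that(2)] j by auto
    moreover have "xs ! i \<notin> tau G (c + 1)"
      using tau_trivial[of "c + 1"] xs_notin_Suc[OF that(1)] one_MS by auto
    ultimately show ?thesis
      using mu_props(2)[OF that(1) c_pos] mu_props(2)[OF that(1), of "c + 1"] by simp
  qed
  show thesis
  proof (cases "j + 2 \<le> M")
    case True
    then show ?thesis
      using that[of "M - 1" "M - 2"] top by auto
  next
    case False
    obtain y where y: "y \<in> carrier G" "\<And>g. g \<in> tau G c \<Longrightarrow> \<exists>t::int. g = y [^] t"
    proof (cases "j = M")
      case True
      show thesis
      proof (rule that[of \<one>])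
        fix g assume "g \<in> tau G c"
        then have "g = \<one> [^] (0::int)"
          using True j by simp
        then show "\<exists>t::int. g = \<one> [^] t" ..
      qed simp
    next
      case F: False
      then have jM: "j < M" "Suc j = M"
        using False j by auto
      show thesis
      proof (rule that[of "xs ! j"])
        fix g assume "g \<in> tau G c"
        then obtain t :: int and h where "h \<in> MS (Suc j)" "g = xs ! j [^] t \<otimes> h"
          using MS_decomp[OF jM(1)] j by blast
        then show "\<exists>t::int. g = xs ! j [^] t"
          using jM xs_carrier by (intro exI[of _ t]) simp
      qed (use jM xs_carrier in simp)
    qed
    let ?b = "\<lambda>i. bs ! i"
    have b: "?b 0 \<in> Gamma G c" "?b 1 \<in> Gamma G c" "?b 0 \<noteq> ?b 1"
    proof -
      have l: "0 < length bs" "1 < length bs" and "distinct bs" and sub: "set bs \<subseteq> Gamma G c"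
        using bs by (auto simp: free_abelian_basis_def)
      then show "?b 0 \<noteq> ?b 1"
        by (simp add: nth_eq_iff_index_eq)
      show "?b 0 \<in> Gamma G c" "?b 1 \<in> Gamma G c"
        by (rule subsetD[OF sub nth_mem[OF l(1)]], rule subsetD[OF sub nth_mem[OF l(2)]])
    qed
    then obtain p q :: int where pq: "?b 0 = y [^] p" "?b 1 = y [^] q"
      using y(2)[OF subsetD[OF Gamma_subset_tau b(1)]] y(2)[OF subsetD[OF Gamma_subset_tau b(2)]] by blast
    \<comment> \<open>With b_0 = y^p and b_1 = y^q, both exponent vectors represent y^(p q).
      Uniqueness forces p = q = 0, so b_0 = b_1, against distinctness.\<close>
    define e1 where "e1 = (\<lambda>i::nat. if i = 0 then q else 0)"
    define e2 where "e2 = (\<lambda>i::nat. if i = 1 then p else 0)"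
    let ?F = "\<lambda>e::nat \<Rightarrow> int. foldr (\<lambda>i acc. (bs ! i) [^] (e i) \<otimes> acc) [0..<length bs] \<one>"
    have tl: "foldr (\<lambda>i acc. (bs ! i) [^] (e i) \<otimes> acc) [m..<l] \<one> = \<one>" if "\<And>i. i \<ge> m \<Longrightarrow> e i = (0::int)" for e m l
    proof -
      have "foldr (\<lambda>i acc. (bs ! i) [^] (e i) \<otimes> acc) is \<one> = \<one>" if "\<forall>i\<in>set is. e i = 0" for "is"
        using that by (induction "is") auto
      then show ?thesis
        using that by simp
    qed
    have split: "[0..<length bs] = 0 # 1 # [2..<length bs]"
    proof -
      have "0 < length bs" "1 < length bs"
        using bs(2) by linarith+
      then show ?thesis
        using upt_conv_Cons[of 0 "length bs"] upt_conv_Cons[of 1 "length bs"] by (simp add: numeral_2_eq_2)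
    qed
    have bc: "?b 0 \<in> carrier G" "?b 1 \<in> carrier G"
      using b lcs_subset by (auto simp: Gamma_def)
    have "?F e1 = ?b 0 [^] q" "?F e2 = ?b 1 [^] p"
      unfolding split using tl[of 2 e1] tl[of 2 e2] bc by (simp_all add: e1_def e2_def)
    moreover have "?b 0 [^] q = ?b 1 [^] p"
      unfolding pq using y(1) by (simp add: int_pow_pow mult.commute)
    moreover have "?b 0 [^] q \<in> Gamma G c"
      using b(1) subgroup_int_pow_closed[OF lcs_subgroup] by (simp add: Gamma_def)
    moreover have "\<forall>i\<ge>length bs. e1 i = 0" "\<forall>i\<ge>length bs. e2 i = 0"
      using bs(2) by (auto simp: e1_def e2_def)
    moreover have "\<exists>!e::nat \<Rightarrow> int. (\<forall>i\<ge>length bs. e i = 0) \<and> ?b 0 [^] q = ?F e"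
      using bs(1) calculation(4) unfolding free_abelian_basis_def by blast
    ultimately have e: "e1 = e2"
      by metis
    have "q = 0" "p = 0"
      using fun_cong[OF e, of 0] fun_cong[OF e, of 1] by (auto simp: e1_def e2_def)
    then show ?thesis
      using pq b(3) by simp
  qed
qed

theorem distorted:
  assumes bs: "free_abelian_basis G (Gamma G c) bs" "length bs \<ge> 2"
  shows "\<not> undistorted (UTZ d) (\<phi> ` carrier G)"
proof
  assume "undistorted (UTZ d) (\<phi> ` carrier G)"
  then obtain S T C where S: "finite S" "S \<subseteq> \<phi> ` carrier G" "generates (UTZ d) S (\<phi> ` carrier G)"
    and T: "generates (UTZ d) T (carrier (UTZ d))"
    and C: "\<And>m h. h \<in> \<phi> ` carrier G \<Longrightarrow> wlen (UTZ d) T h \<le> m \<Longrightarrow> wlen (UTZ d) S h \<le> C * m"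
    unfolding undistorted_def by blast
  obtain i0 where i0: "i0 < d" "\<sigma> i0 = zv"
    using sigma_surj[OF zv_J] by blast
  obtain i j where i: "i < M" "mu G xs i = c" and j: "j < d" "\<sigma> j = ev i" "i0 + c + 1 \<le> j"
  proof -
    obtain i i' where ii: "i < M" "i' < M" "i \<noteq> i'" "mu G xs i = c" "mu G xs i' = c"
      using two_top_generators[OF bs] by blast
    obtain j j' where j: "j < d" "\<sigma> j = ev i" and j': "j' < d" "\<sigma> j' = ev i'"
      using sigma_surj ev_J ii by metis
    have "j \<noteq> j'"
      using j j' ev_inj[of i i'] ii by auto
    then have "i0 + c + 1 \<le> j \<or> i0 + c + 1 \<le> j'"
      using ev_position[OF i0 ii(1,4) j] ev_position[OF i0 ii(2,5) j'] by auto
    then show thesis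
      using that ii j j' by blast
  qed
  \<comment> \<open>The column lies \<open>Suc p\<close> places to the right of the diagonal, so
    \<open>c \<le> p\<close> already gives an exponent of at least c + 1.\<close>
  obtain p where p: "j = i0 + Suc p" "c \<le> p"
    using j(3) that[of "j - i0 - 1"] by auto
  obtain A where "\<forall>N. \<forall>e\<in>{1, -1::'k}. haslen (UTZ d) T (A * N) (transvection d i0 j (e * of_nat N ^ Suc p))"
    using transvection_short[OF T, of i0 p] j(1) p(1) by blast
  then have A: "haslen (UTZ d) T (A * N) (transvection d i0 j (of_nat N ^ Suc p :: 'k))" for N
    by (metis insertI1 mult_1)
  obtain S' where S': "finite S'" "S' \<subseteq> carrier G" "S = \<phi> ` S'"
    using finite_subset_image[OF S(1,2)] by blast
  \<comment> \<open>Words over S and inverses of its elements lift to words over this set in G,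
    where \<open>wpoly_growth\<close> bounds the coordinate.\<close>
  define gens where "gens = S' \<union> (\<lambda>g. inv g) ` S'"
  have gens: "finite gens" "gens \<subseteq> carrier G"
    using S' by (auto simp: gens_def)
  have S_gens: "S \<union> m_inv (UTZ d) ` S = \<phi> ` gens"
  proof -
    have "m_inv (UTZ d) ` \<phi> ` S' = \<phi> ` (\<lambda>g. inv g) ` S'"
      unfolding image_image by (rule image_cong[OF refl]) (use phi_inv S'(2) in blast)
    then show ?thesis
      by (simp only: gens_def S'(3) image_Un)
  qed
  have "wpoly G (tau G) (carrier G) (Suc c) (coord i)"
    using wpoly_coord[OF i(1), where 'r = int] i(2) by (simp del: wpoly.simps)
  then obtain B where B: "B \<ge> 0" "\<And>gs. set gs \<subseteq> gens \<Longrightarrow>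
      \<bar>coord i (foldr (\<otimes>) gs \<one>)\<bar> \<le> B * (int (length gs) + 1) ^ c"
    using wpoly_growth[of "tau G" gens c "coord i", OF _ gens] tau_1 by blast
  \<comment> \<open>A word of length at most C A N has length plus one at most (C A + 1) N when N is
    at least 1, so the growth bound becomes D N^c.\<close>
  define D where "D = B * (int (C * A) + 1) ^ c"
  have bound: "int N \<le> D" if N: "N \<ge> 1" for N
  proof -
    \<comment> \<open>The matrix of x_i^t has the entry -t, so this sign yields the entry
      \<open>N ^ Suc p\<close>.\<close>
    let ?t = "- (int N ^ Suc p)"
    let ?x = "xs ! i [^] ?t"
    have x: "?x \<in> carrier G"
      using xs_carrier[OF i(1)] by simp
    have "\<phi> ?x = transvection d i0 j (of_nat N ^ Suc p)"
      using phi_xs_pow[OF i0 i j(1,2), of ?t] by simp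
    then have "wlen (UTZ d) T (\<phi> ?x) \<le> A * N"
      using haslen_wlen[OF A[of N]] by simp
    then have w: "wlen (UTZ d) S (\<phi> ?x) \<le> C * (A * N)"
      using C x by blast
    have "\<exists>m. \<exists>ws\<in>words_of (UTZ d) S. length ws = m \<and> wprod (UTZ d) ws = \<phi> ?x"
      using S(3) x unfolding generates_def by blast
    then have "\<exists>ws\<in>words_of (UTZ d) S. length ws = wlen (UTZ d) S (\<phi> ?x) \<and> wprod (UTZ d) ws = \<phi> ?x"
      unfolding wlen_def by (rule LeastI_ex)
    then obtain ws where ws: "set ws \<subseteq> \<phi> ` gens" "length ws = wlen (UTZ d) S (\<phi> ?x)" "wprod (UTZ d) ws = \<phi> ?x"
      using S_gens by (auto simp: words_of_def)
    have "ws \<in> lists (\<phi> ` gens)"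
      using ws(1) by (simp only: lists_eq_set mem_Collect_eq)
    then have "ws \<in> map \<phi> ` lists gens"
      by (simp only: lists_image)
    then obtain gs where gs: "set gs \<subseteq> gens" "ws = map \<phi> gs"
      by (auto simp: lists_eq_set)
    have gc: "set gs \<subseteq> carrier G"
      using gs gens by blast
    have "\<phi> (foldr (\<otimes>) gs \<one>) = \<phi> ?x"
      using ws(3) gs phi_wprod[OF gc] by simp
    \<comment> \<open>The equal matrices are compared in row \<open>i0\<close> and column
      \<open>j\<close>, where the negated i-th coordinate stands.\<close>
    then have "(of_int (coord i (foldr (\<otimes>) gs \<one>)) :: 'k) = of_int (coord i ?x)"
      using phi_entry[OF i0 i(1) j(1,2)] x foldr_mult_closed[OF gc] by (metis neg_equal_iff_equal)
    then have "coord i (foldr (\<otimes>) gs \<one>) = ?t"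
      using coord_xs_pow[OF i(1) i(1), of ?t] by simp
    then have "int N ^ Suc p \<le> B * (int (length gs) + 1) ^ c"
      using B(2)[OF gs(1)] by simp
    also have "\<dots> \<le> B * ((int (C * A) + 1) * int N) ^ c"
    proof (intro mult_left_mono power_mono B(1))
      have "int (length gs) \<le> int (C * A) * int N"
        using w ws(2) gs(2) by (simp flip: of_nat_mult add: mult.assoc)
      then show "int (length gs) + 1 \<le> (int (C * A) + 1) * int N"
        using N by (simp add: distrib_right)
    qed simp
    also have "\<dots> = D * int N ^ c"
      by (simp add: D_def power_mult_distrib)
    finally have "int N ^ Suc p \<le> D * int N ^ c"
      by simp
    moreover have "int N * int N ^ c \<le> int N ^ Suc p"
      using p(2) N by (simp add: power_increasing mult_left_mono)
    ultimately have "int N * int N ^ c \<le> D * int N ^ c"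
      by linarith
    then show ?thesis
      using N by (simp add: mult_le_cancel_right)
  qed
  have "int (nat \<bar>D\<bar> + 1) \<le> D"
    by (rule bound) simp
  then show False
    by simp
qed

end

theorem theorem4p3:
  fixes G :: "('a, 'b) monoid_scheme" and c :: nat and xs :: "'a list"
    and \<sigma> :: "nat \<Rightarrow> nat list" and \<phi> :: "'a \<Rightarrow> nat \<Rightarrow> nat \<Rightarrow> 'k::field_char_0"
  assumes "tau_group G"
    and "nil_class G c"
    and "\<exists>bs. free_abelian_basis G (Gamma G c) bs \<and> length bs \<ge> 2"
    and "malcev_basis G (c + 1) xs"
    and "jennings_ordering TYPE('k) G (c + 1) xs \<sigma>"
    and "\<phi> = jmat G (c + 1) xs \<sigma>"
  shows "\<not> undistorted (UTZ (card (jidx G (c + 1) xs)) :: (nat \<Rightarrow> nat \<Rightarrow> 'k) monoid) (\<phi> ` carrier G)"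
proof -
  interpret group G
    using assms(1) by (simp add: tau_group_def)
  interpret R: jennings_rep G c xs "TYPE('k)" \<sigma>
    by unfold_locales (use assms in auto)
  obtain bs where "free_abelian_basis G (Gamma G c) bs" "length bs \<ge> 2"
    using assms(3) by blast
  then show ?thesis
    using R.distorted by (simp add: R.\<phi>_def R.J_def assms(6))
qed

end
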